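(* Let $n\ge m\ge1$ and $1\le k\le n-1$. (i) If $1\le k\le n-m$, then the Radon transform $f\mapsto\hat f$ is injective on the Schwartz space $\mathcal S(\mathfrak M_{n,m})$, and $f$ can be recovered by the formula $$f(x)=\frac{2^{-m}}{(2\pi)^{nm}}\int_{\mathcal P_m}|r|^{\frac{n-m-1}2}dr\int_{V_{n,m}}\exp\!\big(-i\operatorname{tr}(x'vr^{1/2})\big)\,\big(\mathcal F[\hat f(g_v\xi_0,\cdot)]\big)(\xi_0'v_0r^{1/2})\,dv,$$ where $\xi_0=\begin{bmatrix}0\\ I_{n-k}\end{bmatrix}\in V_{n,n-k}$, $v_0=\begin{bmatrix}0\\ I_m\end{bmatrix}\in V_{n,m}$, $g_v\in SO(n)$ is a rotation with $g_vv_0=v$, and $\mathcal F$ is the Fourier transform on $\mathfrak M_{n-k,m}$ in the $t$-variable. (ii) If $k>n-m$, the Radon transform is non-injective on $\mathcal S(\mathfrak M_{n,m})$.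
   Context: $\mathfrak M_{n,m}$: real $n\times m$ matrices with Lebesgue measure; $x'$ transpose; $|a|$ absolute value of the determinant. $\mathcal P_m$: cone of positive definite symmetric $m\times m$ matrices, $dr=\prod_{i\le j}dr_{i,j}$. $V_{n,m}=\{v\in\mathfrak M_{n,m}:v'v=I_m\}$ with $O(n)$-invariant measure $dv$ of total mass $\sigma_{n,m}=2^m\pi^{nm/2}/\Gamma_m(n/2)$, $\Gamma_m(\alpha)=\pi^{m(m-1)/4}\prod_{j=0}^{m-1}\Gamma(\alpha-j/2)$. Fourier transform on $\mathfrak M_{q,m}$: $(\mathcal Fg)(y)=\int_{\mathfrak M_{q,m}}\exp(i\operatorname{tr}(y'x))g(x)\,dx$. Radon transform: for $\xi\in V_{n,n-k}$, $t\in\mathfrak M_{n-k,m}$, $\hat f(\xi,t)=\int_{\mathfrak M_{k,m}}f\left(g_\xi\begin{bmatrix}\omega\\ t\end{bmatrix}\right)d\omega$, where $g_\xi\in SO(n)$ is any rotation with $g_\xi\xi_0=\xi$ (integral of $f$ over the matrix plane $\{x\in\mathfrak M_{n,m}:\xi'x=t\}$). *)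

theory Defs
  imports "HOL-Analysis.Analysis"
begin

text \<open>
  The space of real $n \times m$ matrices is the type \<open>real^'m^'n\<close>, and Lebesgue measure on it
  is \<^const>\<open>lborel\<close>. The rows of an $n \times m$ matrix are split into a block of $k$ rows
  followed by a block of $n - k$ rows, so the row index type is a sum \<open>'k + 'l\<close> with
  \<open>CARD('k) = k\<close> and \<open>CARD('l) = n - k\<close>. Both summands being nonempty expresses
  $1 \le k \le n - 1$. Index types are linearly ordered where ``upper triangle'' or ``last rows''
  is meant.
\<close>

definition posdef_cone :: "(real^'m^'m) set" where
  "posdef_cone = {r. transpose r = r \<and> (\<forall>x. x \<noteq> 0 \<longrightarrow> x \<bullet> (r *v x) > 0)}"

definition posdef_sqrt :: "real^'m^'m \<Rightarrow> real^'m^'m" where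
  "posdef_sqrt r = (THE s. s \<in> posdef_cone \<and> s ** s = r)"

text \<open>
  The measure $\prod_{i \le j} dr_{i,j}$ on all symmetric matrices, i.e. Lebesgue measure in the
  entries of the upper triangle, transported to the matrices. This is not the Lebesgue measure
  induced by the Euclidean structure, from which it differs by a constant factor.
\<close>

definition sym_lborel :: "(real^'m::{finite,linorder}^'m::_) measure" where
  "sym_lborel = distr (PiM {(i, j). i \<le> j} (\<lambda>_. lborel)) borel
     (\<lambda>u. \<chi> i j. if i \<le> j then u (i, j) else u (j, i))"

definition stiefel :: "(real^'m^'n) set" where
  "stiefel = {v. transpose v ** v = mat 1}"

text \<open>The multivariate gamma function $\Gamma_m$.\<close>

definition multi_Gamma :: "nat \<Rightarrow> real \<Rightarrow> real" where
  "multi_Gamma m \<alpha> = pi powr (real (m * (m - 1)) / 4) * (\<Prod>j<m. Gamma (\<alpha> - real j / 2))"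

definition stiefel_mass :: "nat \<Rightarrow> nat \<Rightarrow> real" where
  "stiefel_mass n m = 2 ^ m * pi powr (real (n * m) / 2) / multi_Gamma m (real n / 2)"

text \<open>
  The $O(n)$-invariant Borel measure of total mass $\sigma_{n,m}$; it exists and is unique
  for $n \ge m$ because $O(n)$ is compact and acts transitively.
\<close>

definition stiefel_measure :: "(real^'m^'n) measure" where
  "stiefel_measure = (THE M.
     sets M = sets (restrict_space borel stiefel) \<and>
     (\<forall>g. orthogonal_matrix g \<longrightarrow> distr M M (\<lambda>v. g ** v) = M) \<and>
     emeasure M (space M) = ennreal (stiefel_mass CARD('n) CARD('m)))"

definition fourier :: "(real^'m^'q \<Rightarrow> complex) \<Rightarrow> real^'m^'q \<Rightarrow> complex" where
  "fourier g y = (LINT x|lborel. exp (\<i> * of_real (trace (transpose y ** x))) * g x)"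

definition partial_deriv ::
    "'a::euclidean_space \<Rightarrow> ('a \<Rightarrow> 'b::real_normed_vector) \<Rightarrow> 'a \<Rightarrow> 'b" where
  "partial_deriv b f = (\<lambda>x. frechet_derivative f (at x) b)"

text \<open>
  A list of basis vectors plays the role of a multi-index: \<open>foldr partial_deriv bs f\<close> is an
  iterated partial derivative of \<open>f\<close>. Requiring all of them to be differentiable everywhere
  says that \<open>f\<close> is smooth.
\<close>

definition schwartz :: "('a::euclidean_space \<Rightarrow> 'b::real_normed_vector) set" where
  "schwartz = {f. \<forall>bs \<in> lists Basis.
     (\<forall>x. foldr partial_deriv bs f differentiable (at x)) \<and>
     (\<forall>N::nat. \<exists>C. \<forall>x. (1 + norm x) ^ N * norm (foldr partial_deriv bs f x) \<le> C)}"

text \<open>The block matrices $[\omega; t]$ and $\xi_0 = [0; I_{n-k}]$.\<close>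

definition vstack :: "real^'m^'k::_ \<Rightarrow> real^'m^'l::_ \<Rightarrow> real^'m^('k::finite + 'l::finite)" where
  "vstack \<omega> t = (\<chi> i. case i of Inl a \<Rightarrow> \<omega> $ a | Inr b \<Rightarrow> t $ b)"

definition xi0 :: "real^'l::_^('k::finite + 'l::finite)" where
  "xi0 = vstack 0 (mat 1)"

text \<open>
  For $v_0 = [0; I_m]$ the identity block occupies the last $m$ rows, so row and column indices
  are matched by their positions counted from the end (all rows \<open>Inl a\<close> precede all
  rows \<open>Inr b\<close>). This is the intended matrix whenever $m \le n$.
\<close>

definition col_from_end :: "'m::{finite,linorder} \<Rightarrow> nat" where
  "col_from_end j = card {j'. j < j'}"

definition row_from_end :: "'k::{finite,linorder} + 'l::{finite,linorder} \<Rightarrow> nat" where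
  "row_from_end i = (case i of
     Inl a \<Rightarrow> card {a'. a < a'} + CARD('l)
   | Inr b \<Rightarrow> card {b'. b < b'})"

definition v0 ::
    "real^'m::{finite,linorder}^('k::{finite,linorder} + 'l::{finite,linorder})" where
  "v0 = (\<chi> i j. if row_from_end i = col_from_end j then 1 else 0)"

text \<open>
  The value of the Radon transform does not depend on the choice of the rotation. The transform
  is a function on \<open>stiefel \<times> UNIV\<close> only, hence the restricted abstraction, which makes equality
  of transforms mean equality on that domain.
\<close>

definition radon ::
    "(real^'m^('k::finite + 'l::finite) \<Rightarrow> complex) \<Rightarrow>
     (real^'l::_^('k::_ + 'l::_)) \<times> (real^'m^'l::_) \<Rightarrow> complex" where
  "radon f = (\<lambda>(\<xi>, t) \<in> stiefel \<times> UNIV.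
     LINT \<omega>|lborel. f ((SOME g. rotation_matrix g \<and> g ** xi0 = \<xi>) ** vstack \<omega> t))"

end

theory Submission
  imports Defs "HOL-Probability.Probability"
begin

text \<open>
  By the projection-slice identity, the Fourier transform of \<open>t \<mapsto> radon f (\<xi>, t)\<close> at \<open>y\<close> is the
  Fourier transform of \<open>f\<close> at \<open>\<xi> y\<close>. If \<open>m \<le> n - k\<close>, every \<open>n \<times> m\<close> matrix has the form
  \<open>\<xi> y\<close>, and the inversion formula is Fourier inversion written in polar coordinates \<open>v r\<^sup>1\<^sup>/\<^sup>2\<close>.
  The polar coordinate formula follows from the distribution of the Gram matrix \<open>y' y\<close> under
  Lebesgue measure, which is computed by adding the columns of \<open>y\<close> one at a time, and from
  averaging over \<open>O(n)\<close>. The averages are taken over the orthogonal polar factor of a matrix that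
  is uniformly distributed in a ball, which also gives existence and uniqueness of the invariant
  measure.

  If \<open>m > n - k\<close>, let \<open>f x\<close> be a fixed \<open>m \<times> m\<close> minor of \<open>x\<close> times a Gaussian. Then \<open>f\<close> is odd
  under \<open>x \<mapsto> x \<rho>\<close> for every reflection \<open>\<rho>\<close> of \<open>\<real>\<^sup>m\<close>. Each \<open>t\<close> has a nonzero kernel vector, so it is
  fixed by some such \<open>\<rho>\<close>, and the integral over the matrix plane equals its own negative.
\<close>

section \<open>Linear maps and Lebesgue measure\<close>

text \<open>The measure on the Stiefel manifold enters through a definite description, so nothing
  can be said about it before existence and uniqueness are known, and a direct Jacobian of
  \<open>y = v r\<^sup>1\<^sup>/\<^sup>2\<close> would need calculus on that manifold. Both
  difficulties are avoided by never differentiating the polar map: only the Gram matrix needs a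
  density. One further column contributes a linear substitution, with factor
  \<open>1 / sqrt D\<close> for the previous Gram determinant \<open>D\<close>, and the law of a
  squared norm in the remaining q dimensions, with constant \<pi>^(q/2) / \<Gamma>(q/2), half the
  area of a unit sphere. The product of these constants over q = n, ..., n-m+1 is \<sigma>_(n,m) /
  2^m, which is the origin of the factor 2^(-m); the powers of the successive determinants combine
  to the exponent (n-m-1)/2. In the injective case k \<ge> 1 forces m < n. The spare dimension
  allows the sign of a determinant to be corrected, so frames can be moved onto each other by
  rotations and not merely by orthogonal matrices.\<close>

lemma nn_integral_lborel_translate:
  fixes f :: "'a::euclidean_space \<Rightarrow> ennreal"
  assumes [measurable]: "f \<in> borel_measurable borel"
  shows "(\<integral>\<^sup>+x. f (x + a) \<partial>lborel) = (\<integral>\<^sup>+x. f x \<partial>lborel)"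
proof -
  have "(\<integral>\<^sup>+x. f x \<partial>lborel) = (\<integral>\<^sup>+x. f x \<partial>distr lborel borel ((+) a))"
    by (simp add: lborel_distr_plus)
  also have "\<dots> = (\<integral>\<^sup>+x. f (x + a) \<partial>lborel)"
    by (subst nn_integral_distr) (auto simp: add.commute)
  finally show ?thesis ..
qed

lemma nn_integral_lborel_uminus:
  fixes f :: "'a::euclidean_space \<Rightarrow> ennreal"
  assumes [measurable]: "f \<in> borel_measurable borel"
  shows "(\<integral>\<^sup>+x. f (- x) \<partial>lborel) = (\<integral>\<^sup>+x. f x \<partial>lborel)"
proof -
  have "(lborel :: 'a measure) = density (distr lborel borel (\<lambda>x. 0 + (-1) *\<^sub>R x)) (\<lambda>_. \<bar>-1 :: real\<bar> ^ DIM('a))"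
    by (rule lborel_affine) simp
  hence "(lborel :: 'a measure) = distr lborel borel uminus"
    by (simp add: density_1 fun_eq_iff)
  hence "(\<integral>\<^sup>+x. f x \<partial>lborel) = (\<integral>\<^sup>+x. f x \<partial>distr lborel borel uminus)" by simp
  also have "\<dots> = (\<integral>\<^sup>+x. f (- x) \<partial>lborel)"
    by (subst nn_integral_distr) auto
  finally show ?thesis ..
qed

text \<open>Both sides arise from \<open>\<integral>\<integral> g (x + y) f y \<partial>\<mu> y \<partial>x\<close> by translating either \<open>x\<close> or \<open>y\<close>.\<close>

lemma translation_invariant_nn_integral:
  fixes M :: "'a::euclidean_space measure"
  assumes sf: "sigma_finite_measure M" and [measurable_cong]: "sets M = sets borel"
    and inv: "\<And>f a. f \<in> borel_measurable borel \<Longrightarrow> (\<integral>\<^sup>+x. f (x + a) \<partial>M) = (\<integral>\<^sup>+x. f x \<partial>M)"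
    and [measurable]: "f \<in> borel_measurable borel" "g \<in> borel_measurable borel"
  shows "(\<integral>\<^sup>+x. g x \<partial>lborel) * (\<integral>\<^sup>+x. f x \<partial>M) = (\<integral>\<^sup>+x. f x \<partial>lborel) * (\<integral>\<^sup>+x. g x \<partial>M)"
proof -
  interpret sigma_finite_measure M by fact
  interpret P: pair_sigma_finite lborel M
    by (intro pair_sigma_finite.intro sf sigma_finite_lborel)
  have "(\<integral>\<^sup>+x. g x \<partial>lborel) * (\<integral>\<^sup>+y. f y \<partial>M) = (\<integral>\<^sup>+y. (\<integral>\<^sup>+x. g x \<partial>lborel) * f y \<partial>M)"
    by (simp add: nn_integral_cmult)
  also have "\<dots> = (\<integral>\<^sup>+y. (\<integral>\<^sup>+x. g (x + y) * f y \<partial>lborel) \<partial>M)"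
    by (intro nn_integral_cong)
       (simp add: nn_integral_multc nn_integral_lborel_translate)
  also have "\<dots> = (\<integral>\<^sup>+x. (\<integral>\<^sup>+y. g (x + y) * f y \<partial>M) \<partial>lborel)"
    by (rule P.Fubini') measurable
  also have "\<dots> = (\<integral>\<^sup>+x. (\<integral>\<^sup>+y. g y * f (y - x) \<partial>M) \<partial>lborel)"
  proof (rule nn_integral_cong)
    fix x :: 'a
    have "(\<integral>\<^sup>+y. g y * f (y - x) \<partial>M) = (\<integral>\<^sup>+y. g (y + x) * f (y + x - x) \<partial>M)"
      by (rule inv[symmetric]) measurable
    thus "(\<integral>\<^sup>+y. g (x + y) * f y \<partial>M) = (\<integral>\<^sup>+y. g y * f (y - x) \<partial>M)"
      by (simp add: add.commute)
  qed
  also have "\<dots> = (\<integral>\<^sup>+y. (\<integral>\<^sup>+x. g y * f (y - x) \<partial>lborel) \<partial>M)"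
    by (rule P.Fubini'[symmetric]) measurable
  also have "\<dots> = (\<integral>\<^sup>+y. g y * (\<integral>\<^sup>+x. f x \<partial>lborel) \<partial>M)"
  proof (rule nn_integral_cong)
    fix y :: 'a
    have "(\<integral>\<^sup>+x. f (y - x) \<partial>lborel) = (\<integral>\<^sup>+x. f (y + x) \<partial>lborel)"
      using nn_integral_lborel_uminus[of "\<lambda>x. f (y + x)"] by simp
    also have "\<dots> = (\<integral>\<^sup>+x. f x \<partial>lborel)"
      using nn_integral_lborel_translate[of f y] by (simp add: add.commute)
    finally show "(\<integral>\<^sup>+x. g y * f (y - x) \<partial>lborel) = g y * (\<integral>\<^sup>+x. f x \<partial>lborel)"
      by (simp add: nn_integral_cmult)
  qed
  also have "\<dots> = (\<integral>\<^sup>+x. f x \<partial>lborel) * (\<integral>\<^sup>+y. g y \<partial>M)"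
    by (simp add: nn_integral_multc mult.commute)
  finally show ?thesis .
qed

lemma borel_measurable_linear:
  fixes T :: "'a::euclidean_space \<Rightarrow> 'b::euclidean_space"
  assumes "linear T" shows "T \<in> borel_measurable borel"
  using assms by (intro borel_measurable_continuous_onI linear_continuous_on) (simp add: linear_conv_bounded_linear)

text \<open>The identity with \<open>f\<close> the indicator of the unit ball measures the scaling factor of a linear map.\<close>

lemma nn_integral_lborel_linear:
  fixes T :: "'a::euclidean_space \<Rightarrow> 'a"
  assumes T: "linear T" "inj T" and [measurable]: "f \<in> borel_measurable borel" "g \<in> borel_measurable borel"
  shows "(\<integral>\<^sup>+x. g x \<partial>lborel) * (\<integral>\<^sup>+x. f (T x) \<partial>lborel) = (\<integral>\<^sup>+x. f x \<partial>lborel) * (\<integral>\<^sup>+x. g (T x) \<partial>lborel)"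
proof -
  note [measurable] = borel_measurable_linear[OF T(1)]
  let ?M = "distr lborel borel T"
  have surj: "surj T" using T by (simp add: linear_injective_imp_surjective)
  obtain S where S: "linear S" "S \<circ> T = id" "T \<circ> S = id"
    using T surj by (metis linear_injective_isomorphism comp_def eq_id_iff)
  have SS: "S (T x) = x" "T (S x) = x" for x using S by (auto simp: fun_eq_iff)
  note [measurable] = borel_measurable_linear[OF S(1)]
  have "sigma_finite_measure (distr ?M lborel S)"
    by (simp add: distr_distr comp_def SS distr_id2 sigma_finite_lborel)
  hence sf: "sigma_finite_measure ?M"
    by (rule sigma_finite_measure_distr) simp
  have "(\<integral>\<^sup>+x. g x \<partial>lborel) * (\<integral>\<^sup>+x. f x \<partial>?M) = (\<integral>\<^sup>+x. f x \<partial>lborel) * (\<integral>\<^sup>+x. g x \<partial>?M)"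
  proof (rule translation_invariant_nn_integral[OF sf])
    fix h :: "'a \<Rightarrow> ennreal" and a :: 'a
    assume [measurable]: "h \<in> borel_measurable borel"
    have "(\<integral>\<^sup>+x. h (x + a) \<partial>?M) = (\<integral>\<^sup>+x. h (T (x + S a)) \<partial>lborel)"
      by (simp add: nn_integral_distr linear_add[OF T(1)] SS)
    also have "\<dots> = (\<integral>\<^sup>+x. h (T x) \<partial>lborel)"
      by (rule nn_integral_lborel_translate) measurable
    finally show "(\<integral>\<^sup>+x. h (x + a) \<partial>?M) = (\<integral>\<^sup>+x. h x \<partial>?M)" by (simp add: nn_integral_distr)
  qed auto
  thus ?thesis by (simp add: nn_integral_distr)
qed

lemma emeasure_lborel_ball_pos: "r > 0 \<Longrightarrow> emeasure lborel (ball (c::'a::euclidean_space) r) \<noteq> 0"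
  by (metis emeasure_ball less_numeral_extra(3) ennreal_eq_0_iff less_eq_real_def linorder_not_le unit_ball_vol_pos of_nat_0_le_iff mult_pos_pos zero_less_power)

text \<open>\<open>T\<close> preserves the unit ball, so taking the ball as reference set in the
  scaling identity leaves its volume as a factor on both sides; the volume is finite and nonzero and
  cancels.\<close>

lemma lborel_distr_orthogonal:
  fixes T :: "'a::euclidean_space \<Rightarrow> 'a"
  assumes T: "orthogonal_transformation T"
  shows "distr lborel borel T = lborel"
proof -
  have lin: "linear T" and inj: "inj T"
    using T by (auto simp: orthogonal_transformation_linear orthogonal_transformation_inj)
  note [measurable] = borel_measurable_linear[OF lin]
  let ?B = "ball (0::'a) 1"
  have B: "(\<integral>\<^sup>+x. indicator ?B x \<partial>lborel) = emeasure lborel ?B" by simp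
  have "(\<integral>\<^sup>+x. indicator ?B (T x) \<partial>lborel) = (\<integral>\<^sup>+x. indicator ?B x \<partial>lborel)"
    using T by (intro nn_integral_cong) (auto simp: indicator_def orthogonal_transformation_norm)
  hence *: "emeasure lborel ?B * (\<integral>\<^sup>+x. g (T x) \<partial>lborel) = emeasure lborel ?B * (\<integral>\<^sup>+x. g x \<partial>lborel)"
    if [measurable]: "g \<in> borel_measurable borel" for g
    using nn_integral_lborel_linear[OF lin inj borel_measurable_indicator that, of ?B] by (simp add: mult.commute)
  have fin: "emeasure lborel ?B \<noteq> \<infinity>" by (simp add: emeasure_ball)
  show ?thesis
  proof (rule measure_eqI)
    fix A assume "A \<in> sets (distr lborel borel T)"
    hence [measurable]: "A \<in> sets borel" by simp
    have "emeasure (distr lborel borel T) A = (\<integral>\<^sup>+x. indicator A (T x) \<partial>lborel)"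
      by (simp add: nn_integral_distr flip: nn_integral_indicator)
    also have "\<dots> = (\<integral>\<^sup>+x. indicator A x \<partial>lborel)"
      using *[of "indicator A"] fin emeasure_lborel_ball_pos[of 1 "0::'a"]
      by (simp add: ennreal_mult_cancel_left)
    finally show "emeasure (distr lborel borel T) A = emeasure lborel A" by simp
  qed simp
qed

lemma nn_integral_lborel_orthogonal:
  fixes T :: "'a::euclidean_space \<Rightarrow> 'a"
  assumes T: "orthogonal_transformation T" and [measurable]: "f \<in> borel_measurable borel"
  shows "(\<integral>\<^sup>+x. f (T x) \<partial>lborel) = (\<integral>\<^sup>+x. f x \<partial>lborel)"
proof -
  note [measurable] = borel_measurable_linear[OF orthogonal_transformation_linear[OF T]]
  show ?thesis
    by (subst (2) lborel_distr_orthogonal[OF T, symmetric]) (simp add: nn_integral_distr)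
qed

text \<open>Holds for every \<open>f\<close>: composing with the inverse transfers measurability, so
  a non-measurable \<open>f\<close> makes both Bochner integrals take the default value 0. Plane
  integrals can thus be transformed without a measurability proof.\<close>

lemma integral_lborel_orthogonal:
  fixes T :: "'a::euclidean_space \<Rightarrow> 'a" and f :: "'a \<Rightarrow> 'b::{banach,second_countable_topology}"
  assumes T: "orthogonal_transformation T"
  shows "(\<integral>x. f (T x) \<partial>lborel) = (\<integral>x. f x \<partial>lborel)"
proof -
  have lin: "linear T" using T by (rule orthogonal_transformation_linear)
  obtain S where S: "orthogonal_transformation S" "\<And>x. S (T x) = x" "\<And>x. T (S x) = x"
    using T orthogonal_transformation_inv orthogonal_transformation_bij
    by (metis bij_inv_eq_iff)
  note [measurable] = borel_measurable_linear[OF lin]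
    borel_measurable_linear[OF orthogonal_transformation_linear[OF S(1)]]
  show ?thesis
  proof (cases "f \<in> borel_measurable borel")
    case [measurable]: True
    show ?thesis
      by (subst (2) lborel_distr_orthogonal[OF T, symmetric]) (simp add: integral_distr)
  next
    case False
    hence "(\<lambda>x. f (T x)) \<notin> borel_measurable borel"
      using measurable_compose[of S borel borel "\<lambda>x. f (T x)" borel] by (auto simp: S)
    with False show ?thesis
      by (simp add: not_integrable_integral_eq integrable_iff_bounded)
  qed
qed

section \<open>The trace form on matrices\<close>

lemma inner_matrix_columns:
  fixes x y :: "real^'m^'n"
  shows "x \<bullet> y = (\<Sum>j\<in>UNIV. column j x \<bullet> column j y)"
  unfolding inner_vec_def column_def by (simp) (rule sum.swap)

text \<open>Identifies the matrix kernel exp(i tr(y'x)) with the Euclidean one, so that Fourier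
  inversion can be carried out on an arbitrary Euclidean space.\<close>

lemma trace_transpose_mult_eq_inner:
  fixes x y :: "real^'m^'n"
  shows "trace (transpose y ** x) = y \<bullet> x"
  by (simp add: trace_def transpose_def matrix_matrix_mult_def inner_vec_def) (rule sum.swap)

lemma inner_matrix_mult_left:
  fixes x :: "real^'m^'n" and y :: "real^'m^'p" and g :: "real^'p^'n"
  shows "x \<bullet> (g ** y) = (transpose g ** x) \<bullet> y"
  by (simp add: trace_transpose_mult_eq_inner[symmetric] matrix_transpose_mul matrix_mul_assoc)

lemma inner_matrix_mult_right:
  fixes x :: "real^'m^'n" and y :: "real^'p^'n" and s :: "real^'m^'p"
  shows "x \<bullet> (y ** s) = (x ** transpose s) \<bullet> y"
  by (metis (no_types, lifting) inner_commute matrix_mul_assoc matrix_transpose_mul trace_mul_sym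
      trace_transpose_mult_eq_inner transpose_transpose)

lemma orthogonal_transformation_matrix_left:
  fixes g :: "real^'n^'n"
  assumes "orthogonal_matrix g"
  shows "orthogonal_transformation (\<lambda>x::real^'m^'n. g ** x)"
  unfolding orthogonal_transformation_def
proof
  show "linear (\<lambda>x::real^'m^'n. g ** x)"
    by (intro linearI) (auto simp: vec_eq_iff matrix_matrix_mult_def sum_distrib_left sum.distrib algebra_simps)
  show "\<forall>v w. (g ** v) \<bullet> (g ** w) = v \<bullet> (w::real^'m^'n)"
    using assms by (simp add: inner_matrix_mult_left matrix_mul_assoc orthogonal_matrix)
qed

lemma orthogonal_transformation_matrix_right:
  fixes g :: "real^'m^'m"
  assumes "orthogonal_matrix g"
  shows "orthogonal_transformation (\<lambda>x::real^'m^'n. x ** g)"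
  unfolding orthogonal_transformation_def
proof
  show "linear (\<lambda>x::real^'m^'n. x ** g)"
    by (intro linearI) (auto simp: vec_eq_iff matrix_matrix_mult_def sum_distrib_left sum.distrib algebra_simps)
  show "\<forall>v w. (v ** g) \<bullet> (w ** g) = v \<bullet> (w::real^'m^'n)"
    using assms by (simp add: inner_matrix_mult_right orthogonal_matrix_def flip: matrix_mul_assoc)
qed

section \<open>Fourier inversion for Schwartz functions\<close>

lemma schwartz_decay:
  assumes "f \<in> schwartz" "bs \<in> lists Basis"
  shows "\<exists>C. \<forall>x. (1 + norm x) ^ N * norm (foldr partial_deriv bs f x) \<le> C"
  using assms unfolding schwartz_def by blast

lemma schwartz_differentiable:
  assumes "f \<in> schwartz" "bs \<in> lists Basis"
  shows "foldr partial_deriv bs f differentiable (at x)"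
  using assms unfolding schwartz_def by blast

text \<open>The extra derivative acts first, which in a \<open>foldr\<close> multi-index means that
  \<open>b\<close> is appended at the end.\<close>

lemma schwartz_partial_deriv:
  fixes f :: "'a::euclidean_space \<Rightarrow> 'b::real_normed_vector"
  assumes "f \<in> schwartz" "b \<in> Basis"
  shows "partial_deriv b f \<in> schwartz"
proof -
  have "foldr partial_deriv bs (partial_deriv b f) = foldr partial_deriv (bs @ [b]) f" for bs by simp
  moreover have "bs @ [b] \<in> lists Basis" if "bs \<in> lists Basis" for bs :: "'a list" using that assms(2) by simp
  ultimately show ?thesis using assms(1) unfolding schwartz_def mem_Collect_eq by (metis (no_types, lifting))
qed

lemma schwartz_continuous_on: "f \<in> schwartz \<Longrightarrow> continuous_on S f"
  using schwartz_differentiable[of f "[]"]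
  by (auto intro!: continuous_at_imp_continuous_on differentiable_imp_continuous_within)

lemma schwartz_borel_measurable [measurable_dest]:
  "f \<in> schwartz \<Longrightarrow> f \<in> borel_measurable borel" for f :: "'a::euclidean_space \<Rightarrow> 'b::real_normed_vector"
  by (intro borel_measurable_continuous_onI schwartz_continuous_on)

lemma
  fixes h :: "'a::euclidean_space \<Rightarrow> real \<Rightarrow> 'b::{real_normed_field,banach,second_countable_topology}"
  assumes "\<And>b. b \<in> Basis \<Longrightarrow> integrable lborel (h b)"
  shows lborel_integral_prod_Basis: "(\<integral>x. (\<Prod>b\<in>Basis. h b (x \<bullet> b)) \<partial>lborel) = (\<Prod>b\<in>Basis. \<integral>t. h b t \<partial>lborel)"
    and lborel_integrable_prod_Basis: "integrable lborel (\<lambda>x. \<Prod>b\<in>Basis. h b (x \<bullet> b))"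
proof -
  interpret product_sigma_finite "\<lambda>_::'a. lborel :: real measure" by standard
  have [measurable]: "\<And>b. b \<in> Basis \<Longrightarrow> h b \<in> borel_measurable borel" using assms by auto
  let ?T = "\<lambda>f::'a\<Rightarrow>real. \<Sum>b\<in>Basis. f b *\<^sub>R b"
  have eq: "(\<Prod>b\<in>Basis. h b (?T f \<bullet> b)) = (\<Prod>b\<in>Basis. h b (f b))" for f
    by (intro prod.cong) auto
  have "integrable (\<Pi>\<^sub>M b\<in>Basis. lborel) (\<lambda>f. \<Prod>b\<in>Basis. h b (f b))"
    by (intro product_integrable_prod assms) simp
  thus "integrable lborel (\<lambda>x. \<Prod>b\<in>Basis. h b (x \<bullet> b))"
    unfolding lborel_def[where 'a='a] by (simp add: integrable_distr_eq eq flip: lborel_eq_real)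
  show "(\<integral>x. (\<Prod>b\<in>Basis. h b (x \<bullet> b)) \<partial>lborel) = (\<Prod>b\<in>Basis. \<integral>t. h b t \<partial>lborel)"
    unfolding lborel_def[where 'a='a]
    by (simp add: integral_distr eq product_integral_prod assms flip: lborel_eq_real)
qed

section \<open>Polynomial decay and integrability\<close>

lemma integrable_inverse_one_plus_square: "integrable lborel (\<lambda>t::real. 1 / (1 + t\<^sup>2))"
proof -
  have "set_integrable lborel (einterval (- \<infinity>) \<infinity>) (\<lambda>t::real. 1 / (1 + t\<^sup>2))"
  proof (rule interval_integral_FTC_nonneg(1)[where F = arctan and A = "- (pi/2)" and B = "pi/2"])
    show "DERIV arctan x :> 1 / (1 + x\<^sup>2)" for x
      using DERIV_arctan[of x] by (simp add: inverse_eq_divide)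
    show "isCont (\<lambda>t::real. 1 / (1 + t\<^sup>2)) x" for x
      by (intro continuous_intros) (use sum_power2_gt_zero_iff[of 1 x] in auto)
    show "((arctan \<circ> real_of_ereal) \<longlongrightarrow> - (pi/2)) (at_right (-\<infinity>))"
      by (simp add: ereal_tendsto_simps tendsto_arctan_at_bot)
    show "((arctan \<circ> real_of_ereal) \<longlongrightarrow> pi/2) (at_left \<infinity>)"
      by (simp add: ereal_tendsto_simps tendsto_arctan_at_top)
  qed auto
  thus ?thesis by (simp add: set_integrable_def einterval_def)
qed

lemma integrable_prod_inverse_one_plus_square:
  "integrable lborel (\<lambda>x::'a::euclidean_space. \<Prod>b\<in>Basis. 1 / (1 + (x \<bullet> b)\<^sup>2))"
  by (rule lborel_integrable_prod_Basis) (rule integrable_inverse_one_plus_square)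

text \<open>Trades radial decay for a product of one-dimensional kernels 1/(1+t^2), which are
  integrable through the arctangent. Every coordinate costs two powers, whence the exponent
  \<open>2 * DIM('a)\<close> in the decay bounds.\<close>

lemma one_plus_norm_power_ge_prod:
  fixes x :: "'a::euclidean_space"
  shows "(\<Prod>b\<in>Basis. 1 + (x \<bullet> b)\<^sup>2) \<le> (1 + norm x) ^ (2 * DIM('a))"
proof -
  have "(\<Prod>b\<in>Basis. 1 + (x \<bullet> b)\<^sup>2) \<le> (\<Prod>b\<in>(Basis::'a set). (1 + norm x)\<^sup>2)"
  proof (rule prod_mono)
    fix b :: 'a assume b: "b \<in> Basis"
    have "(x \<bullet> b)\<^sup>2 \<le> (norm x)\<^sup>2" using Basis_le_norm[OF b, of x] by (simp add: abs_le_square_iff[symmetric])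
    thus "0 \<le> 1 + (x \<bullet> b)\<^sup>2 \<and> 1 + (x \<bullet> b)\<^sup>2 \<le> (1 + norm x)\<^sup>2"
      by (simp add: power2_sum add_increasing2)
  qed
  thus ?thesis by (simp add: power_mult)
qed

lemma decay_integrable:
  fixes f :: "'a::euclidean_space \<Rightarrow> 'b::{banach,second_countable_topology}"
  assumes [measurable]: "f \<in> borel_measurable borel"
    and C: "\<And>x. (1 + norm x) ^ (2 * DIM('a)) * norm (f x) \<le> C"
  shows "integrable lborel f"
proof (rule Bochner_Integration.integrable_bound)
  show "integrable lborel (\<lambda>x::'a. C * (\<Prod>b\<in>Basis. 1 / (1 + (x \<bullet> b)\<^sup>2)))"
    by (intro integrable_mult_right integrable_prod_inverse_one_plus_square)
  show "AE x in lborel. norm (f x) \<le> norm (C * (\<Prod>b\<in>Basis. 1 / (1 + (x \<bullet> b)\<^sup>2)))"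
  proof (rule AE_I2)
    fix x :: 'a
    let ?p = "\<Prod>b\<in>Basis. 1 + (x \<bullet> b)\<^sup>2"
    have p: "?p > 0" by (intro prod_pos) (auto simp: add_pos_nonneg)
    have "?p * norm (f x) \<le> C"
      using mult_right_mono[OF one_plus_norm_power_ge_prod[of x] norm_ge_zero[of "f x"]] C[of x] by linarith
    hence "norm (f x) \<le> C / ?p" using p by (simp add: field_simps)
    also have "\<dots> \<le> norm (C * (\<Prod>b\<in>Basis. 1 / (1 + (x \<bullet> b)\<^sup>2)))"
      using p by (simp add: prod_dividef divide_right_mono)
    finally show "norm (f x) \<le> norm (C * (\<Prod>b\<in>Basis. 1 / (1 + (x \<bullet> b)\<^sup>2)))" .
  qed
qed simp

lemma schwartz_integrable:
  fixes f :: "'a::euclidean_space \<Rightarrow> 'b::{banach,second_countable_topology}"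
  assumes f: "f \<in> schwartz" shows "integrable lborel f"
  using schwartz_decay[OF f, of "[]" "2 * DIM('a)"] f by (auto intro: decay_integrable)

section \<open>The Fourier transform of Schwartz functions\<close>

definition fourier_transform :: "('a::euclidean_space \<Rightarrow> complex) \<Rightarrow> 'a \<Rightarrow> complex" where
  "fourier_transform f y = (\<integral>x. cis (y \<bullet> x) * f x \<partial>lborel)"

lemma cis_inner_measurable [measurable]: "(\<lambda>x::'a::euclidean_space. cis (y \<bullet> x)) \<in> borel_measurable borel"
  by (intro borel_measurable_continuous_onI continuous_intros)

lemma integrable_cis_mult:
  fixes f :: "'a::euclidean_space \<Rightarrow> complex"
  assumes "integrable lborel f" shows "integrable lborel (\<lambda>x. cis (y \<bullet> x) * f x)"
  by (rule Bochner_Integration.integrable_bound[OF assms]) (use assms in \<open>auto simp: norm_mult\<close>)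

lemma norm_fourier_transform_le:
  fixes f :: "'a::euclidean_space \<Rightarrow> complex"
  shows "norm (fourier_transform f y) \<le> (\<integral>x. norm (f x) \<partial>lborel)"
  unfolding fourier_transform_def
  using integral_norm_bound[of lborel "\<lambda>x. cis (y \<bullet> x) * f x"] by (simp add: norm_mult)

lemma fourier_transform_translate:
  fixes f :: "'a::euclidean_space \<Rightarrow> complex"
  assumes "integrable lborel f"
  shows "fourier_transform (\<lambda>x. f (x + a)) y = cis (- (y \<bullet> a)) * fourier_transform f y"
proof -
  have [measurable]: "f \<in> borel_measurable borel" using assms by auto
  have "fourier_transform f y = (\<integral>x. cis (y \<bullet> x) * f x \<partial>distr lborel borel ((+) a))"
    by (simp add: lborel_distr_plus fourier_transform_def)
  also have "\<dots> = (\<integral>x. cis (y \<bullet> a) * (cis (y \<bullet> x) * f (x + a)) \<partial>lborel)"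
    by (subst integral_distr) (auto simp: inner_add_right cis_mult mult_ac add_ac simp flip: mult.assoc)
  also have "\<dots> = cis (y \<bullet> a) * fourier_transform (\<lambda>x. f (x + a)) y"
    by (simp add: fourier_transform_def)
  finally show ?thesis by (simp add: cis_mult flip: mult.assoc)
qed

text \<open>Sequential form of the derivative, as dominated convergence is applied along a positive
  null sequence of increments.\<close>

lemma difference_quotient_tendsto:
  fixes \<phi> :: "real \<Rightarrow> complex"
  assumes "(\<phi> has_vector_derivative D) (at 0)" "\<And>n. h n > 0" "h \<longlonglongrightarrow> 0"
  shows "(\<lambda>n. (\<phi> (h n) - \<phi> 0) / h n) \<longlonglongrightarrow> D"
proof -
  have "((\<lambda>t. norm (\<phi> t - \<phi> 0 - t *\<^sub>R D) / norm t) \<longlongrightarrow> 0) (at 0)"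
    using assms(1) by (simp add: has_vector_derivative_def has_derivative_iff_norm)
  moreover have "filterlim h (at 0) sequentially"
    using assms(2,3) by (simp add: filterlim_at less_imp_neq[symmetric] eventually_sequentially)
  ultimately have "(\<lambda>n. norm (\<phi> (h n) - \<phi> 0 - h n *\<^sub>R D) / norm (h n)) \<longlonglongrightarrow> 0"
    by (rule filterlim_compose)
  moreover have "norm (\<phi> (h n) - \<phi> 0 - h n *\<^sub>R D) / norm (h n) = norm ((\<phi> (h n) - \<phi> 0) / h n - D)" for n
  proof -
    have "(\<phi> (h n) - \<phi> 0) / h n - D = (\<phi> (h n) - \<phi> 0 - h n *\<^sub>R D) / h n"
      using assms(2)[of n] by (simp add: diff_divide_distrib scaleR_conv_of_real)
    thus ?thesis by (simp add: norm_divide)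
  qed
  ultimately show ?thesis by (simp add: LIM_zero_iff tendsto_norm_zero_iff)
qed

lemma lborel_integrable_translate:
  fixes f :: "'a::euclidean_space \<Rightarrow> 'b::{banach,second_countable_topology}"
  assumes "integrable lborel f" shows "integrable lborel (\<lambda>x. f (x + a))"
proof -
  have [measurable]: "f \<in> borel_measurable borel" using assms by auto
  have "integrable (distr lborel borel ((+) a)) f" using assms by (simp add: lborel_distr_plus)
  thus ?thesis by (simp add: integrable_distr_eq add.commute)
qed

text \<open>Fourier transform of the difference quotient; the derivative bound makes dominated convergence applicable.\<close>

lemma fourier_transform_partial_deriv:
  fixes f :: "'a::euclidean_space \<Rightarrow> complex"
  assumes f: "f \<in> schwartz" and b: "b \<in> Basis"
  shows "fourier_transform (partial_deriv b f) y = - \<i> * (y \<bullet> b) * fourier_transform f y"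
proof -
  define d where "d = partial_deriv b f"
  have int: "integrable lborel f" "integrable lborel d"
    using f b by (auto simp: d_def intro!: schwartz_integrable schwartz_partial_deriv)
  have [measurable]: "f \<in> borel_measurable borel" "d \<in> borel_measurable borel" using int by auto
  have deriv: "((\<lambda>t. f (x + t *\<^sub>R b)) has_vector_derivative d (x + t *\<^sub>R b)) (at t within S)" for x t S
  proof -
    have "(f has_derivative frechet_derivative f (at (x + t *\<^sub>R b))) (at (x + t *\<^sub>R b))"
      using schwartz_differentiable[OF f, of "[]"] by (simp add: frechet_derivative_works)
    moreover have "((\<lambda>t. x + t *\<^sub>R b) has_derivative (\<lambda>s. s *\<^sub>R b)) (at t within S)"
      by (auto intro!: derivative_eq_intros)
    ultimately have *: "((\<lambda>t. f (x + t *\<^sub>R b)) has_derivative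
        (\<lambda>s. frechet_derivative f (at (x + t *\<^sub>R b)) (s *\<^sub>R b))) (at t within S)"
      by (rule has_derivative_compose[rotated])
    have "linear (frechet_derivative f (at (x + t *\<^sub>R b)))"
      using schwartz_differentiable[OF f, of "[]"] by (simp add: linear_frechet_derivative)
    with * show ?thesis
      by (simp add: has_vector_derivative_def d_def partial_deriv_def linear_scale)
  qed
  obtain C where C: "\<And>x. (1 + norm x) ^ (2 * DIM('a)) * norm (d x) \<le> C"
    using schwartz_decay[OF f, of "[b]"] b unfolding d_def by auto
  define N where "N = 2 * DIM('a)"
  define h where "h n = 1 / (real n + 1)" for n
  have h: "h n > 0" "h n \<le> 1" for n by (auto simp: h_def)
  have h0: "h \<longlonglongrightarrow> 0" unfolding h_def using LIMSEQ_inverse_real_of_nat by (simp add: inverse_eq_divide add.commute)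
  have C0: "C \<ge> 0" using C[of 0] by (meson norm_ge_zero order_trans mult_nonneg_nonneg zero_le_power add_nonneg_nonneg zero_le_one)
  \<comment> \<open>Integrable majorant of the difference quotients. The factor \<open>2 ^ N\<close>
    pays for the shift: for \<tau> in [0,1] and a unit vector b, 1 + |x| is at most 2 (1 + |x +
    \<tau> b|).\<close>
  define w where "w x = 2 ^ N * C * (1 / (1 + norm x) ^ N)" for x :: 'a
  have bound: "norm (f (x + t *\<^sub>R b) - f x) \<le> w x * t" if t: "0 \<le> t" "t \<le> 1" for x t
  proof -
    have "norm (f (x + t *\<^sub>R b) - f (x + 0 *\<^sub>R b)) \<le> w x * norm (t - 0)"
    proof (rule differentiable_bound[where S = "{0..1}" and f' = "\<lambda>\<tau> s. s *\<^sub>R d (x + \<tau> *\<^sub>R b)"])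
      fix \<tau> :: real assume \<tau>: "\<tau> \<in> {0..1}"
      show "((\<lambda>t. f (x + t *\<^sub>R b)) has_derivative (\<lambda>s. s *\<^sub>R d (x + \<tau> *\<^sub>R b))) (at \<tau> within {0..1})"
        using deriv by (simp add: has_vector_derivative_def)
      show "onorm (\<lambda>s. s *\<^sub>R d (x + \<tau> *\<^sub>R b)) \<le> w x"
      proof (rule onorm_bound)
        have "norm x \<le> norm (x + \<tau> *\<^sub>R b) + norm (\<tau> *\<^sub>R b)" by (metis add_diff_cancel_right' norm_triangle_ineq4)
        moreover have "norm (\<tau> *\<^sub>R b) \<le> 1" using b \<tau> by simp
        ultimately have "1 + norm x \<le> 2 * (1 + norm (x + \<tau> *\<^sub>R b))" using norm_ge_zero[of "x + \<tau> *\<^sub>R b"] by argo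
        hence "(1 + norm x) ^ N \<le> (2 * (1 + norm (x + \<tau> *\<^sub>R b))) ^ N" by (intro power_mono) auto
        hence "(1 + norm x) ^ N * norm (d (x + \<tau> *\<^sub>R b)) \<le> 2 ^ N * ((1 + norm (x + \<tau> *\<^sub>R b)) ^ N * norm (d (x + \<tau> *\<^sub>R b)))"
          by (metis (no_types, lifting) mult.assoc mult_right_mono norm_ge_zero power_mult_distrib)
        also have "\<dots> \<le> 2 ^ N * C" using C by (intro mult_left_mono) (auto simp: N_def)
        finally have "norm (d (x + \<tau> *\<^sub>R b)) \<le> w x"
          by (simp add: w_def field_simps add_pos_nonneg)
        thus "norm (s *\<^sub>R d (x + \<tau> *\<^sub>R b)) \<le> w x * norm s" for s :: real
          by (simp add: mult.commute mult_left_mono)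
        show "0 \<le> w x" using C0 by (simp add: w_def)
      qed
    qed (use t in auto)
    thus ?thesis using t by simp
  qed
  have "integrable lborel w"
  proof (rule decay_integrable)
    show "w \<in> borel_measurable borel" unfolding w_def by measurable
    show "(1 + norm x) ^ (2 * DIM('a)) * norm (w x) \<le> 2 ^ N * C" for x
      using C0 by (simp add: w_def N_def)
  qed
  define g where "g n x = (f (x + h n *\<^sub>R b) - f x) / h n" for n x
  have "(\<lambda>n. \<integral>x. cis (y \<bullet> x) * g n x \<partial>lborel) \<longlonglongrightarrow> (\<integral>x. cis (y \<bullet> x) * d x \<partial>lborel)"
  proof (rule integral_dominated_convergence[where w = w])
    show "AE x in lborel. (\<lambda>n. cis (y \<bullet> x) * g n x) \<longlonglongrightarrow> cis (y \<bullet> x) * d x"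
    proof (intro AE_I2 tendsto_intros)
      show "(\<lambda>n. g n x) \<longlonglongrightarrow> d x" for x
        using difference_quotient_tendsto[OF _ h(1) h0, of "\<lambda>t. f (x + t *\<^sub>R b)" "d x"] deriv[of x 0 UNIV]
        by (simp add: g_def)
    qed
    show "AE x in lborel. norm (cis (y \<bullet> x) * g n x) \<le> w x" for n
    proof (rule AE_I2)
      fix x
      have "norm (g n x) \<le> w x"
        using bound[of "h n" x] h[of n] by (simp add: g_def norm_divide field_simps less_imp_le)
      thus "norm (cis (y \<bullet> x) * g n x) \<le> w x" by (simp add: norm_mult)
    qed
  qed (use \<open>integrable lborel w\<close> in \<open>auto simp: g_def\<close>)
  \<comment> \<open>Translation by \<open>h n *\<^sub>R b\<close> multiplies the transform by the
    phase \<open>cis (- (h n * (y \<bullet> b)))\<close>; the scalar quotient that remains tends to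
    the derivative of this phase at 0.\<close>
  moreover have "(\<integral>x. cis (y \<bullet> x) * g n x \<partial>lborel) = (cis (- (h n * (y \<bullet> b))) - 1) / h n * fourier_transform f y" for n
  proof -
    have i: "integrable lborel (\<lambda>x. f (x + h n *\<^sub>R b))"
      using lborel_integrable_translate[OF int(1)] .
    have "(\<integral>x. cis (y \<bullet> x) * g n x \<partial>lborel)
        = (\<integral>x. (cis (y \<bullet> x) * f (x + h n *\<^sub>R b) - cis (y \<bullet> x) * f x) / h n \<partial>lborel)"
      by (simp add: g_def algebra_simps diff_divide_distrib)
    also have "\<dots> = (fourier_transform (\<lambda>x. f (x + h n *\<^sub>R b)) y - fourier_transform f y) / h n"
      unfolding fourier_transform_def
      by (subst integral_divide_zero, subst Bochner_Integration.integral_diff)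
         (auto intro: integrable_cis_mult int i)
    finally show ?thesis
      by (simp add: fourier_transform_translate[OF int(1)] algebra_simps diff_divide_distrib)
  qed
  moreover have "(\<lambda>n. (cis (- (h n * (y \<bullet> b))) - 1) / h n * fourier_transform f y) \<longlonglongrightarrow> - \<i> * (y \<bullet> b) * fourier_transform f y"
  proof (intro tendsto_intros)
    have "((\<lambda>t. cis (- (t * (y \<bullet> b)))) has_vector_derivative - \<i> * (y \<bullet> b)) (at 0)"
    proof -
      have "((\<lambda>z::complex. exp (- \<i> * (y \<bullet> b) * z)) has_field_derivative - \<i> * (y \<bullet> b)) (at (of_real 0))"
        by (auto intro!: derivative_eq_intros)
      from has_vector_derivative_real_field[OF this] show ?thesis
        by (simp add: cis_conv_exp mult_ac)
    qed
    from difference_quotient_tendsto[OF this h(1) h0]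
    show "(\<lambda>n. (cis (- (h n * (y \<bullet> b))) - 1) / h n) \<longlonglongrightarrow> - \<i> * (y \<bullet> b)" by simp
  qed
  ultimately have "(\<integral>x. cis (y \<bullet> x) * d x \<partial>lborel) = - \<i> * (y \<bullet> b) * fourier_transform f y"
    by (simp only: LIMSEQ_unique)
  thus ?thesis by (simp add: fourier_transform_def[of "partial_deriv b f"] d_def)
qed

lemma schwartz_foldr_partial_deriv:
  assumes "f \<in> schwartz" "bs \<in> lists Basis"
  shows "foldr partial_deriv bs f \<in> schwartz"
  using assms(2,1) by (induction bs) (auto intro: schwartz_partial_deriv)

lemma fourier_transform_iterated_partial_deriv:
  fixes f :: "'a::euclidean_space \<Rightarrow> complex"
  assumes "f \<in> schwartz" "bs \<in> lists Basis"
  shows "fourier_transform (foldr partial_deriv bs f) y = (\<Prod>b\<leftarrow>bs. - \<i> * (y \<bullet> b)) * fourier_transform f y"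
  using assms(2)
  by (induction bs) (simp_all add: fourier_transform_partial_deriv schwartz_foldr_partial_deriv assms(1))

lemma borel_measurable_fourier_transform:
  fixes f :: "'a::euclidean_space \<Rightarrow> complex"
  assumes [measurable]: "f \<in> borel_measurable borel"
  shows "fourier_transform f \<in> borel_measurable borel"
proof -
  have [measurable]: "(\<lambda>p::'a \<times> 'a. cis (fst p \<bullet> snd p)) \<in> borel_measurable (borel \<Otimes>\<^sub>M borel)"
    unfolding borel_prod by (intro borel_measurable_continuous_onI continuous_intros)
  have "(\<lambda>y. \<integral>x. (\<lambda>(y, x). cis (y \<bullet> x) * f x) (y, x) \<partial>lborel) \<in> borel_measurable borel"
    by (rule sigma_finite_measure.borel_measurable_lebesgue_integral[OF sigma_finite_lborel]) 
      (simp add: case_prod_beta)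
  thus ?thesis by (simp add: fourier_transform_def[abs_def])
qed

text \<open>Expanding the product of all 1 + (y \<bullet> b)^2 over subsets \<open>S\<close> of the
  basis reduces the claim to bounds on the transform times a product of squared coordinates. Up to
  sign that product is the transform of an iterated derivative, which is bounded by the L1 norm of
  the derivative.\<close>

lemma schwartz_fourier_transform_integrable:
  fixes f :: "'a::euclidean_space \<Rightarrow> complex"
  assumes f: "f \<in> schwartz"
  shows "integrable lborel (fourier_transform f)"
proof -
  have "\<exists>C. \<forall>y. (\<Prod>b\<in>S. (y \<bullet> b)\<^sup>2) * norm (fourier_transform f y) \<le> C" if S: "S \<subseteq> Basis" for S
  proof -
    obtain bs where bs: "set bs = S" "distinct bs"
      using finite_distinct_list[OF finite_subset[OF S finite_Basis]] by blast
    \<comment> \<open>Each direction is taken twice, so that its multiplier, the square of -i (y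
      \<bullet> b), has modulus (y \<bullet> b)^2.\<close>
    let ?cs = "concat (map (\<lambda>b. [b, b]) bs)"
    have cs: "?cs \<in> lists Basis" using bs S by auto
    have "(\<Prod>b\<in>S. (y \<bullet> b)\<^sup>2) * norm (fourier_transform f y) \<le> (\<integral>x. norm (foldr partial_deriv ?cs f x) \<partial>lborel)" for y
    proof -
      have "norm (\<Prod>b\<leftarrow>?cs. - \<i> * (y \<bullet> b)) = (\<Prod>b\<leftarrow>bs. (y \<bullet> b)\<^sup>2)"
        by (induction bs) (auto simp: norm_mult power2_eq_square)
      also have "\<dots> = (\<Prod>b\<in>S. (y \<bullet> b)\<^sup>2)"
        using bs by (metis prod.distinct_set_conv_list)
      finally show ?thesis
        using norm_fourier_transform_le[of "foldr partial_deriv ?cs f" y]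
        unfolding fourier_transform_iterated_partial_deriv[OF f cs] norm_mult by simp
    qed
    thus ?thesis by blast
  qed
  hence "\<forall>S\<in>Pow Basis. \<exists>C. \<forall>y. (\<Prod>b\<in>S. (y \<bullet> b)\<^sup>2) * norm (fourier_transform f y) \<le> C" by blast
  from bchoice[OF this] obtain C where
    C: "\<And>S y. S \<subseteq> Basis \<Longrightarrow> (\<Prod>b\<in>S. (y \<bullet> b)\<^sup>2) * norm (fourier_transform f y) \<le> C S" by blast
  show ?thesis
  proof (rule Bochner_Integration.integrable_bound)
    show "integrable lborel (\<lambda>x::'a. (\<Sum>S\<in>Pow Basis. C S) * (\<Prod>b\<in>Basis. 1 / (1 + (x \<bullet> b)\<^sup>2)))"
      by (intro integrable_mult_right integrable_prod_inverse_one_plus_square)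
    show "fourier_transform f \<in> borel_measurable lborel"
      using borel_measurable_fourier_transform[OF schwartz_borel_measurable[OF f]] by simp
    show "AE y in lborel. norm (fourier_transform f y) \<le> norm ((\<Sum>S\<in>Pow Basis. C S) * (\<Prod>b\<in>Basis. 1 / (1 + (y \<bullet> b)\<^sup>2)))"
    proof (rule AE_I2)
      fix y :: 'a
      let ?p = "\<Prod>b\<in>Basis. 1 + (y \<bullet> b)\<^sup>2"
      have p: "?p > 0" by (intro prod_pos) (auto simp: add_pos_nonneg)
      have "?p = (\<Sum>S\<in>Pow Basis. \<Prod>b\<in>S. (y \<bullet> b)\<^sup>2)"
        by (subst add.commute) (simp add: prod_add)
      hence "?p * norm (fourier_transform f y) \<le> (\<Sum>S\<in>Pow Basis. C S)"
        by (simp add: sum_distrib_right) (intro sum_mono C, auto)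
      hence "norm (fourier_transform f y) \<le> (\<Sum>S\<in>Pow Basis. C S) / ?p" using p by (simp add: field_simps)
      also have "\<dots> \<le> norm ((\<Sum>S\<in>Pow Basis. C S) * (\<Prod>b\<in>Basis. 1 / (1 + (y \<bullet> b)\<^sup>2)))"
        using p by (simp add: prod_dividef divide_right_mono)
      finally show "norm (fourier_transform f y) \<le> norm ((\<Sum>S\<in>Pow Basis. C S) * (\<Prod>b\<in>Basis. 1 / (1 + (y \<bullet> b)\<^sup>2)))" .
    qed
  qed
qed

lemma lborel_integrable_affine:
  fixes f :: "'a::euclidean_space \<Rightarrow> 'b::{banach,second_countable_topology}"
  assumes f: "integrable lborel f" and c: "c > 0"
  shows "integrable lborel (\<lambda>x. f (t + c *\<^sub>R x))"
proof -
  have [measurable]: "f \<in> borel_measurable borel" using f by auto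
  have "integrable (density (distr lborel borel (\<lambda>x. t + c *\<^sub>R x)) (\<lambda>_. ennreal (\<bar>c\<bar>^DIM('a)))) f"
    using f c by (subst (asm) lborel_affine[of c t]) (auto simp: ennreal_power)
  hence "integrable lborel (\<lambda>x. c ^ DIM('a) *\<^sub>R f (t + c *\<^sub>R x))"
    using c by (subst (asm) integrable_density) (auto simp: integrable_distr_eq)
  from integrable_scaleR_right[OF this, of "1 / c ^ DIM('a)"] show ?thesis using c by simp
qed

lemma lborel_integral_affine:
  fixes f :: "'a::euclidean_space \<Rightarrow> 'b::{banach,second_countable_topology}"
  assumes [measurable]: "f \<in> borel_measurable borel" and c: "c > 0"
  shows "(\<integral>x. f (t + c *\<^sub>R x) \<partial>lborel) = (1 / c ^ DIM('a)) *\<^sub>R (\<integral>x. f x \<partial>lborel)"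
proof -
  have "(\<integral>x. f x \<partial>lborel) = (\<integral>x. f x \<partial>density (distr lborel borel (\<lambda>x. t + c *\<^sub>R x)) (\<lambda>_. ennreal (\<bar>c\<bar>^DIM('a))))"
    using c by (subst lborel_affine[of c t]) (auto simp: ennreal_power)
  also have "\<dots> = c ^ DIM('a) *\<^sub>R (\<integral>x. f (t + c *\<^sub>R x) \<partial>lborel)"
    using c by (subst integral_density) (auto simp: integral_distr)
  finally show ?thesis using c by simp
qed

section \<open>Gaussians and the inversion theorem\<close>

definition gauss :: "'a::euclidean_space \<Rightarrow> real" where
  "gauss x = exp (- (x \<bullet> x) / 2)"

lemma gauss_measurable [measurable]: "gauss \<in> borel_measurable borel"
  unfolding gauss_def[abs_def] by (intro borel_measurable_continuous_onI continuous_intros) auto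

lemma gauss_nonneg: "0 \<le> gauss x" and gauss_le_1: "gauss x \<le> 1"
  by (simp_all add: gauss_def)

lemma gauss_eq_prod: "gauss (x::'a::euclidean_space) = (\<Prod>b\<in>Basis. exp (- (x \<bullet> b)\<^sup>2 / 2))"
  by (simp add: gauss_def euclidean_inner[of x x] power2_eq_square exp_sum[symmetric] sum_divide_distrib sum_negf)

lemma integrable_gauss_real: "integrable lborel (\<lambda>t::real. exp (- t\<^sup>2 / 2))"
proof -
  have "integrable lborel (\<lambda>t. sqrt (2 * pi) * (std_normal_density t * t ^ 0))"
    by (intro integrable_mult_right integrable_std_normal_moment)
  thus ?thesis by (simp add: std_normal_density_def)
qed

text \<open>The characteristic function of the standard normal law, freed of its normalisation
  \<open>sqrt (2 * pi)\<close>.\<close>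

lemma fourier_gauss_real:
  "(\<integral>t. cis (s * t) * exp (- t\<^sup>2 / 2) \<partial>lborel) = sqrt (2 * pi) * exp (- s\<^sup>2 / 2)"
proof -
  have "exp (- s\<^sup>2 / 2) = char std_normal_distribution s"
    by (simp add: char_std_normal_distribution)
  also have "\<dots> = (\<integral>t. std_normal_density t *\<^sub>R cis (s * t) \<partial>lborel)"
    unfolding char_def by (subst integral_density) (auto simp: cis_conv_exp)
  also have "\<dots> = (\<integral>t. (1 / sqrt (2 * pi)) *\<^sub>R (cis (s * t) * exp (- t\<^sup>2 / 2)) \<partial>lborel)"
    by (simp add: std_normal_density_def scaleR_conv_of_real mult_ac)
  also have "\<dots> = (1 / sqrt (2 * pi)) *\<^sub>R (\<integral>t. cis (s * t) * exp (- t\<^sup>2 / 2) \<partial>lborel)"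
    by (rule integral_scaleR_right) 
  finally show ?thesis by (simp add: scaleR_conv_of_real field_simps)
qed

lemma integrable_gauss: "integrable lborel (\<lambda>x::'a::euclidean_space. gauss x)"
  unfolding gauss_eq_prod by (rule lborel_integrable_prod_Basis) (rule integrable_gauss_real)

lemma cis_sum: "finite A \<Longrightarrow> cis (\<Sum>a\<in>A. f a) = (\<Prod>a\<in>A. cis (f a))"
  by (induction A rule: finite_induct) (auto simp flip: cis_mult)

lemma fourier_transform_gauss:
  fixes y :: "'a::euclidean_space"
  shows "fourier_transform (\<lambda>x. of_real (gauss x)) y = of_real (sqrt (2 * pi) ^ DIM('a) * gauss y)"
proof -
  have "fourier_transform (\<lambda>x. of_real (gauss x)) y
      = (\<integral>x. (\<Prod>b\<in>Basis. cis ((y \<bullet> b) * (x \<bullet> b)) * exp (- (x \<bullet> b)\<^sup>2 / 2)) \<partial>lborel)"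
  proof -
    have "cis (y \<bullet> x) = (\<Prod>b\<in>Basis. cis ((y \<bullet> b) * (x \<bullet> b)))" for x
      by (subst euclidean_inner) (rule cis_sum[OF finite_Basis])
    thus ?thesis by (simp add: fourier_transform_def gauss_eq_prod prod.distrib)
  qed
  also have "\<dots> = (\<Prod>b\<in>(Basis::'a set). \<integral>t. cis ((y \<bullet> b) * t) * exp (- t\<^sup>2 / 2) \<partial>lborel)"
  proof (rule lborel_integral_prod_Basis[where h = "\<lambda>b t. cis ((y \<bullet> b) * t) * exp (- t\<^sup>2 / 2)"])
    fix b :: 'a
    have "integrable lborel (\<lambda>t::real. complex_of_real (exp (- t\<^sup>2 / 2)))"
      using integrable_gauss_real by (simp only: integrable_of_real)
    from integrable_cis_mult[OF this, of "y \<bullet> b"]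
    show "integrable lborel (\<lambda>t. cis ((y \<bullet> b) * t) * exp (- t\<^sup>2 / 2))" by simp
  qed
  also have "\<dots> = of_real (sqrt (2 * pi) ^ DIM('a) * gauss y)"
    unfolding fourier_gauss_real by (simp add: gauss_eq_prod prod.distrib)
  finally show ?thesis .
qed

lemma integral_gauss: "(\<integral>x. gauss (x::'a::euclidean_space) \<partial>lborel) = sqrt (2 * pi) ^ DIM('a)"
proof -
  have "complex_of_real (\<integral>x. gauss (x::'a) \<partial>lborel) = complex_of_real (sqrt (2 * pi) ^ DIM('a))"
    using fourier_transform_gauss[of "0::'a"] unfolding fourier_transform_def
    by (simp add: gauss_def)
  thus ?thesis using of_real_eq_iff by blast
qed

text \<open>The multiplication formula: both sides are iterated integrals of
  \<open>cis (y \<bullet> x) * f x * g y\<close>, in the two possible orders.\<close>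

lemma fourier_transform_mult_swap:
  fixes f g :: "'a::euclidean_space \<Rightarrow> complex"
  assumes f: "integrable lborel f" and g: "integrable lborel g"
  shows "(\<integral>y. fourier_transform f y * g y \<partial>lborel) = (\<integral>x. f x * fourier_transform g x \<partial>lborel)"
proof -
  have [measurable]: "f \<in> borel_measurable borel" "g \<in> borel_measurable borel" using f g by auto
  have [measurable]: "(\<lambda>p::'a \<times> 'a. cis (fst p \<bullet> snd p)) \<in> borel_measurable (borel \<Otimes>\<^sub>M borel)"
    unfolding borel_prod by (intro borel_measurable_continuous_onI continuous_intros)
  have [measurable]: "(\<lambda>(y, x). cis (y \<bullet> x) * f x * g y) \<in> borel_measurable (lborel \<Otimes>\<^sub>M lborel)"
    by (simp add: case_prod_beta)
  have int: "integrable (lborel \<Otimes>\<^sub>M lborel) (\<lambda>(y, x). cis (y \<bullet> x) * f x * g y)"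
  proof (rule lborel_pair.Fubini_integrable)
    have "(\<integral>x. norm (cis (y \<bullet> x) * f x * g y) \<partial>lborel) = (\<integral>x. norm (f x) \<partial>lborel) * norm (g y)" for y
      by (simp add: norm_mult)
    thus "integrable lborel (\<lambda>y. \<integral>x. norm (case (y, x) of (y, x) \<Rightarrow> cis (y \<bullet> x) * f x * g y) \<partial>lborel)"
      using g by simp
    show "AE y in lborel. integrable lborel (\<lambda>x. case (y, x) of (y, x) \<Rightarrow> cis (y \<bullet> x) * f x * g y)"
      using integrable_cis_mult[OF f] by simp
  qed simp
  have "(\<integral>y. fourier_transform f y * g y \<partial>lborel) = (\<integral>y. (\<integral>x. cis (y \<bullet> x) * f x * g y \<partial>lborel) \<partial>lborel)"
    by (simp add: fourier_transform_def)
  also have "\<dots> = (\<integral>x. (\<integral>y. cis (y \<bullet> x) * f x * g y \<partial>lborel) \<partial>lborel)"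
    using lborel_pair.Fubini_integral[OF int] by simp
  also have "\<dots> = (\<integral>x. (\<integral>y. f x * (cis (x \<bullet> y) * g y) \<partial>lborel) \<partial>lborel)"
    by (simp add: inner_commute mult_ac)
  also have "\<dots> = (\<integral>x. f x * fourier_transform g x \<partial>lborel)"
    by (simp add: fourier_transform_def)
  finally show ?thesis .
qed

text \<open>Gaussian regularisation: insert \<open>gauss (\<epsilon> y)\<close> and let \<open>\<epsilon> \<rightarrow> 0\<close>.\<close>

theorem fourier_inversion:
  fixes f :: "'a::euclidean_space \<Rightarrow> complex"
  assumes f: "integrable lborel f" and Ff: "integrable lborel (fourier_transform f)"
    and cont: "continuous_on UNIV f" and bd: "\<And>x. norm (f x) \<le> K"
  shows "(\<integral>y. cis (- (x \<bullet> y)) * fourier_transform f y \<partial>lborel) = (2 * pi) ^ DIM('a) * f x"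
proof -
  have [measurable]: "f \<in> borel_measurable borel" "fourier_transform f \<in> borel_measurable borel" using f Ff by auto
  have [measurable]: "(\<lambda>y. cis (- (x \<bullet> y))) \<in> borel_measurable borel"
    using cis_inner_measurable[of "- x"] by simp
  define c where "c = sqrt (2 * pi) ^ DIM('a)"
  define \<epsilon> where "\<epsilon> n = 1 / (real n + 1)" for n
  have e: "\<epsilon> n > 0" for n by (simp add: \<epsilon>_def)
  have e0: "\<epsilon> \<longlonglongrightarrow> 0" unfolding \<epsilon>_def using LIMSEQ_inverse_real_of_nat by (simp add: inverse_eq_divide add.commute)
  define J where "J n = (\<integral>y. fourier_transform f y * (cis (- (x \<bullet> y)) * gauss (\<epsilon> n *\<^sub>R y)) \<partial>lborel)" for n
  \<comment> \<open>The multiplication formula moves the transform onto the modulated Gaussian. This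
    becomes a narrow Gaussian of width \<epsilon> centred at \<open>x\<close>, and rescaling turns
    the integral into a weighted mean of \<open>f\<close> near \<open>x\<close>.\<close>
  have J_eq: "J n = (\<integral>u. (c * gauss u) *\<^sub>R f (x + \<epsilon> n *\<^sub>R u) \<partial>lborel)" for n
  proof -
    let ?g = "\<lambda>y. cis (- (x \<bullet> y)) * gauss (\<epsilon> n *\<^sub>R y)"
    have gi: "integrable lborel (\<lambda>y::'a. complex_of_real (gauss (\<epsilon> n *\<^sub>R y)))"
    proof -
      have "integrable lborel (\<lambda>y::'a. gauss (0 + \<epsilon> n *\<^sub>R y))"
        by (rule lborel_integrable_affine[OF integrable_gauss e])
      thus ?thesis by (simp only: integrable_of_real add_0)
    qed
    have g: "integrable lborel ?g" using integrable_cis_mult[OF gi, of "- x"] by simp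
    have Fg: "fourier_transform ?g z = c / \<epsilon> n ^ DIM('a) * gauss ((z - x) /\<^sub>R \<epsilon> n)" for z
    proof -
      let ?h = "\<lambda>w. cis (((z - x) /\<^sub>R \<epsilon> n) \<bullet> w) * complex_of_real (gauss w)"
      have "fourier_transform ?g z = (\<integral>y. ?h (0 + \<epsilon> n *\<^sub>R y) \<partial>lborel)"
        unfolding fourier_transform_def using e[of n]
        by (simp add: cis_mult inner_diff_left less_imp_neq[symmetric] flip: mult.assoc)
      also have "\<dots> = (1 / \<epsilon> n ^ DIM('a)) *\<^sub>R (\<integral>w. ?h w \<partial>lborel)"
        by (rule lborel_integral_affine) (use e cis_inner_measurable[of "(z - x) /\<^sub>R \<epsilon> n"] in measurable)
      also have "(\<integral>w. ?h w \<partial>lborel) = of_real (c * gauss ((z - x) /\<^sub>R \<epsilon> n))"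
        using fourier_transform_gauss[of "(z - x) /\<^sub>R \<epsilon> n"] unfolding fourier_transform_def c_def .
      finally show ?thesis by (simp add: scaleR_conv_of_real)
    qed
    let ?k = "\<lambda>z. (c * gauss ((z - x) /\<^sub>R \<epsilon> n)) *\<^sub>R f z"
    have "J n = (\<integral>z. f z * fourier_transform ?g z \<partial>lborel)"
      unfolding J_def by (rule fourier_transform_mult_swap[OF f g])
    also have "\<dots> = (\<integral>z. (1 / \<epsilon> n ^ DIM('a)) *\<^sub>R ?k z \<partial>lborel)"
      unfolding Fg by (simp add: scaleR_conv_of_real mult_ac)
    also have "\<dots> = (1 / \<epsilon> n ^ DIM('a)) *\<^sub>R (\<integral>z. ?k z \<partial>lborel)"
      by (rule integral_scaleR_right)
    also have "\<dots> = (\<integral>u. ?k (x + \<epsilon> n *\<^sub>R u) \<partial>lborel)"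
      by (rule lborel_integral_affine[symmetric]) (use e in measurable)
    finally show ?thesis using e[of n] by (simp add: less_imp_neq[symmetric])
  qed
  \<comment> \<open>One evaluation of the limit: the weighted means concentrate at \<open>x\<close>,
    dominated by \<open>K\<close> times a Gaussian.\<close>
  have "(\<lambda>n. \<integral>u. (c * gauss u) *\<^sub>R f (x + \<epsilon> n *\<^sub>R u) \<partial>lborel) \<longlonglongrightarrow> (\<integral>u. (c * gauss (u::'a)) *\<^sub>R f x \<partial>lborel)"
  proof (rule integral_dominated_convergence[where w = "\<lambda>u. c * gauss u * K"])
    show "integrable lborel (\<lambda>u::'a. c * gauss u * K)"
      by (intro integrable_mult_left integrable_mult_right integrable_gauss)
    show "AE u in lborel. (\<lambda>n. (c * gauss u) *\<^sub>R f (x + \<epsilon> n *\<^sub>R u)) \<longlonglongrightarrow> (c * gauss u) *\<^sub>R f x"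
    proof (intro AE_I2 tendsto_scaleR tendsto_const)
      fix u
      have "(\<lambda>n. x + \<epsilon> n *\<^sub>R u) \<longlonglongrightarrow> x + 0 *\<^sub>R u" by (intro tendsto_intros e0)
      moreover have "isCont f x" using cont by (simp add: continuous_on_eq_continuous_at)
      ultimately show "(\<lambda>n. f (x + \<epsilon> n *\<^sub>R u)) \<longlonglongrightarrow> f x" using isCont_tendsto_compose[of x f] by auto
    qed
    show "AE u in lborel. norm ((c * gauss u) *\<^sub>R f (x + \<epsilon> n *\<^sub>R u)) \<le> c * gauss u * K" for n
      using bd by (intro AE_I2) (auto simp: c_def gauss_def abs_mult intro!: mult_left_mono)
  qed auto
  hence lim: "J \<longlonglongrightarrow> (\<integral>u. (c * gauss (u::'a)) *\<^sub>R f x \<partial>lborel)"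
    by (rule Lim_transform_eventually) (simp add: J_eq)
  \<comment> \<open>The other evaluation: the regulariser tends to \<open>gauss 0\<close>, which is
    1, dominated by the integrable transform.\<close>
  have "J \<longlonglongrightarrow> (\<integral>y. fourier_transform f y * (cis (- (x \<bullet> y)) * gauss (0::'a)) \<partial>lborel)"
    unfolding J_def
  proof (rule integral_dominated_convergence[where w = "\<lambda>y. norm (fourier_transform f y)"])
    show "AE y in lborel. (\<lambda>n. fourier_transform f y * (cis (- (x \<bullet> y)) * gauss (\<epsilon> n *\<^sub>R y)))
      \<longlonglongrightarrow> fourier_transform f y * (cis (- (x \<bullet> y)) * gauss (0::'a))"
    proof (intro AE_I2 tendsto_intros)
      fix y :: 'a
      have "(\<lambda>n. exp (- ((\<epsilon> n *\<^sub>R y) \<bullet> (\<epsilon> n *\<^sub>R y)) / 2)) \<longlonglongrightarrow> exp (- ((0 *\<^sub>R y) \<bullet> (0 *\<^sub>R y)) / 2)"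
        by (intro tendsto_intros e0) auto
      thus "(\<lambda>n. gauss (\<epsilon> n *\<^sub>R y)) \<longlonglongrightarrow> gauss (0::'a)" by (simp add: gauss_def)
    qed
    show "AE y in lborel. norm (fourier_transform f y * (cis (- (x \<bullet> y)) * gauss (\<epsilon> n *\<^sub>R y))) \<le> norm (fourier_transform f y)" for n
      by (intro AE_I2) (simp add: norm_mult gauss_nonneg mult_left_le gauss_le_1)
    show "(\<lambda>y. fourier_transform f y * (cis (- (x \<bullet> y)) * gauss (0::'a))) \<in> borel_measurable lborel" by simp
    show "(\<lambda>y. fourier_transform f y * (cis (- (x \<bullet> y)) * gauss (\<epsilon> n *\<^sub>R y))) \<in> borel_measurable lborel" for n by simp
  qed (use Ff in auto)
  from LIMSEQ_unique[OF this lim]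
  have "(\<integral>y. fourier_transform f y * (cis (- (x \<bullet> y)) * gauss (0::'a)) \<partial>lborel) = (\<integral>u. (c * gauss (u::'a)) *\<^sub>R f x \<partial>lborel)" .
  also have "\<dots> = (\<integral>u. c * gauss (u::'a) \<partial>lborel) *\<^sub>R f x"
    by (rule integral_scaleR_left) (intro integrable_mult_right integrable_gauss)
  \<comment> \<open>One factor \<open>c\<close> comes from the transform of the Gaussian, the other
    from its mass; together they give 2\<pi> per dimension.\<close>
  also have "(\<integral>u. c * gauss (u::'a) \<partial>lborel) = (2 * pi) ^ DIM('a)"
  proof -
    have "(\<integral>u. c * gauss (u::'a) \<partial>lborel) = (sqrt (2 * pi) * sqrt (2 * pi)) ^ DIM('a)"
      by (simp only: integral_mult_right_zero integral_gauss c_def power_mult_distrib)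
    thus ?thesis by simp
  qed
  finally show ?thesis by (simp add: gauss_def scaleR_conv_of_real mult.commute)
qed

lemma schwartz_fourier_inversion:
  fixes f :: "'a::euclidean_space \<Rightarrow> complex"
  assumes f: "f \<in> schwartz"
  shows "(\<integral>y. cis (- (x \<bullet> y)) * fourier_transform f y \<partial>lborel) = (2 * pi) ^ DIM('a) * f x"
proof -
  obtain K where "norm (f x) \<le> K" for x using schwartz_decay[OF f, of "[]" 0] by auto
  thus ?thesis using fourier_inversion[OF schwartz_integrable[OF f] schwartz_fourier_transform_integrable[OF f]
      schwartz_continuous_on[OF f]] by blast
qed

section \<open>Positive definite matrices\<close>

text \<open>A maximiser of the quadratic form on the unit sphere of an invariant subspace is an eigenvector.\<close>

lemma symmetric_eigenvector_exists:
  fixes A :: "real^'n^'n"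
  assumes sym: "transpose A = A" and W: "subspace W" "W \<noteq> {0}"
    and inv: "\<And>x. x \<in> W \<Longrightarrow> A *v x \<in> W"
  obtains x c where "x \<in> W" "norm x = 1" "A *v x = c *\<^sub>R x"
proof -
  let ?S = "W \<inter> sphere 0 1" and ?q = "\<lambda>x. x \<bullet> (A *v x)"
  have "compact ?S"
    by (intro closed_Int_compact closed_subspace W compact_sphere)
  moreover have "?S \<noteq> {}"
  proof -
    obtain w where w: "w \<in> W" "w \<noteq> 0" using W subspace_0 by blast
    hence "w /\<^sub>R norm w \<in> ?S" using W(1) by (simp add: subspace_scale)
    thus ?thesis by blast
  qed
  moreover have "continuous_on ?S ?q"
    by (intro continuous_intros linear_continuous_on matrix_vector_mul_bounded_linear)
  ultimately obtain x where x: "x \<in> ?S" "\<And>y. y \<in> ?S \<Longrightarrow> ?q y \<le> ?q x"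
    using continuous_attains_sup[of ?S ?q] by blast
  define c where "c = ?q x"
  have symq: "u \<bullet> (A *v v) = v \<bullet> (A *v u)" for u v
    by (metis dot_lmul_matrix inner_commute sym transpose_matrix_vector)
  have le: "?q y \<le> c * (y \<bullet> y)" if "y \<in> W" for y
  proof (cases "y = 0")
    case False
    hence "y /\<^sub>R norm y \<in> ?S" using W(1) that by (simp add: subspace_scale)
    from x(2)[OF this] have "?q y / (norm y * norm y) \<le> c"
      by (simp add: c_def matrix_vector_mult_scaleR field_simps)
    thus ?thesis using False by (simp add: field_simps flip: power2_norm_eq_inner power2_eq_square)
  qed auto
  \<comment> \<open>The residual of the eigenvalue equation. Were it nonzero, moving from
    \<open>x\<close> in the direction \<open>z\<close> would raise the Rayleigh quotient to first
    order.\<close>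
  define z where "z = A *v x - c *\<^sub>R x"
  have z: "z \<in> W" unfolding z_def using x(1) W(1) inv by (simp add: subspace_diff subspace_scale)
  have xx: "x \<bullet> x = 1" using x(1) by (simp add: norm_eq_1)
  have "z \<bullet> z = 0"
  proof (rule ccontr)
    assume nz: "z \<bullet> z \<noteq> 0"
    define K where "K = c * (z \<bullet> z) - ?q z"
    have K: "2 * t * (z \<bullet> z) \<le> t\<^sup>2 * K" for t
    proof -
      have "x + t *\<^sub>R z \<in> W" using x(1) z W(1) by (simp add: subspace_add subspace_scale)
      from le[OF this] have "c + 2 * t * (z \<bullet> (A *v x)) + t\<^sup>2 * ?q z \<le> c * (1 + 2 * t * (x \<bullet> z) + t\<^sup>2 * (z \<bullet> z))"
        by (simp add: matrix_vector_right_distrib matrix_vector_mult_scaleR algebra_simps inner_add_left inner_add_right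
            symq[of x z] xx power2_eq_square inner_commute c_def)
      moreover have "z \<bullet> (A *v x) = z \<bullet> z + c * (x \<bullet> z)"
        by (simp add: z_def inner_diff_left inner_diff_right inner_commute algebra_simps)
      ultimately show ?thesis by (simp add: K_def algebra_simps)
    qed
    have pos: "z \<bullet> z > 0" using nz by (simp add: less_le)
    \<comment> \<open>So small that the second-order term \<open>t * K\<close> is at most
      \<open>z \<bullet> z\<close>, whereas maximality demands at least twice that.\<close>
    define t where "t = (z \<bullet> z) / (\<bar>K\<bar> + 1)"
    have t: "t > 0" using pos by (simp add: t_def)
    have "2 * (z \<bullet> z) \<le> t * K"
      using K[of t] t by (simp add: power2_eq_square)
    also have "t * K \<le> t * (\<bar>K\<bar> + 1)" using t by (intro mult_left_mono) auto
    also have "\<dots> = z \<bullet> z" by (simp add: t_def)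
    finally show False using pos by simp
  qed
  hence "A *v x = c *\<^sub>R x" by (simp add: z_def)
  thus ?thesis using that x(1) by auto
qed

text \<open>A maximal orthonormal set of eigenvectors spans: otherwise its orthogonal complement is
  a nonzero subspace, invariant by symmetry of \<open>A\<close>, and supplies a further
  eigenvector.\<close>

lemma symmetric_orthonormal_eigenbasis:
  fixes A :: "real^'n^'n"
  assumes sym: "transpose A = A"
  obtains B where "pairwise orthogonal B" "\<And>x. x \<in> B \<Longrightarrow> norm x = 1" "span B = UNIV" "card B = CARD('n)"
    "\<And>x. x \<in> B \<Longrightarrow> \<exists>c. A *v x = c *\<^sub>R x" "finite B"
proof -
  define P where "P B \<longleftrightarrow> pairwise orthogonal B \<and> (\<forall>x\<in>B. norm x = 1 \<and> (\<exists>c. A *v x = c *\<^sub>R x))" for B :: "(real^'n) set"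
  have indep: "independent B" if "P B" for B
    using that by (intro pairwise_orthogonal_independent) (auto simp: P_def)
  have fin: "finite B" "card B \<le> CARD('n)" if "P B" for B
    using independent_bound[OF indep[OF that]] by simp_all
  have "P {}" by (simp add: P_def)
  moreover have "\<forall>B. P B \<longrightarrow> card B < Suc CARD('n)" using fin(2) by (simp add: less_Suc_eq_le)
  ultimately have "\<exists>B. P B \<and> (\<forall>B'. P B' \<longrightarrow> card B' \<le> card B)"
    by (rule ex_has_greatest_nat)
  then obtain B where B: "P B" "\<And>B'. P B' \<Longrightarrow> card B' \<le> card B" by metis
  have "span B = UNIV"
  proof (rule ccontr)
    assume ne: "span B \<noteq> UNIV"
    define W where "W = {x. \<forall>b\<in>B. orthogonal b x}"
    have W: "subspace W" unfolding W_def by (rule subspace_orthogonal_to_vectors)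
    have "\<exists>x\<in>W. x \<noteq> 0"
    proof -
      have "span B \<subset> span UNIV" using ne by auto
      then obtain x where x: "x \<noteq> 0" "\<And>y. y \<in> span B \<Longrightarrow> orthogonal x y"
        using orthogonal_to_subspace_exists_gen[of B UNIV] by blast
      have "x \<in> W" unfolding W_def using x(2) span_base[of _ B] by (simp add: orthogonal_commute)
      thus ?thesis using x(1) by blast
    qed
    hence W0: "W \<noteq> {0}" by auto
    have inv: "A *v x \<in> W" if "x \<in> W" for x
      unfolding W_def
    proof safe
      fix b assume b: "b \<in> B"
      then obtain c where "A *v b = c *\<^sub>R b" using B(1) by (auto simp: P_def)
      moreover have "b \<bullet> (A *v x) = (A *v b) \<bullet> x"
        by (metis dot_lmul_matrix sym transpose_matrix_vector)
      ultimately show "orthogonal b (A *v x)" using that b by (auto simp: W_def orthogonal_def)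
    qed
    obtain x c where x: "x \<in> W" "norm x = 1" "A *v x = c *\<^sub>R x"
      using symmetric_eigenvector_exists[OF sym W W0 inv] by blast
    have "pairwise orthogonal (insert x B)"
      using B(1) x(1) by (auto simp: P_def pairwise_insert W_def orthogonal_commute)
    hence "P (insert x B)"
      using B(1) x(2,3) unfolding P_def by blast
    moreover have "x \<notin> B"
      using x by (auto simp: W_def orthogonal_def)
    hence "card (insert x B) = Suc (card B)" using fin[OF B(1)] by simp
    ultimately show False using B(2)[of "insert x B"] by simp
  qed
  moreover from this have "card B = CARD('n)"
    using indep[OF B(1)] by (metis DIM_cart DIM_real dim_UNIV dim_eq_card_independent dim_span mult.right_neutral)
  ultimately show ?thesis using B(1) fin(1)[OF B(1)] by (intro that[of B]) (simp_all add: P_def)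
qed

section \<open>Diagonal matrices and the spectral theorem\<close>

definition diag_matrix :: "('n \<Rightarrow> real) \<Rightarrow> real^'n^'n" where
  "diag_matrix d = (\<chi> i j. if i = j then d i else 0)"

lemma diag_matrix_mult [simp]: "diag_matrix c ** diag_matrix d = diag_matrix (\<lambda>i. c i * d i)"
  by (simp add: diag_matrix_def matrix_matrix_mult_def vec_eq_iff if_distrib[of "\<lambda>x. _ * x"] if_distrib[of "\<lambda>x. x * _"]
      cong: if_cong)

lemma transpose_diag_matrix [simp]: "transpose (diag_matrix d) = diag_matrix d"
  by (auto simp: diag_matrix_def transpose_def vec_eq_iff)

lemma diag_matrix_vector: "diag_matrix d *v x = (\<chi> i. d i * x $ i)" for x :: "real^'n"
  by (simp add: diag_matrix_def matrix_vector_mult_def vec_eq_iff if_distrib[of "\<lambda>x. x * _"] cong: if_cong)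

lemma det_diag_matrix [simp]: "det (diag_matrix d) = (\<Prod>i\<in>UNIV. d i)"
  by (subst det_diagonal) (auto simp: diag_matrix_def)

lemma spectral_theorem:
  fixes A :: "real^'n^'n"
  assumes sym: "transpose A = A"
  obtains Q d where "orthogonal_matrix Q" "A = Q ** diag_matrix d ** transpose Q"
proof -
  obtain B where B: "pairwise orthogonal B" "\<And>x. x \<in> B \<Longrightarrow> norm x = 1" "card B = CARD('n)"
    "\<And>x. x \<in> B \<Longrightarrow> \<exists>c. A *v x = c *\<^sub>R x" "finite B"
    using symmetric_orthonormal_eigenbasis[OF sym] by metis
  then obtain b where b: "bij_betw b (UNIV::'n set) B"
    using finite_same_card_bij[of "UNIV::'n set" B] by auto
  hence bB: "b i \<in> B" for i by (auto simp: bij_betw_def)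
  have inj: "b i = b j \<longleftrightarrow> i = j" for i j using b by (auto simp: bij_betw_def inj_on_def)
  define Q :: "real^'n^'n" where "Q = (\<chi> i j. b j $ i)"
  have col: "column j Q = b j" for j by (simp add: Q_def column_def vec_eq_iff)
  have Q: "orthogonal_matrix Q"
    unfolding orthogonal_matrix_orthonormal_columns col
    using B(2)[OF bB] pairwiseD[OF B(1) bB bB] inj by metis
  have "\<forall>i. \<exists>c. A *v b i = c *\<^sub>R b i" using B(4) bB by blast
  then obtain d where d: "\<And>i. A *v b i = d i *\<^sub>R b i" by (auto dest!: choice)
  have "A ** Q = Q ** diag_matrix d"
  proof -
    have "(A ** Q) $ i $ j = (Q ** diag_matrix d) $ i $ j" for i j
    proof -
      have "(A ** Q) $ i $ j = (A *v b j) $ i"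
        by (simp add: matrix_matrix_mult_def matrix_vector_mult_def Q_def)
      also have "\<dots> = (Q ** diag_matrix d) $ i $ j"
        by (simp add: d diag_matrix_def matrix_matrix_mult_def Q_def if_distrib[of "\<lambda>x. _ * x"] cong: if_cong)
      finally show ?thesis .
    qed
    thus ?thesis by (simp add: vec_eq_iff)
  qed
  hence "A ** (Q ** transpose Q) = Q ** diag_matrix d ** transpose Q"
    by (simp add: matrix_mul_assoc)
  hence "A = Q ** diag_matrix d ** transpose Q"
    using Q by (simp add: orthogonal_matrix_def)
  with Q show ?thesis by (rule that)
qed

section \<open>The positive definite cone\<close>

lemma posdef_cone_inner_pos: "r \<in> posdef_cone \<Longrightarrow> x \<noteq> 0 \<Longrightarrow> 0 < x \<bullet> (r *v x)"
  by (simp add: posdef_cone_def)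

lemma posdef_coneI:
  "transpose r = r \<Longrightarrow> (\<And>x. x \<noteq> 0 \<Longrightarrow> 0 < x \<bullet> (r *v x)) \<Longrightarrow> r \<in> posdef_cone"
  by (simp add: posdef_cone_def)

lemma posdef_cone_transpose: "r \<in> posdef_cone \<Longrightarrow> transpose r = r"
  by (simp add: posdef_cone_def)

lemma inner_congruence:
  fixes a :: "real^'n^'p" and r :: "real^'p^'p"
  shows "x \<bullet> ((transpose a ** r ** a) *v x) = (a *v x) \<bullet> (r *v (a *v x))"
  by (simp add: matrix_vector_mul_assoc[symmetric])
     (metis dot_lmul_matrix transpose_matrix_vector transpose_transpose)

lemma posdef_cone_congruence:
  fixes a :: "real^'n^'p"
  assumes "r \<in> posdef_cone" "inj ((*v) a)"
  shows "transpose a ** r ** a \<in> posdef_cone"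
proof (rule posdef_coneI)
  show "transpose (transpose a ** r ** a) = transpose a ** r ** a"
    using assms(1) by (simp add: matrix_transpose_mul posdef_cone_transpose matrix_mul_assoc)
  fix x :: "real^'n" assume "x \<noteq> 0"
  hence "a *v x \<noteq> 0" using injD[OF assms(2), of x 0] by auto
  thus "0 < x \<bullet> ((transpose a ** r ** a) *v x)"
    unfolding inner_congruence using assms(1) by (rule posdef_cone_inner_pos[rotated])
qed

lemma mat_1_posdef: "mat 1 \<in> posdef_cone"
  by (auto intro!: posdef_coneI)

lemma gram_posdef:
  fixes a :: "real^'n^'p"
  assumes "inj ((*v) a)"
  shows "transpose a ** a \<in> posdef_cone"
  using posdef_cone_congruence[OF mat_1_posdef assms] by simp

lemma diag_matrix_posdef_iff:
  fixes d :: "'n::finite \<Rightarrow> real"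
  shows "diag_matrix d \<in> posdef_cone \<longleftrightarrow> (\<forall>i. d i > 0)"
proof
  assume "diag_matrix d \<in> posdef_cone"
  hence "0 < axis i 1 \<bullet> (diag_matrix d *v axis i 1)" for i
    by (rule posdef_cone_inner_pos) (simp add: axis_eq_0_iff)
  thus "\<forall>i. d i > 0" by (simp add: diag_matrix_vector inner_axis' )
next
  assume d: "\<forall>i. d i > 0"
  show "diag_matrix d \<in> posdef_cone"
  proof (rule posdef_coneI)
    fix x :: "real^'n" assume "x \<noteq> 0"
    then obtain k where k: "x $ k \<noteq> 0" by (auto simp: vec_eq_iff)
    have "0 < (\<Sum>i\<in>UNIV. d i * (x $ i)\<^sup>2)"
      using d k by (intro sum_pos2[of _ k]) (simp_all add: less_imp_le)
    thus "0 < x \<bullet> (diag_matrix d *v x)"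
      by (simp add: diag_matrix_vector inner_vec_def power2_eq_square mult_ac)
  qed simp
qed

lemma orthogonal_matrix_inj: "orthogonal_matrix (Q::real^'n^'n) \<Longrightarrow> inj ((*v) Q)"
  by (metis orthogonal_matrix_def matrix_left_invertible_injective)

lemma posdef_diagonalization:
  fixes r :: "real^'n^'n"
  assumes r: "r \<in> posdef_cone"
  obtains Q d where "orthogonal_matrix Q" "r = Q ** diag_matrix d ** transpose Q" "\<And>i. d i > 0"
proof -
  obtain Q d where Q: "orthogonal_matrix Q" "r = Q ** diag_matrix d ** transpose Q"
    using spectral_theorem[OF posdef_cone_transpose[OF r]] .
  have "transpose Q ** r ** Q = (transpose Q ** Q) ** diag_matrix d ** (transpose Q ** Q)"
    unfolding Q(2) by (simp only: matrix_mul_assoc)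
  hence "diag_matrix d = transpose Q ** r ** Q"
    using Q(1) by (simp add: orthogonal_matrix_def)
  also have "\<dots> \<in> posdef_cone"
    by (intro posdef_cone_congruence r orthogonal_matrix_inj Q)
  finally show ?thesis using that[OF Q] by (simp add: diag_matrix_posdef_iff)
qed

lemma det_orthogonal_conj:
  fixes Q :: "real^'n^'n"
  assumes "orthogonal_matrix Q" shows "det (Q ** r ** transpose Q) = det r"
proof -
  have "det Q * det Q = 1"
    using arg_cong[of _ _ det, OF assms[unfolded orthogonal_matrix_def, THEN conjunct2]] by (simp add: det_mul)
  thus ?thesis by (simp add: det_mul)
qed

lemma posdef_det_pos:
  fixes r :: "real^'n^'n"
  assumes "r \<in> posdef_cone" shows "det r > 0"
  using posdef_diagonalization[OF assms] det_orthogonal_conj by (metis det_diag_matrix prod_pos)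

section \<open>Square roots of positive definite matrices\<close>

lemma posdef_sqrt_exists:
  fixes r :: "real^'n^'n"
  assumes "r \<in> posdef_cone"
  obtains s where "s \<in> posdef_cone" "s ** s = r"
proof -
  obtain Q d where Q: "orthogonal_matrix Q" "r = Q ** diag_matrix d ** transpose Q" "\<And>i. d i > 0"
    using posdef_diagonalization[OF assms] by blast
  define e where "e i = sqrt (d i)" for i
  define s where "s = Q ** diag_matrix e ** transpose Q"
  have "transpose (transpose Q) ** diag_matrix e ** transpose Q \<in> posdef_cone"
    using Q(1,3) by (intro posdef_cone_congruence orthogonal_matrix_inj)
      (auto simp: diag_matrix_posdef_iff e_def orthogonal_matrix_transpose)
  hence "s \<in> posdef_cone" by (simp add: s_def)
  moreover have "s ** s = Q ** diag_matrix e ** (transpose Q ** Q) ** diag_matrix e ** transpose Q"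
    unfolding s_def by (simp only: matrix_mul_assoc)
  hence "s ** s = Q ** (diag_matrix e ** diag_matrix e) ** transpose Q"
    using Q(1) by (simp only: orthogonal_matrix_def matrix_mul_rid) (simp only: matrix_mul_assoc)
  hence "s ** s = r"
    using Q(3) by (simp add: Q(2) e_def less_imp_le)
  ultimately show ?thesis by (rule that)
qed

text \<open>The quadratic form attains a positive minimum on the compact unit sphere. This uniform
  constant drives both the continuity of the square root and the Borel measurability of the
  cone.\<close>

lemma posdef_coercive:
  fixes r :: "real^'n^'n"
  assumes "r \<in> posdef_cone"
  obtains c where "c > 0" "\<And>x. c * (x \<bullet> x) \<le> x \<bullet> (r *v x)"
proof -
  let ?q = "\<lambda>x. x \<bullet> (r *v x)"
  have "continuous_on (sphere 0 1) ?q"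
    by (intro continuous_intros linear_continuous_on matrix_vector_mul_bounded_linear)
  moreover have "sphere (0::real^'n) 1 \<noteq> {}" by simp
  ultimately obtain x where x: "norm x = 1" "\<And>y. norm y = 1 \<Longrightarrow> ?q x \<le> ?q y"
    using continuous_attains_inf[of "sphere 0 1" ?q] by auto
  show ?thesis
  proof
    show "?q x > 0" using x(1) assms by (intro posdef_cone_inner_pos) auto
    show "?q x * (y \<bullet> y) \<le> ?q y" for y
    proof (cases "y = 0")
      case False
      hence "?q x \<le> ?q (y /\<^sub>R norm y)" by (intro x(2)) simp
      also have "\<dots> = ?q y / (norm y * norm y)"
        by (simp add: matrix_vector_mult_scaleR field_simps)
      finally show ?thesis using False
        by (simp add: field_simps flip: power2_norm_eq_inner power2_eq_square)
    qed auto
  qed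
qed

text \<open>Writes the trace as a sum of quadratic forms at the columns of \<open>e\<close>, so that
  positivity and coercivity of \<open>t\<close> pass to the trace.\<close>

lemma trace_congruence:
  fixes e :: "real^'n^'p" and t :: "real^'p^'p"
  shows "trace (transpose e ** t ** e) = (\<Sum>j\<in>UNIV. column j e \<bullet> (t *v column j e))"
proof -
  have "trace (transpose e ** (t ** e)) = e \<bullet> (t ** e)"
    by (rule trace_transpose_mult_eq_inner)
  also have "\<dots> = (\<Sum>j\<in>UNIV. column j e \<bullet> column j (t ** e))"
    by (rule inner_matrix_columns)
  also have "\<dots> = (\<Sum>j\<in>UNIV. column j e \<bullet> (t *v column j e))"
    by (simp add: column_def matrix_matrix_mult_def matrix_vector_mult_def)
  finally show ?thesis by (simp add: matrix_mul_assoc)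
qed

text \<open>With \<open>e = s - t\<close> the trace of \<open>e (s\<^sup>2 - t\<^sup>2)\<close> equals that of \<open>e (s + t) e\<close>.\<close>

lemma posdef_square_expanding:
  fixes s t :: "real^'n^'n"
  assumes s: "s \<in> posdef_cone" and t: "t \<in> posdef_cone"
    and c: "\<And>x. c * (x \<bullet> x) \<le> x \<bullet> (t *v x)"
  shows "c * norm (s - t) \<le> norm (s ** s - t ** t)"
proof -
  define e where "e = s - t"
  have te: "transpose e = e"
    using s t by (simp add: e_def transpose_def vec_eq_iff posdef_cone_def)
  have id: "s ** s - t ** t = s ** e + e ** t"
    unfolding e_def by (simp add: vec_eq_iff matrix_matrix_mult_def sum.distrib[symmetric] sum_subtractf[symmetric] algebra_simps)
  have "trace (transpose e ** (s ** s - t ** t)) = trace (e ** (s ** e)) + trace (e ** (e ** t))"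
    by (simp add: te id matrix_add_ldistrib trace_add)
  also have "trace (e ** (e ** t)) = trace (e ** t ** e)"
    using trace_mul_sym[of e "e ** t"] by (simp add: matrix_mul_assoc)
  finally have *: "e \<bullet> (s ** s - t ** t) = trace (transpose e ** s ** e) + trace (transpose e ** t ** e)"
    unfolding trace_transpose_mult_eq_inner by (simp add: te matrix_mul_assoc)
  have "0 \<le> trace (transpose e ** s ** e)"
    unfolding trace_congruence
  proof (rule sum_nonneg)
    fix j show "0 \<le> column j e \<bullet> (s *v column j e)"
      using posdef_cone_inner_pos[OF s, of "column j e"] by (cases "column j e = 0") auto
  qed
  moreover have "c * (e \<bullet> e) \<le> trace (transpose e ** t ** e)"
    unfolding trace_congruence inner_matrix_columns[of e e] sum_distrib_left by (intro sum_mono c)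
  ultimately have "c * (e \<bullet> e) \<le> e \<bullet> (s ** s - t ** t)" using * by linarith
  also have "\<dots> \<le> norm e * norm (s ** s - t ** t)" by (rule norm_cauchy_schwarz)
  finally have "norm e * (c * norm e) \<le> norm e * norm (s ** s - t ** t)"
    by (simp add: power2_eq_square mult_ac flip: power2_norm_eq_inner)
  thus ?thesis unfolding e_def[symmetric] by (cases "e = 0") (auto simp: mult_le_cancel_left)
qed

lemma posdef_sqrt_unique:
  assumes "s \<in> posdef_cone" "t \<in> posdef_cone" "s ** s = t ** t"
  shows "s = t"
proof -
  obtain c where "c > 0" "\<And>x. c * (x \<bullet> x) \<le> x \<bullet> (t *v x)"
    using posdef_coercive[OF assms(2)] by blast
  thus ?thesis using posdef_square_expanding[OF assms(1,2), of c] assms(3)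
    by (simp add: mult_le_0_iff)
qed

lemma posdef_sqrt:
  assumes "r \<in> posdef_cone"
  shows posdef_sqrt_posdef: "posdef_sqrt r \<in> posdef_cone" and posdef_sqrt_square: "posdef_sqrt r ** posdef_sqrt r = r"
proof -
  have "\<exists>!s. s \<in> posdef_cone \<and> s ** s = r"
    using posdef_sqrt_exists[OF assms] posdef_sqrt_unique by metis
  from theI'[OF this] show "posdef_sqrt r \<in> posdef_cone" "posdef_sqrt r ** posdef_sqrt r = r"
    by (simp_all add: posdef_sqrt_def)
qed

lemma posdef_sqrt_eqI:
  assumes "s \<in> posdef_cone" "s ** s = r" shows "posdef_sqrt r = s"
  unfolding posdef_sqrt_def using assms posdef_sqrt_unique by (intro the_equality) auto

text \<open>Squaring expands distances to \<open>posdef_sqrt r\<close> by at least the coercivity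
  constant of that root, so taking roots is Lipschitz at each point. Continuity is what later makes
  the root Borel measurable.\<close>

lemma continuous_on_posdef_sqrt: "continuous_on posdef_cone (posdef_sqrt :: real^'n^'n \<Rightarrow> _)"
  unfolding continuous_on_iff
proof safe
  fix r :: "real^'n^'n" and \<epsilon> :: real assume r: "r \<in> posdef_cone" and e: "\<epsilon> > 0"
  obtain c where c: "c > 0" "\<And>x. c * (x \<bullet> x) \<le> x \<bullet> (posdef_sqrt r *v x)"
    using posdef_coercive[OF posdef_sqrt_posdef[OF r]] by blast
  show "\<exists>d>0. \<forall>r'\<in>posdef_cone. dist r' r < d \<longrightarrow> dist (posdef_sqrt r') (posdef_sqrt r) < \<epsilon>"
  proof (intro exI conjI ballI impI)
    show "c * \<epsilon> > 0" using c e by simp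
    fix r' assume r': "r' \<in> posdef_cone" "dist r' r < c * \<epsilon>"
    have "c * norm (posdef_sqrt r' - posdef_sqrt r) \<le> norm (r' - r)"
      using posdef_square_expanding[OF posdef_sqrt_posdef[OF r'(1)] posdef_sqrt_posdef[OF r] c(2)]
        posdef_sqrt_square[OF r] posdef_sqrt_square[OF r'(1)] by simp
    also have "\<dots> < c * \<epsilon>" using r'(2) by (simp add: dist_norm)
    finally show "dist (posdef_sqrt r') (posdef_sqrt r) < \<epsilon>" using c(1) by (simp add: dist_norm)
  qed
qed

section \<open>Slices of the Fourier transform and rotations of frames\<close>

lemma Basis_matrix: "(Basis :: (real^'m^'n) set) = range (\<lambda>(i, j). axis i (axis j 1))"
  by (auto simp: Basis_vec_def)

lemma inner_matrix_axis: "(x::real^'m^'n) \<bullet> axis i (axis j 1) = x $ i $ j"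
  by (simp add: inner_axis)

lemma prod_Basis_matrix: "(\<Prod>b\<in>Basis. (x::real^'m^'n) \<bullet> b) = (\<Prod>i\<in>UNIV. \<Prod>j\<in>UNIV. x $ i $ j)"
proof -
  have inj: "inj (\<lambda>(i, j). axis i (axis j 1) :: real^'m^'n)"
    by (auto simp: inj_on_def axis_eq_axis)
  show ?thesis
    unfolding Basis_matrix prod.reindex[OF inj]
    by (simp add: case_prod_beta inner_matrix_axis prod.cartesian_product)
qed

lemma mem_box_matrix: "(x::real^'m^'n) \<in> box l u \<longleftrightarrow> (\<forall>i j. l $ i $ j < x $ i $ j \<and> x $ i $ j < u $ i $ j)"
  by (simp add: mem_box Basis_matrix inner_matrix_axis)

lemma prod_Basis_vector: "(\<Prod>b\<in>Basis. (x::real^'n) \<bullet> b) = (\<Prod>i\<in>UNIV. x $ i)"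
proof -
  have B: "(Basis :: (real^'n) set) = range (\<lambda>i. axis i 1)" by (auto simp: Basis_vec_def)
  have inj: "inj (\<lambda>i. axis i 1 :: real^'n)" by (auto simp: inj_on_def axis_eq_axis)
  show ?thesis unfolding B prod.reindex[OF inj] by (simp add: inner_axis)
qed

lemma emeasure_box_vector:
  assumes "\<And>i. l $ i \<le> u $ i"
  shows "emeasure lborel (box l (u::real^'n)) = ennreal (\<Prod>i\<in>UNIV. u $ i - l $ i)"
proof -
  have "\<And>b. b \<in> Basis \<Longrightarrow> l \<bullet> b \<le> u \<bullet> b"
    using assms by (auto simp: Basis_vec_def inner_axis)
  thus ?thesis using prod_Basis_vector[of "u - l"] by (simp add: emeasure_lborel_box)
qed

lemma emeasure_box_matrix:
  assumes "\<And>i j. l $ i $ j \<le> u $ i $ j"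
  shows "emeasure lborel (box l (u::real^'m^'n)) = ennreal (\<Prod>i\<in>UNIV. \<Prod>j\<in>UNIV. u $ i $ j - l $ i $ j)"
proof -
  have "\<And>b. b \<in> Basis \<Longrightarrow> l \<bullet> b \<le> u \<bullet> b"
    using assms by (auto simp: Basis_matrix inner_matrix_axis)
  thus ?thesis using prod_Basis_matrix[of "u - l"] by (simp add: emeasure_lborel_box)
qed

lemma le_inner_Basis_matrix: "(\<And>b. b \<in> Basis \<Longrightarrow> l \<bullet> b \<le> u \<bullet> b) \<Longrightarrow> l $ i $ j \<le> (u::real^'m^'n) $ i $ j"
  by (metis Basis_matrix case_prod_conv inner_matrix_axis rangeI)

section \<open>Stacked matrices and the projection-slice identity\<close>

lemma vstack_nth [simp]: "vstack \<omega> t $ Inl a = \<omega> $ a" "vstack \<omega> t $ Inr b = t $ b"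
  by (simp_all add: vstack_def)

lemma vstack_inner: "vstack \<omega> t \<bullet> vstack \<omega>' t' = \<omega> \<bullet> \<omega>' + t \<bullet> t'"
  unfolding inner_vec_def[of "vstack \<omega> t"] UNIV_Plus_UNIV[symmetric]
  by (subst sum.Plus) (auto simp: inner_vec_def)

lemma vstack_mult: "vstack \<omega> t ** s = vstack (\<omega> ** s) (t ** s)"
  by (simp add: vec_eq_iff matrix_matrix_mult_def vstack_def split: sum.split)

lemma vstack_measurable [measurable]:
  "(\<lambda>(\<omega>, t). vstack \<omega> t :: real^'m^('k::finite + 'l::finite)) \<in> borel_measurable (lborel \<Otimes>\<^sub>M lborel)"
proof -
  have "continuous_on UNIV (\<lambda>p. vstack (fst p) (snd p) :: real^'m^('k + 'l))"
    unfolding vstack_def continuous_on_componentwise[where 'b="real^'m^('k+'l)"]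
  proof
    fix b :: "real^'m^('k + 'l)" assume "b \<in> Basis"
    then obtain i j where b: "b = axis i (axis j 1)" by (auto simp: Basis_matrix)
    show "continuous_on UNIV (\<lambda>p. (\<chi> i. case i of Inl a \<Rightarrow> fst p $ a | Inr b \<Rightarrow> snd p $ b) \<bullet> b)"
      unfolding b inner_matrix_axis by (cases i) (auto intro!: continuous_intros)
  qed
  hence "(\<lambda>p. vstack (fst p) (snd p) :: real^'m^('k + 'l)) \<in> borel_measurable borel"
    by (rule borel_measurable_continuous_onI)
  thus ?thesis by (simp add: lborel_prod case_prod_beta)
qed

text \<open>A box of stacked matrices is a product of boxes, so both measures agree on boxes. The
  splitting separates the variable \<open>\<omega>\<close> along a matrix plane from the offset
  \<open>t\<close>, as Fubini requires.\<close>

lemma lborel_vstack: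
  "(lborel :: (real^'m^('k::finite + 'l::finite)) measure) = distr (lborel \<Otimes>\<^sub>M lborel) borel (\<lambda>(\<omega>, t). vstack \<omega> t)"
proof (rule lborel_eqI)
  fix l u :: "real^'m^('k + 'l)"
  assume "\<And>b. b \<in> Basis \<Longrightarrow> l \<bullet> b \<le> u \<bullet> b"
  hence le: "l $ i $ j \<le> u $ i $ j" for i j by (rule le_inner_Basis_matrix)
  let ?L = "\<lambda>x::real^'m^('k + 'l). \<chi> a. x $ Inl a" and ?R = "\<lambda>x::real^'m^('k + 'l). \<chi> a. x $ Inr a"
  have "(\<lambda>(\<omega>, t). vstack \<omega> t) -` box l u \<inter> space (lborel \<Otimes>\<^sub>M lborel) = box (?L l) (?L u) \<times> box (?R l) (?R u)"
    by (auto simp: mem_box_matrix space_pair_measure split_sum_all)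
  hence "emeasure (distr (lborel \<Otimes>\<^sub>M lborel) borel (\<lambda>(\<omega>, t). vstack \<omega> t)) (box l u)
      = emeasure lborel (box (?L l) (?L u)) * emeasure lborel (box (?R l) (?R u))"
    by (simp add: emeasure_distr lborel.emeasure_pair_measure_Times)
  also have "\<dots> = ennreal (\<Prod>i\<in>UNIV. \<Prod>j\<in>UNIV. u $ i $ j - l $ i $ j)"
    unfolding UNIV_Plus_UNIV[symmetric]
    by (subst prod.Plus) (auto simp: emeasure_box_matrix le ennreal_mult prod_nonneg)
  finally show "emeasure (distr (lborel \<Otimes>\<^sub>M lborel) borel (\<lambda>(\<omega>, t). vstack \<omega> t)) (box l u) = (\<Prod>b\<in>Basis. (u - l) \<bullet> b)"
    using prod_Basis_matrix[of "u - l"] by simp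
qed simp

lemma xi0_mult: "xi0 ** y = vstack 0 y"
  by (simp add: xi0_def vstack_mult)

lemma xi0_stiefel: "(xi0 :: real^'l^('k::finite + 'l::finite)) \<in> stiefel"
proof -
  have "(transpose (xi0 :: real^'l^('k + 'l)) ** xi0) $ i $ j = (mat 1 :: real^'l^'l) $ i $ j" for i j
    unfolding matrix_matrix_mult_def UNIV_Plus_UNIV[symmetric]
    by (subst vec_lambda_beta, subst vec_lambda_beta, subst sum.Plus)
       (auto simp: xi0_def transpose_def mat_def if_distrib[of "\<lambda>x. x * _"] cong: if_cong)
  thus ?thesis by (simp add: stiefel_def vec_eq_iff)
qed

lemma stiefel_mult_left: "orthogonal_matrix g \<Longrightarrow> v \<in> stiefel \<Longrightarrow> g ** v \<in> stiefel"
  unfolding stiefel_def mem_Collect_eq matrix_transpose_mul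
  by (metis matrix_mul_assoc matrix_mul_lid orthogonal_matrix)

lemma fourier_eq_fourier_transform: "fourier f = fourier_transform f"
  by (simp add: fun_eq_iff fourier_def fourier_transform_def trace_transpose_mult_eq_inner cis_conv_exp)

text \<open>The character of frequency \<open>\<xi> ** y\<close> is constant on each plane: at the
  image of the stacked matrix of \<omega> and t its exponent is y \<bullet> t. Integrating over
  \<omega> therefore gives the Radon transform, and the rotation preserves Lebesgue measure.\<close>

lemma fourier_radon:
  fixes f :: "real^'m^('k::finite + 'l::finite) \<Rightarrow> complex"
  assumes f: "integrable lborel f" and g: "rotation_matrix g" "g ** xi0 = \<xi>"
  shows "fourier (\<lambda>t. radon f (\<xi>, t)) y = fourier f (\<xi> ** y)"
proof -
  have [measurable]: "f \<in> borel_measurable borel" using f by auto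
  \<comment> \<open>The rotation selected inside \<open>radon\<close>. The given \<open>g\<close>
    shows that a suitable one exists; orthogonality and \<open>G ** xi0 = \<xi>\<close> are the
    properties carried forward.\<close>
  define G where "G = (SOME g. rotation_matrix g \<and> g ** xi0 = \<xi>)"
  have "rotation_matrix G \<and> G ** xi0 = \<xi>"
    unfolding G_def by (rule someI[of _ g]) (use g in simp)
  hence G: "orthogonal_matrix G" "G ** xi0 = \<xi>" by (auto simp: rotation_matrix_def)
  have "\<xi> \<in> stiefel" using stiefel_mult_left[OF G(1) xi0_stiefel] G(2) by simp
  hence radon: "radon f (\<xi>, t) = (\<integral>\<omega>. f (G ** vstack \<omega> t) \<partial>lborel)" for t
    by (simp add: radon_def G_def)
  let ?h = "\<lambda>x. cis ((\<xi> ** y) \<bullet> x) * f x"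
  have T: "orthogonal_transformation (\<lambda>x. G ** x :: real^'m^('k + 'l))"
    by (rule orthogonal_transformation_matrix_left[OF G(1)])
  note [measurable] = borel_measurable_linear[OF orthogonal_transformation_linear[OF T]]
  have inner: "(\<xi> ** y) \<bullet> (G ** vstack \<omega> t) = y \<bullet> t" for \<omega> t
  proof -
    have "(\<xi> ** y) \<bullet> (G ** vstack \<omega> t) = (G ** (xi0 ** y)) \<bullet> (G ** vstack \<omega> t)"
      using G(2) by (simp add: matrix_mul_assoc)
    also have "\<dots> = (xi0 ** y) \<bullet> vstack \<omega> t"
      using T by (simp add: orthogonal_transformation_def)
    finally show ?thesis by (simp add: xi0_mult vstack_inner)
  qed
  have "integrable (distr lborel borel (\<lambda>x. G ** x)) ?h"
    using integrable_cis_mult[OF f] by (simp add: lborel_distr_orthogonal[OF T])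
  hence "integrable lborel (\<lambda>x. ?h (G ** x))"
    by (subst (asm) integrable_distr_eq) auto
  hence "integrable (lborel \<Otimes>\<^sub>M lborel) (\<lambda>p. ?h (G ** (case p of (\<omega>, t) \<Rightarrow> vstack \<omega> t)))"
    by (subst (asm) lborel_vstack, subst (asm) integrable_distr_eq) auto
  hence int: "integrable (lborel \<Otimes>\<^sub>M lborel) (\<lambda>(\<omega>, t). cis (y \<bullet> t) * f (G ** vstack \<omega> t))"
    by (simp add: case_prod_unfold inner)
  have "fourier (\<lambda>t. radon f (\<xi>, t)) y = (\<integral>t. (\<integral>\<omega>. cis (y \<bullet> t) * f (G ** vstack \<omega> t) \<partial>lborel) \<partial>lborel)"
    by (simp add: fourier_eq_fourier_transform fourier_transform_def radon)
  also have "\<dots> = (\<integral>(\<omega>, t). cis (y \<bullet> t) * f (G ** vstack \<omega> t) \<partial>(lborel \<Otimes>\<^sub>M lborel))"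
    by (rule lborel_pair.integral_snd[OF int])
  also have "\<dots> = (\<integral>p. ?h (G ** (case p of (\<omega>, t) \<Rightarrow> vstack \<omega> t)) \<partial>(lborel \<Otimes>\<^sub>M lborel))"
    by (simp add: case_prod_unfold inner)
  also have "\<dots> = (\<integral>x. ?h (G ** x) \<partial>lborel)"
  proof -
    have "(\<lambda>x. ?h (G ** x)) \<in> borel_measurable borel" by measurable
    from integral_distr[OF vstack_measurable this] show ?thesis
      by (simp only: lborel_vstack[symmetric])
  qed
  also have "\<dots> = (\<integral>x. ?h x \<partial>lborel)"
    by (rule integral_lborel_orthogonal[OF T])
  finally show ?thesis by (simp add: fourier_eq_fourier_transform fourier_transform_def)
qed

text \<open>Only the added vectors are orthonormal; the prescribed \<open>y i\<close> stay
  arbitrary, since their Gram matrix is later the object of study. The complement of their span has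
  at least as many dimensions as there are free indices.\<close>

lemma orthonormal_completion:
  fixes y :: "'n::finite \<Rightarrow> real^'n"
  obtains z where "\<And>i. i \<in> I \<Longrightarrow> z i = y i" "\<And>i. i \<notin> I \<Longrightarrow> norm (z i) = 1"
    "\<And>i j. i \<notin> I \<Longrightarrow> i \<noteq> j \<Longrightarrow> orthogonal (z i) (z j)"
proof -
  define W where "W = {x. \<forall>a\<in>span (y ` I). orthogonal a x}"
  have W: "subspace W" unfolding W_def by (rule subspace_orthogonal_to_vectors)
  have "dim W + dim (span (y ` I)) = CARD('n)"
    using dim_subspace_orthogonal_to_vectors[of "span (y ` I)" UNIV] by (simp add: W_def)
  moreover have "dim (span (y ` I)) \<le> card I"
    using dim_le_card'[of "y ` I"] card_image_le[of I y] by simp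
  ultimately have dimW: "card (- I) \<le> dim W" by (simp add: Compl_eq_Diff_UNIV card_Diff_subset)
  obtain B where B: "B \<subseteq> W" "pairwise orthogonal B" "\<And>x. x \<in> B \<Longrightarrow> norm x = 1" "independent B" "card B = dim W"
    using orthonormal_basis_subspace[OF W] by metis
  have "finite B" using B(4) independent_bound by blast
  then obtain f where f: "f ` (- I) \<subseteq> B" "inj_on f (- I)"
    using card_le_inj[of "- I" B] dimW B(5) by auto
  define z where "z i = (if i \<in> I then y i else f i)" for i
  have fB: "f i \<in> B" if "i \<notin> I" for i using f(1) that by blast
  have "orthogonal (f i) (z j)" if "i \<notin> I" "i \<noteq> j" for i j
  proof (cases "j \<in> I")
    case True
    hence "y j \<in> span (y ` I)" by (simp add: span_base)
    thus ?thesis using True B(1) fB[OF that(1)] by (auto simp: z_def W_def orthogonal_commute)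
  next
    case False
    hence "f i \<noteq> f j" using f(2) that by (auto dest: inj_onD)
    thus ?thesis using False B(2) fB that(1) by (auto simp: z_def pairwise_def)
  qed
  thus ?thesis using B(3) fB by (intro that[of z]) (auto simp: z_def)
qed

section \<open>Frames and the rotations between them\<close>

lemma stiefel_column_inner:
  assumes "v \<in> stiefel" shows "column i v \<bullet> column j v = (if i = j then 1 else 0)"
proof -
  have "(transpose v ** v) $ i $ j = (mat 1 :: real^'a^'a) $ i $ j" using assms by (simp add: stiefel_def)
  thus ?thesis by (simp add: mat_def matrix_matrix_mult_def transpose_def column_def inner_vec_def)
qed

lemma stiefel_extend_orthogonal:
  fixes v :: "real^'m^'n" and \<iota> :: "'m \<Rightarrow> 'n"
  assumes v: "v \<in> stiefel" and \<iota>: "inj \<iota>"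
  obtains Q where "orthogonal_matrix Q" "\<And>j. column (\<iota> j) Q = column j v"
proof -
  obtain z where z: "\<And>i. i \<in> range \<iota> \<Longrightarrow> z i = column (inv \<iota> i) v" "\<And>i. i \<notin> range \<iota> \<Longrightarrow> norm (z i) = 1"
    "\<And>i j. i \<notin> range \<iota> \<Longrightarrow> i \<noteq> j \<Longrightarrow> orthogonal (z i) (z j)"
    using orthonormal_completion[of "range \<iota>" "\<lambda>i. column (inv \<iota> i) v"] by blast
  define Q :: "real^'n^'n" where "Q = (\<chi> i j. z j $ i)"
  have col: "column j Q = z j" for j by (simp add: Q_def column_def vec_eq_iff)
  have "norm (z i) = 1" for i
    using z(1,2)[of i] stiefel_column_inner[OF v] by (cases "i \<in> range \<iota>") (auto simp: norm_eq_1)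
  moreover have "orthogonal (z i) (z j)" if "i \<noteq> j" for i j
  proof (cases "i \<in> range \<iota> \<and> j \<in> range \<iota>")
    case True
    then obtain a b where "i = \<iota> a" "j = \<iota> b" by blast
    thus ?thesis using z(1)[of i] z(1)[of j] stiefel_column_inner[OF v, of a b] that \<iota>
      by (auto simp: orthogonal_def)
  next
    case False
    thus ?thesis using z(3) that by (metis orthogonal_commute)
  qed
  ultimately have "orthogonal_matrix Q"
    by (simp add: orthogonal_matrix_orthonormal_columns col)
  moreover have "column (\<iota> j) Q = column j v" for j using z(1)[of "\<iota> j"] \<iota> by (simp add: col)
  ultimately show ?thesis by (rule that)
qed

text \<open>Completing both frames to orthogonal matrices gives an orthogonal map between them whose
  determinant may be -1. The strict inequality leaves a column index \<open>k\<close> outside the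
  frame, and scaling that direction by \<open>c\<close>, which is 1 or -1, corrects the determinant
  without touching the frame.\<close>

lemma stiefel_rotation_exists:
  fixes v w :: "real^'m^'n"
  assumes "CARD('m) < CARD('n)" "v \<in> stiefel" "w \<in> stiefel"
  obtains g where "rotation_matrix g" "g ** v = w"
proof -
  obtain \<iota> :: "'m \<Rightarrow> 'n" where \<iota>: "inj \<iota>"
    using card_le_inj[of "UNIV::'m set" "UNIV::'n set"] assms(1) by auto
  have "range \<iota> \<noteq> UNIV"
    using assms(1) card_image[OF \<iota>] by (metis less_irrefl)
  then obtain k where k: "k \<notin> range \<iota>" by blast
  obtain P where P: "orthogonal_matrix P" "\<And>j. column (\<iota> j) P = column j v"
    using stiefel_extend_orthogonal[OF assms(2) \<iota>] by blast
  obtain Q where Q: "orthogonal_matrix Q" "\<And>j. column (\<iota> j) Q = column j w"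
    using stiefel_extend_orthogonal[OF assms(3) \<iota>] by blast
  define c where "c = det P * det Q"
  have c: "c * c = 1" "c = 1 \<or> c = -1"
    using det_orthogonal_matrix[OF P(1)] det_orthogonal_matrix[OF Q(1)] by (auto simp: c_def)
  define D where "D = diag_matrix (\<lambda>i. if i = k then c else 1)"
  have D: "orthogonal_matrix D"
    using c(1) by (simp add: orthogonal_matrix D_def if_distrib[of "\<lambda>x. x * _"] cong: if_cong)
      (simp add: diag_matrix_def mat_def vec_eq_iff)
  have detD: "det D = c" by (simp add: D_def)
  define g where "g = Q ** D ** transpose P"
  have "orthogonal_matrix g"
    unfolding g_def by (intro orthogonal_matrix_mul Q D orthogonal_matrix_transpose[THEN iffD2] P)
  moreover have "det g = 1" using c(1) by (simp add: g_def det_mul detD c_def mult_ac)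
  moreover have "g ** v = w"
  proof -
    have e: "transpose P *v column j v = axis (\<iota> j) 1" for j
    proof -
      have "transpose P *v column (\<iota> j) P = transpose P *v (P *v axis (\<iota> j) 1)"
        by (simp add: matrix_vector_mult_basis)
      also have "\<dots> = axis (\<iota> j) 1" using P(1) by (simp add: matrix_vector_mul_assoc orthogonal_matrix)
      finally show ?thesis by (simp add: P(2))
    qed
    have Da: "D *v axis (\<iota> j) 1 = axis (\<iota> j) 1" for j
      using k by (auto simp: D_def diag_matrix_vector axis_def vec_eq_iff)
    have "g *v column j v = column j w" for j
      unfolding g_def matrix_vector_mul_assoc[symmetric] e Da by (simp add: matrix_vector_mult_basis Q(2))
    moreover have "column j (g ** v) = g *v column j v" for j
      by (simp add: column_def matrix_matrix_mult_def matrix_vector_mult_def vec_eq_iff)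
    ultimately show ?thesis by (simp add: vec_eq_iff column_def)
  qed
  ultimately show ?thesis using that by (simp add: rotation_matrix_def)
qed

section \<open>Failure of injectivity\<close>

lemma real_polynomial_function_derivative:
  fixes p :: "'a::euclidean_space \<Rightarrow> real"
  assumes "real_polynomial_function p"
  shows "\<exists>p'. (\<forall>b. real_polynomial_function (\<lambda>x. p' x b)) \<and> (\<forall>x. (p has_derivative p' x) (at x))"
  using assms
proof (induction rule: real_polynomial_function.induct)
  case (linear f)
  thus ?case
    by (intro exI[of _ "\<lambda>_. f"]) (auto intro: bounded_linear_imp_has_derivative)
next
  case (const c)
  thus ?case by (intro exI[of _ "\<lambda>_ _. 0"]) auto
next
  case (add f g)
  then obtain f' g' where "\<forall>b. real_polynomial_function (\<lambda>x. f' x b)" "\<forall>x. (f has_derivative f' x) (at x)"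
    "\<forall>b. real_polynomial_function (\<lambda>x. g' x b)" "\<forall>x. (g has_derivative g' x) (at x)" by blast
  thus ?case
    by (intro exI[of _ "\<lambda>x h. f' x h + g' x h"]) (auto intro: has_derivative_add)
next
  case (mult f g)
  then obtain f' g' where "\<forall>b. real_polynomial_function (\<lambda>x. f' x b)" "\<forall>x. (f has_derivative f' x) (at x)"
    "\<forall>b. real_polynomial_function (\<lambda>x. g' x b)" "\<forall>x. (g has_derivative g' x) (at x)" by blast
  thus ?case using mult.hyps
    by (intro exI[of _ "\<lambda>x h. f x * g' x h + f' x h * g x"] conjI allI
        real_polynomial_function.intros(3,4) has_derivative_mult) blast+
qed

lemma real_polynomial_function_bound:
  fixes p :: "'a::euclidean_space \<Rightarrow> real"
  assumes "real_polynomial_function p"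
  shows "\<exists>C N. C \<ge> 0 \<and> (\<forall>x. \<bar>p x\<bar> \<le> C * (1 + norm x) ^ N)"
  using assms
proof (induction rule: real_polynomial_function.induct)
  case (linear f)
  then obtain K where K: "K \<ge> 0" "\<And>x. norm (f x) \<le> norm x * K" using bounded_linear.nonneg_bounded by blast
  have "\<bar>f x\<bar> \<le> K * (1 + norm x) ^ 1" for x
    using K(2)[of x] K(1) by (simp add: algebra_simps)
  thus ?case using K(1) by blast
next
  case (const c)
  have "\<bar>c\<bar> \<le> \<bar>c\<bar> * (1 + norm x) ^ 0" for x :: 'a by simp
  thus ?case by (meson abs_ge_zero)
next
  case (add f g)
  then obtain C N D M where C: "C \<ge> 0" "D \<ge> 0" "\<And>x. \<bar>f x\<bar> \<le> C * (1 + norm x) ^ N" "\<And>x. \<bar>g x\<bar> \<le> D * (1 + norm x) ^ M" by metis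
  have "\<bar>f x + g x\<bar> \<le> (C + D) * (1 + norm x) ^ (N + M)" for x
  proof -
    have "C * (1 + norm x) ^ N \<le> C * (1 + norm x) ^ (N + M)" "D * (1 + norm x) ^ M \<le> D * (1 + norm x) ^ (N + M)"
      using C(1,2) by (auto intro!: mult_left_mono power_increasing)
    thus ?thesis using C(3)[of x] C(4)[of x] by (simp add: algebra_simps)
  qed
  thus ?case using C(1,2) by (meson add_nonneg_nonneg)
next
  case (mult f g)
  then obtain C N D M where C: "C \<ge> 0" "D \<ge> 0" "\<And>x. \<bar>f x\<bar> \<le> C * (1 + norm x) ^ N" "\<And>x. \<bar>g x\<bar> \<le> D * (1 + norm x) ^ M" by metis
  have "\<bar>f x * g x\<bar> \<le> (C * D) * (1 + norm x) ^ (N + M)" for x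
    using mult_mono[OF C(3)[of x] C(4)[of x]] C(1) by (simp add: abs_mult power_add mult_ac)
  thus ?case using C(1,2) by (meson mult_nonneg_nonneg)
qed

text \<open>From 1 + s \<le> exp s the product is at most exp(K s - s^2/2) with s the norm, and
  completing the square bounds the exponent by K^2/2.\<close>

lemma one_plus_norm_power_gauss_bound: "(1 + norm x) ^ K * gauss x \<le> exp ((real K)\<^sup>2 / 2)"
proof -
  have "(1 + norm x) ^ K \<le> exp (norm x) ^ K" by (intro power_mono exp_ge_add_one_self) auto
  hence "(1 + norm x) ^ K * gauss x \<le> exp (norm x) ^ K * gauss x"
    by (intro mult_right_mono) (simp_all add: gauss_nonneg)
  also have "\<dots> = exp (real K * norm x - (norm x)\<^sup>2 / 2)"
    by (simp add: gauss_def exp_of_nat_mult[symmetric] exp_add[symmetric] power2_norm_eq_inner)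
  also have "real K * norm x - (norm x)\<^sup>2 / 2 \<le> (real K)\<^sup>2 / 2"
    using zero_le_power2[of "real K - norm x"] by (simp add: power2_diff)
  finally show ?thesis by simp
qed

text \<open>Differentiating the Gaussian only produces the polynomial factor
  \<open>- (x \<bullet> b)\<close>, so polynomials times the Gaussian are closed under partial
  derivatives and an induction over multi-indices is possible.\<close>

lemma partial_deriv_polynomial_gauss:
  fixes p :: "'a::euclidean_space \<Rightarrow> real"
  assumes "real_polynomial_function p"
  shows "\<exists>q. real_polynomial_function q \<and>
      partial_deriv b (\<lambda>x. complex_of_real (p x * gauss x)) = (\<lambda>x. complex_of_real (q x * gauss x))"
    and "(\<lambda>x. complex_of_real (p x * gauss x)) differentiable at x"
proof -
  obtain p' where p': "\<And>b. real_polynomial_function (\<lambda>x. p' x b)" "\<And>x. (p has_derivative p' x) (at x)"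
    using real_polynomial_function_derivative[OF assms] by blast
  have g: "(gauss has_derivative (\<lambda>h. - (x \<bullet> h) * gauss x)) (at x)" for x :: 'a
    unfolding gauss_def[abs_def]
    by (auto intro!: derivative_eq_intros simp: inner_commute)
  have d: "((\<lambda>x. complex_of_real (p x * gauss x)) has_derivative
      (\<lambda>h. complex_of_real (p x * (- (x \<bullet> h) * gauss x) + p' x h * gauss x))) (at x)" for x
    by (intro has_derivative_of_real has_derivative_mult p' g)
  thus "(\<lambda>x. complex_of_real (p x * gauss x)) differentiable at x" by (auto simp: differentiable_def)
  define q where "q x = p x * (- (x \<bullet> b)) + p' x b" for x
  have "real_polynomial_function (\<lambda>x. - (x \<bullet> b))"
    by (intro real_polynomial_function.intros(1) bounded_linear_minus bounded_linear_inner_left)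
  hence "real_polynomial_function q"
    unfolding q_def[abs_def] using assms p'(1)
    by (intro real_polynomial_function.intros(3) real_polynomial_function.intros(4))
  moreover have "partial_deriv b (\<lambda>x. complex_of_real (p x * gauss x)) = (\<lambda>x. complex_of_real (q x * gauss x))"
    unfolding partial_deriv_def frechet_derivative_at[OF d, symmetric]
    by (simp add: q_def fun_eq_iff algebra_simps)
  ultimately show "\<exists>q. real_polynomial_function q \<and>
      partial_deriv b (\<lambda>x. complex_of_real (p x * gauss x)) = (\<lambda>x. complex_of_real (q x * gauss x))"
    by blast
qed

lemma polynomial_gauss_schwartz:
  fixes p :: "'a::euclidean_space \<Rightarrow> real"
  assumes p: "real_polynomial_function p"
  shows "(\<lambda>x. complex_of_real (p x * gauss x)) \<in> schwartz"
proof -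
  have *: "\<exists>q. real_polynomial_function q \<and>
      foldr partial_deriv bs (\<lambda>x. complex_of_real (p x * gauss x)) = (\<lambda>x. complex_of_real (q x * gauss x))" for bs
  proof (induction bs)
    case Nil
    show ?case using p by auto
  next
    case (Cons b bs)
    then obtain q where q: "real_polynomial_function q"
      "foldr partial_deriv bs (\<lambda>x. complex_of_real (p x * gauss x)) = (\<lambda>x. complex_of_real (q x * gauss x))" by blast
    show ?case using partial_deriv_polynomial_gauss(1)[OF q(1), of b] by (simp only: q(2) foldr.simps o_apply)
  qed
  show ?thesis
    unfolding schwartz_def mem_Collect_eq
  proof (intro ballI conjI allI)
    fix bs :: "'a list"
    obtain q where q: "real_polynomial_function q"
      "foldr partial_deriv bs (\<lambda>x. complex_of_real (p x * gauss x)) = (\<lambda>x. complex_of_real (q x * gauss x))"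
      using *[of bs] by blast
    show "foldr partial_deriv bs (\<lambda>x. complex_of_real (p x * gauss x)) differentiable at x" for x
      unfolding q(2) by (rule partial_deriv_polynomial_gauss(2)[OF q(1)])
    fix N :: nat
    obtain C M where C: "C \<ge> 0" "\<And>x. \<bar>q x\<bar> \<le> C * (1 + norm x) ^ M"
      using real_polynomial_function_bound[OF q(1)] by blast
    have "(1 + norm x) ^ N * norm (complex_of_real (q x * gauss x)) \<le> C * exp ((real (N + M))\<^sup>2 / 2)" for x
    proof -
      have "(1 + norm x) ^ N * norm (complex_of_real (q x * gauss x)) = (1 + norm x) ^ N * (\<bar>q x\<bar> * gauss x)"
        by (simp only: norm_of_real abs_mult) (simp add: gauss_nonneg)
      also have "\<dots> \<le> (1 + norm x) ^ N * ((C * (1 + norm x) ^ M) * gauss x)"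
        by (intro mult_left_mono mult_right_mono C) (auto simp: gauss_nonneg)
      also have "\<dots> = C * ((1 + norm x) ^ (N + M) * gauss x)" by (simp add: power_add mult_ac)
      also have "\<dots> \<le> C * exp ((real (N + M))\<^sup>2 / 2)"
        by (intro mult_left_mono C one_plus_norm_power_gauss_bound)
      finally show ?thesis .
    qed
    thus "\<exists>C. \<forall>x. (1 + norm x) ^ N * norm (foldr partial_deriv bs (\<lambda>x. complex_of_real (p x * gauss x)) x) \<le> C"
      unfolding q(2) by blast
  qed
qed

text \<open>The reflection that negates \<open>w\<close> and fixes its orthogonal complement,
  obtained by conjugating a coordinate reflection. A matrix \<open>t\<close> that annihilates
  \<open>w\<close> does not see the change of sign.\<close>

lemma reflection_exists:
  fixes w :: "real^'m"
  assumes w: "w \<noteq> 0"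
  obtains \<rho> where "orthogonal_matrix \<rho>" "det \<rho> = - 1" "\<And>t :: real^'m^'l. t *v w = 0 \<Longrightarrow> t ** \<rho> = t"
proof -
  define k :: 'm where "k = undefined"
  have "norm (w /\<^sub>R norm w) = 1" using w by simp
  then obtain Q where Q: "orthogonal_matrix Q" "Q *v axis k 1 = w /\<^sub>R norm w"
    using orthogonal_matrix_exists_basis by metis
  define D :: "real^'m^'m" where "D = diag_matrix (\<lambda>i. if i = k then -1 else 1)"
  define \<rho> where "\<rho> = Q ** D ** transpose Q"
  have D: "orthogonal_matrix D"
    by (simp add: orthogonal_matrix D_def if_distrib[of "\<lambda>x. x * _"] cong: if_cong)
      (simp add: diag_matrix_def mat_def vec_eq_iff)
  show ?thesis
  proof
    show "orthogonal_matrix \<rho>"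
      unfolding \<rho>_def by (intro orthogonal_matrix_mul Q D orthogonal_matrix_transpose[THEN iffD2])
    show "det \<rho> = - 1"
      unfolding \<rho>_def det_orthogonal_conj[OF Q(1)] by (simp add: D_def)
    fix t :: "real^'m^'l" assume t: "t *v w = 0"
    have "(t ** Q) $ i $ k = 0" for i
    proof -
      have "(t ** Q) $ i $ k = (t *v (Q *v axis k 1)) $ i"
        unfolding matrix_vector_mul_assoc by (simp add: matrix_vector_mult_basis column_def)
      also have "\<dots> = 0" by (simp add: Q(2) matrix_vector_mult_scaleR t)
      finally show ?thesis .
    qed
    hence "(t ** Q ** D) $ i $ j = (t ** Q) $ i $ j" for i j
      by (auto simp: matrix_matrix_mult_def[of "t ** Q"] D_def diag_matrix_def if_distrib[of "\<lambda>x. _ * x"] cong: if_cong)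
    hence "t ** Q ** D = t ** Q" by (simp add: vec_eq_iff)
    hence "t ** \<rho> = t ** (Q ** transpose Q)" by (simp add: \<rho>_def matrix_mul_assoc)
    thus "t ** \<rho> = t" using Q(1) by (simp add: orthogonal_matrix_def)
  qed
qed

text \<open>The function \<open>det (x\<^sub>I) exp (-\<bar>x\<bar>\<^sup>2/2)\<close> changes sign under the reflections \<open>x \<mapsto> x \<rho>\<close>;
  if \<open>t\<close> has fewer rows than columns, some such reflection fixes \<open>t\<close>.\<close>

lemma radon_not_inj:
  assumes "CARD('m) \<le> CARD('k::finite + 'l::finite)" and less: "CARD('l) < CARD('m)"
  shows "\<not> inj_on (radon :: (real^'m^('k + 'l) \<Rightarrow> complex) \<Rightarrow> _) schwartz"
proof -
  \<comment> \<open>\<open>\<iota>\<close> selects the rows of the minor; it exists because there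
    are at least as many rows as columns.\<close>
  obtain \<iota> :: "'m \<Rightarrow> 'k + 'l" where \<iota>: "inj \<iota>"
    using card_le_inj[of "UNIV::'m set" "UNIV::('k + 'l) set"] assms(1) by auto
  define minor where "minor x = (\<chi> a j. x $ \<iota> a $ j)" for x :: "real^'m^('k + 'l)"
  define f where "f x = complex_of_real (det (minor x) * gauss x)" for x
  have "real_polynomial_function (\<lambda>x. det (minor x))"
    unfolding det_def minor_def
    by (intro real_polynomial_function_sum real_polynomial_function_prod real_polynomial_function.intros(4)
        real_polynomial_function.intros(2) real_polynomial_function.intros(1))
       (auto simp: finite_permutations intro: bounded_linear_compose[OF bounded_linear_vec_nth bounded_linear_vec_nth])
  hence f: "f \<in> schwartz" unfolding f_def[abs_def] by (rule polynomial_gauss_schwartz)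
  have sign: "f (x ** \<rho>) = - f x" if "orthogonal_matrix \<rho>" "det \<rho> = - 1" for x \<rho>
  proof -
    have "minor (x ** \<rho>) = minor x ** \<rho>"
      by (simp add: minor_def vec_eq_iff matrix_matrix_mult_def)
    moreover have "orthogonal_transformation (\<lambda>x :: real^'m^('k + 'l). x ** \<rho>)"
      by (rule orthogonal_transformation_matrix_right[OF that(1)])
    hence "gauss (x ** \<rho>) = gauss x"
      by (simp add: gauss_def orthogonal_transformation_def)
    ultimately show ?thesis using that(2) by (simp add: f_def det_mul)
  qed
  have "radon f (\<xi>, t) = 0" if \<xi>: "\<xi> \<in> stiefel" for \<xi> :: "real^'l^('k + 'l)" and t :: "real^'m^'l"
  proof -
    have "rank t < CARD('m)" using rank_bound[of t] less by simp
    hence "\<not> inj ((*v) t)" by (simp add: less_rank_noninjective)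
    then obtain w where w: "w \<noteq> 0" "t *v w = 0"
      by (auto simp: inj_on_def) (metis matrix_vector_mult_diff_distrib right_minus_eq)
    obtain \<rho> where \<rho>: "orthogonal_matrix \<rho>" "det \<rho> = - 1" "t ** \<rho> = t"
      using reflection_exists[OF w(1)] w(2) by metis
    define G where "G = (SOME g. rotation_matrix g \<and> g ** xi0 = \<xi>)"
    have radon: "radon f (\<xi>, t) = (\<integral>\<omega>. f (G ** vstack \<omega> t) \<partial>lborel)"
      using \<xi> by (simp add: radon_def G_def)
    have "vstack (\<omega> ** \<rho>) t = vstack \<omega> t ** \<rho>" for \<omega> :: "real^'m^'k"
      by (simp add: vstack_mult \<rho>)
    hence "f (G ** vstack (\<omega> ** \<rho>) t) = - f (G ** vstack \<omega> t)" for \<omega>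
      by (simp add: matrix_mul_assoc sign \<rho>)
    moreover have "(\<integral>\<omega>. f (G ** vstack (\<omega> ** \<rho>) t) \<partial>lborel) = (\<integral>\<omega>. f (G ** vstack \<omega> t) \<partial>lborel)"
      by (rule integral_lborel_orthogonal[OF orthogonal_transformation_matrix_right[OF \<rho>(1)]])
    ultimately show ?thesis by (simp add: radon)
  qed
  \<comment> \<open>Off the domain both transforms equal \<open>undefined\<close>, so vanishing on
    the domain already gives equality of functions.\<close>
  hence "radon f = radon (\<lambda>_. 0)"
    by (auto simp: fun_eq_iff radon_def restrict_def)
  moreover have "(\<lambda>_. 0) \<in> (schwartz :: (real^'m^('k + 'l) \<Rightarrow> complex) set)"
    using polynomial_gauss_schwartz[OF real_polynomial_function.intros(2)[of 0]] by simp
  \<comment> \<open>With the identity in the selected rows the minor is 1, so this element of the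
    kernel is not the zero function.\<close>
  moreover have "f (\<chi> i j. if i = \<iota> j then 1 else 0) \<noteq> 0"
  proof -
    have "minor (\<chi> i j. if i = \<iota> j then 1 else 0) = mat 1"
      using \<iota> by (auto simp: minor_def mat_def vec_eq_iff inj_eq)
    thus ?thesis by (simp add: f_def gauss_def)
  qed
  ultimately show ?thesis using f by (auto dest: inj_onD)
qed

section \<open>Linear substitutions and bordered matrices\<close>

lemma nn_integral_lborel_diag_matrix:
  fixes h :: "real^'n \<Rightarrow> ennreal"
  assumes d: "\<And>i. d i > 0" and [measurable]: "h \<in> borel_measurable borel"
  shows "ennreal (\<Prod>i\<in>UNIV. d i) * (\<integral>\<^sup>+x. h (diag_matrix d *v x) \<partial>lborel) = (\<integral>\<^sup>+x. h x \<partial>lborel)"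
proof -
  have lin: "linear ((*v) (diag_matrix d))" by simp
  note [measurable] = borel_measurable_linear[OF lin]
  \<comment> \<open>The factors \<open>d\<close> re-indexed by basis vectors: at
    \<open>axis i 1\<close> every factor of the product but the i-th is 1.\<close>
  let ?c = "\<lambda>b::real^'n. \<Prod>i\<in>UNIV. if b = axis i 1 then d i else 1"
  have c: "?c (axis i 1) = d i" for i
    by (simp add: axis_eq_axis)
  have B: "(Basis :: (real^'n) set) = range (\<lambda>i. axis i 1)" by (auto simp: Basis_vec_def)
  have inj: "inj (\<lambda>i. axis i 1 :: real^'n)" by (auto simp: inj_on_def axis_eq_axis)
  have T: "(\<lambda>x. 0 + (\<Sum>b\<in>Basis. (?c b * (x \<bullet> b)) *\<^sub>R b)) = (*v) (diag_matrix d)"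
  proof
    fix x :: "real^'n"
    have "0 + (\<Sum>b\<in>Basis. (?c b * (x \<bullet> b)) *\<^sub>R b) = (\<Sum>i\<in>UNIV. (d i * x $ i) *\<^sub>R axis i 1)"
      unfolding B sum.reindex[OF inj] by (simp add: c inner_axis del: prod.delta)
    also have "\<dots> = diag_matrix d *v x"
      by (simp add: vec_eq_iff diag_matrix_vector axis_def if_distrib[of "\<lambda>x. _ * x"] cong: if_cong)
    finally show "0 + (\<Sum>b\<in>Basis. (?c b * (x \<bullet> b)) *\<^sub>R b) = diag_matrix d *v x" .
  qed
  have det: "(\<Prod>b\<in>(Basis::(real^'n) set). \<bar>?c b\<bar>) = (\<Prod>i\<in>UNIV. d i)"
    unfolding B prod.reindex[OF inj] using d by (simp add: c abs_of_pos del: prod.delta)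
  have "(lborel :: (real^'n) measure) = density (distr lborel borel ((*v) (diag_matrix d))) (\<lambda>_. ennreal (\<Prod>i\<in>UNIV. d i))"
  proof -
    have "?c b \<noteq> 0" for b using d by (simp add: less_imp_neq[symmetric] del: prod.delta)
    from lborel_affine_euclidean[of ?c 0, OF this] show ?thesis unfolding T det .
  qed
  hence "(\<integral>\<^sup>+x. h x \<partial>lborel) = (\<integral>\<^sup>+x. h x \<partial>density (distr lborel borel ((*v) (diag_matrix d))) (\<lambda>_. ennreal (\<Prod>i\<in>UNIV. d i)))"
    by simp
  also have "\<dots> = ennreal (\<Prod>i\<in>UNIV. d i) * (\<integral>\<^sup>+x. h (diag_matrix d *v x) \<partial>lborel)"
    by (simp add: nn_integral_density nn_integral_distr nn_integral_cmult)
  finally show ?thesis ..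
qed

lemma diag_matrix_mult_nth:
  fixes M :: "real^'n^'n"
  shows "(diag_matrix d ** M) $ i $ j = d i * M $ i $ j" "(M ** diag_matrix d) $ i $ j = M $ i $ j * d j"
  by (simp_all add: matrix_matrix_mult_def diag_matrix_def if_distrib[of "\<lambda>x. _ * x"] if_distrib[of "\<lambda>x. x * _"] cong: if_cong)

lemma orthogonal_transformation_vector:
  "orthogonal_matrix (Q::real^'n^'n) \<Longrightarrow> orthogonal_transformation ((*v) Q)"
  by (simp add: orthogonal_transformation_matrix)

text \<open>The orthogonal factors of a diagonalisation preserve Lebesgue measure, and the diagonal
  factor scales it by a determinant equal to that of \<open>P\<close>.\<close>

lemma nn_integral_lborel_posdef:
  fixes h :: "real^'n \<Rightarrow> ennreal"
  assumes P: "P \<in> posdef_cone" and [measurable]: "h \<in> borel_measurable borel"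
  shows "ennreal (det P) * (\<integral>\<^sup>+x. h (P *v x) \<partial>lborel) = (\<integral>\<^sup>+x. h x \<partial>lborel)"
proof -
  obtain Q d where Q: "orthogonal_matrix Q" "P = Q ** diag_matrix d ** transpose Q" "\<And>i. d i > 0"
    using posdef_diagonalization[OF P] by blast
  have Q': "orthogonal_matrix (transpose Q)" using Q(1) by simp
  have [measurable]: "(*v) M \<in> borel_measurable borel" for M :: "real^'n^'n"
    by (rule borel_measurable_linear) simp
  have det: "det P = (\<Prod>i\<in>UNIV. d i)" unfolding Q(2) det_orthogonal_conj[OF Q(1)] by simp
  have "(\<integral>\<^sup>+x. h (P *v x) \<partial>lborel) = (\<integral>\<^sup>+x. h (Q *v (diag_matrix d *v (transpose Q *v x))) \<partial>lborel)"
    by (simp only: Q(2) matrix_vector_mul_assoc matrix_mul_assoc)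
  also have "\<dots> = (\<integral>\<^sup>+x. h (Q *v (diag_matrix d *v x)) \<partial>lborel)"
    by (rule nn_integral_lborel_orthogonal[OF orthogonal_transformation_vector[OF Q']]) measurable
  finally have "(\<integral>\<^sup>+x. h (P *v x) \<partial>lborel) = (\<integral>\<^sup>+x. h (Q *v (diag_matrix d *v x)) \<partial>lborel)" .
  moreover have "ennreal (\<Prod>i\<in>UNIV. d i) * (\<integral>\<^sup>+x. h (Q *v (diag_matrix d *v x)) \<partial>lborel) = (\<integral>\<^sup>+x. h (Q *v x) \<partial>lborel)"
    by (rule nn_integral_lborel_diag_matrix[OF Q(3)]) measurable
  moreover have "(\<integral>\<^sup>+x. h (Q *v x) \<partial>lborel) = (\<integral>\<^sup>+x. h x \<partial>lborel)"
    by (rule nn_integral_lborel_orthogonal[OF orthogonal_transformation_vector[OF Q(1)]]) measurable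
  ultimately show ?thesis by (simp add: det)
qed

lemma posdef_det_sqrt:
  assumes R: "R \<in> posdef_cone" shows "det (posdef_sqrt R) = sqrt (det R)"
proof -
  have "det (posdef_sqrt R) * det (posdef_sqrt R) = det R"
    using posdef_sqrt_square[OF R] by (metis det_mul)
  moreover have "det (posdef_sqrt R) \<ge> 0"
    using posdef_det_pos[OF posdef_sqrt_posdef[OF R]] by simp
  ultimately show ?thesis by (intro real_sqrt_unique[symmetric]) (simp_all add: power2_eq_square)
qed

lemma posdef_inverse:
  fixes r :: "real^'n^'n"
  assumes "r \<in> posdef_cone"
  shows "matrix_inv r ** r = mat 1" "r ** matrix_inv r = mat 1"
proof -
  have "invertible r" using posdef_det_pos[OF assms] by (simp add: invertible_det_nz)
  thus "matrix_inv r ** r = mat 1" "r ** matrix_inv r = mat 1"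
    using someI_ex[of "\<lambda>r'. r ** r' = mat 1 \<and> r' ** r = mat 1"]
    by (simp_all add: invertible_def matrix_inv_def)
qed

lemma symmetric_matrix_inv:
  fixes r :: "real^'n^'n"
  assumes "r \<in> posdef_cone"
  shows "transpose (matrix_inv r) = matrix_inv r"
proof -
  have "transpose (matrix_inv r) ** r = mat 1"
    using posdef_inverse(2)[OF assms] posdef_cone_transpose[OF assms]
    by (metis matrix_transpose_mul transpose_mat)
  thus ?thesis using posdef_inverse[OF assms]
    by (metis matrix_mul_assoc matrix_mul_lid matrix_mul_rid)
qed

text \<open>Polar decomposition reduces \<open>S\<close> to its positive definite part \<open>(S S')\<^sup>1\<^sup>/\<^sup>2\<close>.\<close>

lemma nn_integral_lborel_matrix:
  fixes h :: "real^'n \<Rightarrow> ennreal" and S :: "real^'n^'n"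
  assumes R: "S ** transpose S \<in> posdef_cone" and [measurable]: "h \<in> borel_measurable borel"
  shows "ennreal (sqrt (det (S ** transpose S))) * (\<integral>\<^sup>+x. h (S *v x) \<partial>lborel) = (\<integral>\<^sup>+x. h x \<partial>lborel)"
proof -
  define P where "P = posdef_sqrt (S ** transpose S)"
  have P: "P \<in> posdef_cone" "P ** P = S ** transpose S"
    using posdef_sqrt[OF R] by (simp_all add: P_def)
  define Q where "Q = matrix_inv P ** S"
  have [measurable]: "(*v) M \<in> borel_measurable borel" for M :: "real^'n^'n"
    by (rule borel_measurable_linear) simp
  have "Q ** transpose Q = matrix_inv P ** (S ** transpose S) ** matrix_inv P"
    by (simp add: Q_def matrix_transpose_mul symmetric_matrix_inv[OF P(1)] matrix_mul_assoc)
  also have "\<dots> = (matrix_inv P ** P) ** (P ** matrix_inv P)"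
    unfolding P(2)[symmetric] by (simp only: matrix_mul_assoc)
  finally have "Q ** transpose Q = mat 1" by (simp add: posdef_inverse[OF P(1)])
  hence "orthogonal_matrix Q"
    by (simp add: orthogonal_matrix_def matrix_left_right_inverse)
  hence Q: "orthogonal_transformation ((*v) Q)" by (rule orthogonal_transformation_vector)
  have "S = P ** Q" by (simp add: Q_def matrix_mul_assoc posdef_inverse[OF P(1)])
  hence "(\<integral>\<^sup>+x. h (S *v x) \<partial>lborel) = (\<integral>\<^sup>+x. h (P *v (Q *v x)) \<partial>lborel)"
    by (simp add: matrix_vector_mul_assoc)
  also have "\<dots> = (\<integral>\<^sup>+x. h (P *v x) \<partial>lborel)"
    by (rule nn_integral_lborel_orthogonal[OF Q]) measurable
  finally show ?thesis
    using nn_integral_lborel_posdef[OF P(1), of h] posdef_det_sqrt[OF R] by (simp add: P_def)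
qed

section \<open>Bordered matrices and Schur complements\<close>

definition outer :: "real^'n \<Rightarrow> real^'m \<Rightarrow> real^'m^'n" where
  "outer u v = (\<chi> i j. u $ i * v $ j)"

lemma outer_simps:
  fixes M :: "real^'n^'n"
  shows "M ** outer u v = outer (M *v u) v" "outer u v ** M = outer u (transpose M *v v)"
    "outer u v ** outer x y = (v \<bullet> x) *\<^sub>R outer u y" "transpose (outer u v) = outer v u"
  by (simp_all add: outer_def matrix_matrix_mult_def matrix_vector_mult_def vec_eq_iff transpose_def
      sum_distrib_left sum_distrib_right inner_vec_def mult_ac del: transpose_matrix_vector)

text \<open>Padding by the identity keeps Gram matrices of every size in the one type
  \<open>real^'n^'n\<close>. Determinant and definiteness are those of the part indexed by
  \<open>I\<close>, so enlarging \<open>I\<close> by one index can serve as an induction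
  step.\<close>

definition block :: "'n set \<Rightarrow> ('n \<Rightarrow> 'n \<Rightarrow> real) \<Rightarrow> real^'n^'n" where
  "block I c = (\<chi> i j. if i \<in> I \<and> j \<in> I then c i j else if i = j then 1 else 0)"

definition border :: "'n \<Rightarrow> ('n \<Rightarrow> 'n \<Rightarrow> real) \<Rightarrow> ('n \<Rightarrow> real) \<Rightarrow> real \<Rightarrow> 'n \<Rightarrow> 'n \<Rightarrow> real" where
  "border a c b \<rho> i j = (if i = a then (if j = a then \<rho> else b j) else if j = a then b i else c i j)"

definition restrict_vec :: "'n set \<Rightarrow> ('n \<Rightarrow> real) \<Rightarrow> real^'n" where
  "restrict_vec I b = (\<chi> i. if i \<in> I then b i else 0)"

lemma block_mult_off:
  assumes "a \<notin> I" shows "block I c *v axis a 1 = axis a 1"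
  using assms unfolding matrix_vector_mult_basis by (auto simp: column_def block_def axis_def vec_eq_iff)

text \<open>\<open>axis a 1\<close> is fixed by the block and hence by its symmetric inverse, so the
  inverse preserves the \<open>a\<close>-th component, which is 0 for
  \<open>restrict_vec I b\<close>.\<close>

lemma block_inv_restrict_off:
  assumes R: "block I c \<in> posdef_cone" and a: "a \<notin> I"
  shows "(matrix_inv (block I c) *v restrict_vec I b) $ a = 0"
proof -
  let ?R = "block I c"
  have "(matrix_inv ?R *v restrict_vec I b) $ a = axis a 1 \<bullet> (matrix_inv ?R *v restrict_vec I b)"
    by (simp add: inner_axis')
  also have "\<dots> = (matrix_inv ?R *v axis a 1) \<bullet> restrict_vec I b"
    by (metis dot_lmul_matrix symmetric_matrix_inv[OF R] transpose_matrix_vector)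
  also have "matrix_inv ?R *v axis a 1 = matrix_inv ?R *v (?R *v axis a 1)"
    by (simp only: block_mult_off[OF a])
  also have "\<dots> = axis a 1" by (simp add: matrix_vector_mul_assoc posdef_inverse[OF R])
  finally show ?thesis using a by (simp add: restrict_vec_def inner_axis')
qed

text \<open>As \<open>w\<close> vanishes at \<open>a\<close>, it is a combination of the other rows
  of the identity, and adding it to row \<open>a\<close> leaves the determinant unchanged.\<close>

lemma det_unipotent:
  fixes w :: "real^'n"
  assumes "w $ a = 0" shows "det (mat 1 + outer (axis a 1) w) = 1"
proof -
  have row: "row j (mat 1 :: real^'n^'n) = axis j 1" for j
    by (simp add: row_def mat_def axis_def vec_eq_iff eq_commute)
  have "w = (\<Sum>j\<in>UNIV - {a}. w $ j *\<^sub>R axis j 1)"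
    using assms by (auto simp: vec_eq_iff axis_def if_distrib[of "\<lambda>x. _ * x"] sum.If_cases cong: if_cong)
  also have "\<dots> \<in> span {row j (mat 1 :: real^'n^'n) |j. j \<noteq> a}"
    by (intro span_sum span_scale span_base) (auto simp: row)
  finally have "det (\<chi> k. if k = a then row a (mat 1 :: real^'n^'n) + w else row k (mat 1)) = det (mat 1 :: real^'n^'n)"
    by (intro det_row_span) (simp add: span_vec_eq)
  moreover have "(\<chi> k. if k = a then row a (mat 1 :: real^'n^'n) + w else row k (mat 1)) = mat 1 + outer (axis a 1) w"
    by (auto simp: vec_eq_iff outer_def row_def axis_def)
  ultimately show ?thesis by simp
qed

text \<open>Congruence by the unipotent matrix \<open>1 + e\<^sub>a w'\<close> with \<open>w = R\<^sup>-\<^sup>1 b\<close> clears the border of the matrix.\<close>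

lemma
  fixes a :: "'n::finite" and b :: "'n \<Rightarrow> real" and \<rho> :: real
  assumes R: "block I c \<in> posdef_cone" and a: "a \<notin> I"
  defines "s \<equiv> \<rho> - restrict_vec I b \<bullet> (matrix_inv (block I c) *v restrict_vec I b)"
  shows det_border: "det (block (insert a I) (border a c b \<rho>)) = det (block I c) * s"
    and posdef_border: "block (insert a I) (border a c b \<rho>) \<in> posdef_cone \<longleftrightarrow> s > 0"
proof -
  let ?R = "block I c" and ?R' = "block (insert a I) (border a c b \<rho>)" and ?e = "axis a 1 :: real^'n"
  define bv where "bv = restrict_vec I b"
  define w where "w = matrix_inv ?R *v bv"
  define L where "L = mat 1 + outer ?e w"
  define D where "D t = diag_matrix (\<lambda>i. if i = a then t else 1)" for t
  have wa: "w $ a = 0" unfolding w_def bv_def by (rule block_inv_restrict_off[OF R a])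
  have Rw: "?R *v w = bv" by (simp add: w_def matrix_vector_mul_assoc posdef_inverse[OF R])
  have tR: "transpose ?R = ?R" by (rule posdef_cone_transpose[OF R])
  have Re: "?R *v ?e = ?e" by (rule block_mult_off[OF a])
  have s: "s = \<rho> - bv \<bullet> w" by (simp add: s_def bv_def w_def)
  have 1: "?R' = ?R + outer bv ?e + outer ?e bv + (\<rho> - 1) *\<^sub>R outer ?e ?e"
    using a by (auto simp: vec_eq_iff block_def border_def outer_def bv_def restrict_vec_def axis_def)
  have RD: "?R ** D s = ?R + (s - 1) *\<^sub>R outer ?e ?e"
    using a by (auto simp: vec_eq_iff D_def diag_matrix_mult_nth block_def outer_def axis_def)
  have ew: "?e \<bullet> w = 0" "w \<bullet> ?e = 0" "bv \<bullet> ?e = 0" "?e \<bullet> ?e = 1"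
    using wa a by (auto simp: inner_axis inner_axis' bv_def restrict_vec_def)
  have add_rdistrib: "(A + B) ** C = A ** C + B ** C" for A B C :: "real^'n^'n"
    by (simp add: vec_eq_iff matrix_matrix_mult_def sum.distrib algebra_simps)
  have scale: "(t *\<^sub>R A) ** C = t *\<^sub>R (A ** C)" "A ** (t *\<^sub>R C) = t *\<^sub>R (A ** C)" for t and A C :: "real^'n^'n"
    by (simp_all add: vec_eq_iff matrix_matrix_mult_def sum_distrib_left mult_ac)
  have o0: "outer u 0 = 0" "outer 0 u = (0 :: real^'n^'n)" for u :: "real^'n" by (simp_all add: outer_def vec_eq_iff)
  have "L ** ?R = ?R + outer ?e bv"
    unfolding L_def by (simp add: add_rdistrib outer_simps tR Rw del: transpose_matrix_vector)
  moreover have "L ** outer ?e ?e = outer ?e ?e"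
    unfolding L_def add_rdistrib by (simp add: outer_simps(3) ew)
  ultimately have LX: "L ** (?R ** D s) = ?R + outer ?e bv + (s - 1) *\<^sub>R outer ?e ?e"
    unfolding RD by (simp add: matrix_add_ldistrib scale)
  have tL: "transpose L = mat 1 + outer w ?e"
    by (auto simp: L_def transpose_def vec_eq_iff outer_def mat_def mult.commute)
  \<comment> \<open>One step of a block LDL' factorisation, with the Schur complement
    \<open>s\<close> as the new pivot. Since \<open>L\<close> has determinant 1, both claims are
    reduced to \<open>?R ** D s\<close>.\<close>
  have eq: "?R' = L ** (?R ** D s) ** transpose L"
    unfolding LX tL 1
    unfolding matrix_add_ldistrib matrix_mul_rid
    unfolding add_rdistrib scale
    unfolding outer_simps(3)
    unfolding outer_simps(1)
    by (simp add: s Rw ew inner_commute[of w bv] algebra_simps)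
  have detL: "det L = 1" unfolding L_def by (rule det_unipotent[of w a, OF wa])
  have detD: "det (D t) = t" for t by (simp add: D_def)
  show det: "det ?R' = det ?R * s"
    unfolding eq by (simp add: det_mul detL detD)
  show "?R' \<in> posdef_cone \<longleftrightarrow> s > 0"
  proof
    assume "?R' \<in> posdef_cone"
    from posdef_det_pos[OF this] show "s > 0"
      unfolding det using posdef_det_pos[OF R] by (simp add: zero_less_mult_iff)
  next
    assume s0: "s > 0"
    \<comment> \<open>\<open>D\<close> commutes with the block because \<open>a\<close> lies outside
      \<open>I\<close>; splitting \<open>s\<close> into two factors \<open>sqrt s\<close> exhibits
      the product as a congruence of \<open>?R\<close>.\<close>
    have DR: "transpose (D (sqrt s)) ** ?R ** D (sqrt s) = ?R ** D s"
    proof -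
      have "D (sqrt s) ** ?R = ?R ** D (sqrt s)"
        using a by (auto simp: vec_eq_iff D_def diag_matrix_mult_nth block_def)
      moreover have "D (sqrt s) ** D (sqrt s) = D s"
        using s0 by (auto simp: D_def intro!: arg_cong[of _ _ diag_matrix])
      moreover have "transpose (D (sqrt s)) = D (sqrt s)" by (simp add: D_def)
      ultimately show ?thesis by (metis matrix_mul_assoc)
    qed
    have "inj ((*v) (D (sqrt s)))"
      using s0 by (simp add: inj_matrix_vector_mult invertible_det_nz detD)
    hence "?R ** D s \<in> posdef_cone" unfolding DR[symmetric] by (rule posdef_cone_congruence[OF R])
    moreover have "inj ((*v) (transpose L))"
      by (simp add: inj_matrix_vector_mult invertible_det_nz detL)
    ultimately have "transpose (transpose L) ** (?R ** D s) ** transpose L \<in> posdef_cone"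
      by (rule posdef_cone_congruence)
    thus "?R' \<in> posdef_cone" by (simp add: eq)
  qed
qed

text \<open>The form of the smaller block at \<open>x\<close> is the bordered form at
  \<open>x\<close> with its \<open>a\<close>-th coordinate deleted, plus the square of that
  coordinate. Contrapositively, a Gram matrix that is not positive definite stays so when a vector
  is added, so its weight remains 0.\<close>

lemma posdef_block_of_border:
  fixes a :: "'n::finite"
  assumes R': "block (insert a I) (border a c b \<rho>) \<in> posdef_cone" and a: "a \<notin> I"
  shows "block I c \<in> posdef_cone"
proof (rule posdef_coneI)
  let ?R = "block I c" and ?R' = "block (insert a I) (border a c b \<rho>)"
  define D :: "real^'n^'n" where "D = diag_matrix (\<lambda>i. if i = a then 0 else 1)"
  have sym: "?R' $ i $ j = ?R' $ j $ i" for i j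
    using posdef_cone_transpose[OF R'] by (simp add: transpose_def vec_eq_iff)
  have "?R $ i $ j = ?R $ j $ i" for i j
    using sym[of i j] a by (auto simp: block_def border_def split: if_splits)
  thus "transpose ?R = ?R" by (simp add: transpose_def vec_eq_iff)
  fix x :: "real^'n" assume x: "x \<noteq> 0"
  have tD: "transpose D = D" by (simp add: D_def)
  have "?R = D ** ?R' ** D + outer (axis a 1) (axis a 1)"
    using a by (auto simp: vec_eq_iff D_def diag_matrix_mult_nth block_def border_def outer_def axis_def)
  hence "x \<bullet> (?R *v x) = x \<bullet> ((transpose D ** ?R' ** D) *v x) + x \<bullet> (outer (axis a 1) (axis a 1) *v x)"
    by (simp add: tD matrix_vector_mult_add_rdistrib inner_add_right)
  also have "outer (axis a 1) (axis a 1) *v x = x $ a *\<^sub>R axis a 1"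
    by (auto simp: outer_def matrix_vector_mult_def vec_eq_iff axis_def if_distrib[of "\<lambda>x. x * _"] if_distrib[of "\<lambda>x. _ * x"] cong: if_cong)
  finally have *: "x \<bullet> (?R *v x) = (D *v x) \<bullet> (?R' *v (D *v x)) + (x $ a)\<^sup>2"
    by (simp add: inner_congruence inner_axis power2_eq_square)
  show "0 < x \<bullet> (?R *v x)"
  proof (cases "D *v x = 0")
    case True
    have "x $ a \<noteq> 0"
    proof
      assume "x $ a = 0"
      hence "D *v x = x" by (auto simp: D_def diag_matrix_vector vec_eq_iff)
      thus False using True x by simp
    qed
    thus ?thesis unfolding * by (simp add: True)
  next
    case False
    thus ?thesis unfolding * using posdef_cone_inner_pos[OF R' False] by (simp add: add_pos_nonneg)
  qed
qed

section \<open>Joint distribution of inner products\<close>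

lemma nn_integral_lborel_vec_lambda:
  fixes h :: "real^'n \<Rightarrow> ennreal"
  assumes [measurable]: "h \<in> borel_measurable borel"
  shows "(\<integral>\<^sup>+x. h x \<partial>lborel) = (\<integral>\<^sup>+z. h (\<chi> i. z i) \<partial>(\<Pi>\<^sub>M i\<in>UNIV. lborel))"
proof -
  interpret product_sigma_finite "\<lambda>_::'n. lborel :: real measure" by standard
  have vm [measurable]: "(\<lambda>z. \<chi> i. z i :: real^'n) \<in> borel_measurable (\<Pi>\<^sub>M i\<in>UNIV. lborel)"
  proof (rule borel_measurable_euclidean_space[THEN iffD2], safe)
    fix b :: "real^'n" assume "b \<in> Basis"
    then obtain i where "b = axis i 1" by (auto simp: Basis_vec_def)
    thus "(\<lambda>z. (\<chi> i. z i) \<bullet> b) \<in> borel_measurable (\<Pi>\<^sub>M i\<in>UNIV. lborel)" by (simp add: inner_axis)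
  qed
  have eq: "(lborel :: (real^'n) measure) = distr (\<Pi>\<^sub>M i\<in>UNIV. lborel) borel (\<lambda>z. \<chi> i. z i)"
  proof (rule lborel_eqI)
    fix l u :: "real^'n"
    assume le: "\<And>b. b \<in> Basis \<Longrightarrow> l \<bullet> b \<le> u \<bullet> b"
    have le: "l $ i \<le> u $ i" for i using le[of "axis i 1"] by (simp add: inner_axis axis_in_Basis_iff)
    have "(\<lambda>z. \<chi> i. z i) -` box l u \<inter> space (\<Pi>\<^sub>M i\<in>UNIV. lborel) = Pi\<^sub>E UNIV (\<lambda>i. {l $ i<..<u $ i})"
      by (auto simp: space_PiM mem_box_cart PiE_iff)
    hence "emeasure (distr (\<Pi>\<^sub>M i\<in>UNIV. lborel) borel (\<lambda>z. \<chi> i. z i)) (box l u)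
        = (\<Prod>i\<in>UNIV. emeasure lborel {l $ i<..<u $ i})"
      by (simp add: emeasure_distr emeasure_PiM)
    thus "emeasure (distr (\<Pi>\<^sub>M i\<in>UNIV. lborel) borel (\<lambda>z. \<chi> i. z i)) (box l u) = (\<Prod>b\<in>Basis. (u - l) \<bullet> b)"
      using prod_Basis_vector[of "u - l"] le by (simp add: prod_ennreal)
  qed simp
  show ?thesis by (subst eq) (simp add: nn_integral_distr)
qed

lemma nn_integral_PiM_reindex:
  fixes M :: "'c measure"
  assumes sf: "sigma_finite_measure M" and g: "bij_betw g J I" and fin: "finite J"
    and [measurable]: "F \<in> borel_measurable (\<Pi>\<^sub>M j\<in>J. M)"
  shows "(\<integral>\<^sup>+\<omega>. F \<omega> \<partial>(\<Pi>\<^sub>M j\<in>J. M)) = (\<integral>\<^sup>+\<omega>. F (\<lambda>j\<in>J. \<omega> (g j)) \<partial>(\<Pi>\<^sub>M i\<in>I. M))"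
proof -
  interpret J: product_sigma_finite "\<lambda>_. M" by (intro product_sigma_finite.intro sf)
  have gI: "g j \<in> I" if "j \<in> J" for j using g that by (auto simp: bij_betw_def)
  have finI: "finite I" using g fin bij_betw_finite by blast
  have [measurable]: "(\<lambda>\<omega>. \<lambda>j\<in>J. \<omega> (g j)) \<in> measurable (\<Pi>\<^sub>M i\<in>I. M) (\<Pi>\<^sub>M j\<in>J. M)"
    by (intro measurable_restrict measurable_component_singleton gI)
  have "distr (\<Pi>\<^sub>M i\<in>I. M) (\<Pi>\<^sub>M j\<in>J. M) (\<lambda>\<omega>. \<lambda>j\<in>J. \<omega> (g j)) = (\<Pi>\<^sub>M j\<in>J. M)"
  proof (rule J.PiM_eqI)
    fix A assume A: "\<And>j. j \<in> J \<Longrightarrow> A j \<in> sets M"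
    define g' where "g' = the_inv_into J g"
    have g': "g' (g j) = j" if "j \<in> J" for j
      using g that by (simp add: g'_def the_inv_into_f_f bij_betw_def)
    have g'I: "g' i \<in> J" "g (g' i) = i" if "i \<in> I" for i
      using g that by (auto simp: g'_def bij_betw_def the_inv_into_into f_the_inv_into_f)
    have "(\<lambda>\<omega>. \<lambda>j\<in>J. \<omega> (g j)) -` Pi\<^sub>E J A \<inter> space (\<Pi>\<^sub>M i\<in>I. M) = Pi\<^sub>E I (\<lambda>i. A (g' i))"
    proof (intro set_eqI iffI)
      fix \<omega> assume "\<omega> \<in> (\<lambda>\<omega>. \<lambda>j\<in>J. \<omega> (g j)) -` Pi\<^sub>E J A \<inter> space (\<Pi>\<^sub>M i\<in>I. M)"
      hence \<omega>: "\<omega> \<in> extensional I" "\<And>j. j \<in> J \<Longrightarrow> \<omega> (g j) \<in> A j"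
        by (auto simp: space_PiM PiE_def Pi_def)
      show "\<omega> \<in> Pi\<^sub>E I (\<lambda>i. A (g' i))"
        using \<omega>(1) \<omega>(2)[of "g' i" for i] g'I by (auto simp: PiE_def) (metis)
    next
      fix \<omega> assume \<omega>: "\<omega> \<in> Pi\<^sub>E I (\<lambda>i. A (g' i))"
      have "\<omega> i \<in> space M" if "i \<in> I" for i
        using \<omega> that A[OF g'I(1)[OF that]] sets.sets_into_space by (auto simp: PiE_def Pi_def)
      moreover have "\<omega> (g j) \<in> A j" if "j \<in> J" for j
        using \<omega> gI[OF that] g'[OF that] by (force simp: PiE_def Pi_def)
      ultimately show "\<omega> \<in> (\<lambda>\<omega>. \<lambda>j\<in>J. \<omega> (g j)) -` Pi\<^sub>E J A \<inter> space (\<Pi>\<^sub>M i\<in>I. M)"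
        using \<omega> by (auto simp: space_PiM PiE_def)
    qed
    hence "emeasure (distr (\<Pi>\<^sub>M i\<in>I. M) (\<Pi>\<^sub>M j\<in>J. M) (\<lambda>\<omega>. \<lambda>j\<in>J. \<omega> (g j))) (Pi\<^sub>E J A) = (\<Prod>i\<in>I. emeasure M (A (g' i)))"
      using A fin finI g'I(1) by (simp add: emeasure_distr sets_PiM_I_finite J.emeasure_PiM)
    also have "\<dots> = (\<Prod>j\<in>J. emeasure M (A (g' (g j))))"
      by (rule prod.reindex_bij_betw[OF g, symmetric])
    also have "\<dots> = (\<Prod>j\<in>J. emeasure M (A j))" by (intro prod.cong) (auto simp: g')
    finally show "emeasure (distr (\<Pi>\<^sub>M i\<in>I. M) (\<Pi>\<^sub>M j\<in>J. M) (\<lambda>\<omega>. \<lambda>j\<in>J. \<omega> (g j))) (Pi\<^sub>E J A) = (\<Prod>j\<in>J. emeasure M (A j))" .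
  qed (use fin in auto)
  hence "(\<integral>\<^sup>+\<omega>. F \<omega> \<partial>(\<Pi>\<^sub>M j\<in>J. M)) = (\<integral>\<^sup>+\<omega>. F \<omega> \<partial>distr (\<Pi>\<^sub>M i\<in>I. M) (\<Pi>\<^sub>M j\<in>J. M) (\<lambda>\<omega>. \<lambda>j\<in>J. \<omega> (g j)))" by simp
  thus ?thesis by (simp add: nn_integral_distr)
qed

text \<open>Half the area of the unit sphere in dimension \<open>q\<close>: with s = r^2 the radial
  element r^(q-1) dr becomes s^(q/2-1) ds / 2.\<close>

definition sphere_const :: "nat \<Rightarrow> real" where
  "sphere_const q = pi powr (real q / 2) / Gamma (real q / 2)"

lemma sphere_const_pos: "q > 0 \<Longrightarrow> sphere_const q > 0"
  by (simp add: sphere_const_def Gamma_real_pos)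

text \<open>The density of the squared norm under Lebesgue measure in dimension \<open>q\<close>.
  The value 0 at nonpositive arguments later encodes the positivity of a Schur complement.\<close>

definition radial_density :: "nat \<Rightarrow> real \<Rightarrow> ennreal" where
  "radial_density q s = (if s > 0 then ennreal (sphere_const q * s powr (real q / 2 - 1)) else 0)"

lemma radial_density_measurable [measurable]: "radial_density q \<in> borel_measurable borel"
  unfolding radial_density_def[abs_def] by measurable

lemma emeasure_density_radial_atMost:
  assumes q: "q > 0"
  shows "emeasure (density lborel (radial_density q)) {..r} = (if r > 0 then ennreal (unit_ball_vol q * sqrt r ^ q) else 0)"
proof (cases "r > 0")
  case True
  \<comment> \<open>Antiderivative of the density. The factor 2/q turns \<Gamma>(q/2) into
    \<Gamma>(q/2 + 1), hence \<open>sphere_const\<close> into the volume of the unit ball.\<close>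
  define F where "F s = sphere_const q * (2 / q) * s powr (real q / 2)" for s
  have G: "Gamma (real q / 2 + 1) = (real q / 2) * Gamma (real q / 2)"
    using q by (intro Gamma_plus1) (auto elim!: nonpos_Ints_cases)
  have "emeasure (density lborel (radial_density q)) {..r} = (\<integral>\<^sup>+s. radial_density q s * indicator {..r} s \<partial>lborel)"
    by (rule emeasure_density) auto
  also have "\<dots> = (\<integral>\<^sup>+s. ennreal (sphere_const q * s powr (real q / 2 - 1)) * indicator {0..r} s \<partial>lborel)"
  proof (rule nn_integral_cong_AE)
    have "AE s in lborel. s \<noteq> (0::real)" by (rule AE_lborel_singleton)
    thus "AE s in lborel. radial_density q s * indicator {..r} s = ennreal (sphere_const q * s powr (real q / 2 - 1)) * indicator {0..r} s"
      by eventually_elim (auto simp: radial_density_def indicator_def)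
  qed
  also have "\<dots> = ennreal (F r - F 0)"
  proof -
    have "((\<lambda>s. sphere_const q * s powr (real q / 2 - 1)) has_integral (F r - F 0)) {0..r}"
    proof (rule fundamental_theorem_of_calculus_interior)
      show "continuous_on {0..r} F" unfolding F_def
        using q by (intro continuous_intros continuous_on_powr') auto
      fix s assume s: "s \<in> {0<..<r}"
      have "(F has_real_derivative sphere_const q * (2 / q) * ((real q / 2) * s powr (real q / 2 - 1))) (at s)"
        unfolding F_def using s by (auto intro!: derivative_eq_intros)
      thus "(F has_vector_derivative sphere_const q * s powr (real q / 2 - 1)) (at s)"
        using q by (simp add: has_real_derivative_iff_has_vector_derivative)
    qed (use True in auto)
    thus ?thesis
      using sphere_const_pos[OF q] by (intro nn_integral_has_integral_lebesgue') auto
  qed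
  also have "F r - F 0 = unit_ball_vol q * sqrt r ^ q"
  proof -
    have "sqrt r ^ q = r powr (real q / 2)"
      using True by (simp add: powr_half_sqrt[symmetric] powr_realpow[symmetric] powr_powr mult.commute)
    moreover have "sphere_const q * (2 / q) = unit_ball_vol q"
      unfolding sphere_const_def unit_ball_vol_def G using q by simp
    ultimately show ?thesis using q by (simp add: F_def)
  qed
  finally show ?thesis using True by simp
next
  case False
  have "emeasure (density lborel (radial_density q)) {..r} = (\<integral>\<^sup>+s. radial_density q s * indicator {..r} s \<partial>lborel)"
    by (rule emeasure_density) auto
  also have "\<dots> = integral\<^sup>N lborel (\<lambda>_::real. 0)"
    by (rule nn_integral_cong) (use False in \<open>auto simp: radial_density_def indicator_def\<close>)
  finally show ?thesis using False by simp
qed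

lemma sum_squares_measurable [measurable]:
  "(\<lambda>c. \<Sum>j\<in>J. (c j)\<^sup>2 :: real) \<in> borel_measurable (\<Pi>\<^sub>M j\<in>J. lborel)"
  by (intro borel_measurable_sum borel_measurable_power) (auto intro: measurable_component_singleton)

lemma emeasure_sum_squares_le:
  assumes J: "finite J" "J \<noteq> {}"
  shows "emeasure (distr (\<Pi>\<^sub>M j\<in>J. lborel) borel (\<lambda>c. \<Sum>j\<in>J. (c j)\<^sup>2)) {..r} =
    (if r > 0 then ennreal (unit_ball_vol (real (card J)) * sqrt r ^ card J) else 0)"
proof -
  let ?M = "\<Pi>\<^sub>M j\<in>J. lborel :: real measure" and ?N = "distr (\<Pi>\<^sub>M j\<in>J. lborel) borel (\<lambda>c. \<Sum>j\<in>J. (c j)\<^sup>2)"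
  have pos: "emeasure ?N {..r} = ennreal (unit_ball_vol (real (card J)) * sqrt r ^ card J)" if "r > 0" for r
  proof -
    have "emeasure ?N {..r} = emeasure ?M ((\<lambda>c. \<Sum>j\<in>J. (c j)\<^sup>2) -` {..r} \<inter> space ?M)"
      by (simp add: emeasure_distr)
    also have "(\<lambda>c. \<Sum>j\<in>J. (c j)\<^sup>2) -` {..r} = {f. sqrt (\<Sum>j\<in>J. (f j)\<^sup>2) \<le> sqrt r}" by auto
    finally show ?thesis using emeasure_cball_aux[OF J(1), of "sqrt r"] that by simp
  qed
  show ?thesis
  proof (cases "r > 0")
    case False
    \<comment> \<open>For a nonpositive bound the preimage lies in every ball of radius
      \<open>sqrt e\<close>, whose volume tends to 0 with \<open>e\<close>.\<close>
    have le: "emeasure ?N {..r} \<le> ennreal (unit_ball_vol (real (card J)) * sqrt e ^ card J)" if "e > 0" for e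
    proof -
      have "emeasure ?N {..r} \<le> emeasure ?N {..e}" using False that by (intro emeasure_mono) auto
      thus ?thesis using pos[OF that] by simp
    qed
    have "((\<lambda>e. ennreal (unit_ball_vol (real (card J)) * sqrt e ^ card J)) \<longlongrightarrow> ennreal (unit_ball_vol (real (card J)) * sqrt 0 ^ card J)) (at_right 0)"
      by (intro tendsto_intros tendsto_ennrealI) 
    moreover have "\<forall>\<^sub>F e in at_right (0::real). emeasure ?N {..r} \<le> ennreal (unit_ball_vol (real (card J)) * sqrt e ^ card J)"
      using le by (auto simp: eventually_at_right_less intro!: eventually_mono[OF eventually_at_right_less[of 0]])
    ultimately have "emeasure ?N {..r} \<le> ennreal (unit_ball_vol (real (card J)) * sqrt 0 ^ card J)"
      by (intro tendsto_lowerbound) auto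
    thus ?thesis using False J by (simp add: zero_power card_gt_0_iff)
  qed (simp add: pos)
qed

text \<open>Half-lines generate the Borel sets and carry finite mass here, so it suffices to compare
  distribution functions, which are ball volumes.\<close>

lemma distr_sum_squares:
  assumes J: "finite J" "J \<noteq> {}"
  shows "distr (\<Pi>\<^sub>M j\<in>J. lborel) borel (\<lambda>c. \<Sum>j\<in>J. (c j)\<^sup>2) = density lborel (radial_density (card J))"
proof (rule measure_eqI_generator_eq[where E = "range atMost" and \<Omega> = UNIV and A = "\<lambda>n. {..real n}"])
  have q: "card J > 0" using J by (simp add: card_gt_0_iff)
  show "Int_stable (range atMost :: real set set)" by (auto simp: Int_stable_def)
  show "emeasure (distr (\<Pi>\<^sub>M j\<in>J. lborel) borel (\<lambda>c. \<Sum>j\<in>J. (c j)\<^sup>2)) X = emeasure (density lborel (radial_density (card J))) X"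
    if "X \<in> range atMost" for X
    using that by (auto simp: emeasure_sum_squares_le[OF J] emeasure_density_radial_atMost[OF q])
  show "emeasure (distr (\<Pi>\<^sub>M j\<in>J. lborel) borel (\<lambda>c. \<Sum>j\<in>J. (c j)\<^sup>2)) {..real n} \<noteq> \<infinity>" for n
    by (simp add: emeasure_sum_squares_le[OF J])
  show "(\<Union>n. {..real n}) = UNIV" using real_arch_simple by auto
qed (auto simp: borel_eq_atMost)

lemma nn_integral_sum_squares:
  assumes J: "finite J" "J \<noteq> {}" and [measurable]: "\<phi> \<in> borel_measurable borel"
  shows "(\<integral>\<^sup>+c. \<phi> (\<Sum>j\<in>J. (c j)\<^sup>2) \<partial>(\<Pi>\<^sub>M j\<in>J. lborel)) = (\<integral>\<^sup>+s. radial_density (card J) s * \<phi> s \<partial>lborel)"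
proof -
  have "(\<integral>\<^sup>+c. \<phi> (\<Sum>j\<in>J. (c j)\<^sup>2) \<partial>(\<Pi>\<^sub>M j\<in>J. lborel))
      = (\<integral>\<^sup>+s. \<phi> s \<partial>distr (\<Pi>\<^sub>M j\<in>J. lborel) borel (\<lambda>c. \<Sum>j\<in>J. (c j)\<^sup>2))"
    by (simp add: nn_integral_distr)
  thus ?thesis by (simp add: distr_sum_squares[OF J] nn_integral_density)
qed

text \<open>The block acts as the identity on coordinates outside \<open>I\<close>, and so does its
  inverse; the form splits into a part on \<open>I\<close> and a plain sum of squares, which the
  radial law will integrate out.\<close>

lemma inner_block_inv:
  fixes c :: "'n::finite \<Rightarrow> 'n \<Rightarrow> real" and b d :: "'n \<Rightarrow> real"
  assumes R: "block I c \<in> posdef_cone"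
  defines "x \<equiv> \<chi> i. if i \<in> I then b i else d i"
  shows "x \<bullet> (matrix_inv (block I c) *v x) =
    restrict_vec I b \<bullet> (matrix_inv (block I c) *v restrict_vec I b) + (\<Sum>i\<in>-I. (d i)\<^sup>2)"
proof -
  let ?R = "block I c" and ?b = "restrict_vec I b" and ?d = "restrict_vec (-I) d"
  have x: "x = ?b + ?d" by (auto simp: x_def restrict_vec_def vec_eq_iff)
  have "?R *v ?d = ?d"
  proof -
    have "(?R *v ?d) $ i = ?d $ i" for i
    proof -
      have "(?R *v ?d) $ i = (\<Sum>j\<in>UNIV. if j = i then ?d $ j else 0)"
        unfolding matrix_vector_mult_def vec_lambda_beta
        by (intro sum.cong) (auto simp: block_def restrict_vec_def)
      thus ?thesis by simp
    qed
    thus ?thesis by (simp add: vec_eq_iff)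
  qed
  hence inv: "matrix_inv ?R *v ?d = ?d"
    using posdef_inverse(1)[OF R] by (metis matrix_vector_mul_assoc matrix_vector_mul_lid)
  have sym: "u \<bullet> (matrix_inv ?R *v v) = v \<bullet> (matrix_inv ?R *v u)" for u v
    by (metis dot_lmul_matrix inner_commute symmetric_matrix_inv[OF R] transpose_matrix_vector)
  have bd: "?b \<bullet> ?d = 0" by (auto simp: inner_vec_def restrict_vec_def intro!: sum.neutral)
  have dd: "?d \<bullet> ?d = (\<Sum>i\<in>-I. (d i)\<^sup>2)"
    by (simp add: inner_vec_def restrict_vec_def power2_eq_square if_distrib[of "\<lambda>x. x * _"] if_distrib[of "\<lambda>x. _ * x"]
      sum.If_cases Compl_eq cong: if_cong)
  have "x \<bullet> (matrix_inv ?R *v x) = ?b \<bullet> (matrix_inv ?R *v ?b) + 2 * (?b \<bullet> ?d) + ?d \<bullet> ?d"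
    unfolding x by (simp add: matrix_vector_right_distrib inner_add_left inner_add_right inv sym[of ?d ?b])
  thus ?thesis by (simp add: bd dd)
qed

lemma vec_measurableI:
  assumes "\<And>i. (\<lambda>x. f x $ i) \<in> borel_measurable M"
  shows "(f :: 'a \<Rightarrow> real^'n) \<in> borel_measurable M"
proof (rule borel_measurable_euclidean_space[THEN iffD2], safe)
  fix b :: "real^'n" assume "b \<in> Basis"
  then obtain i where "b = axis i 1" by (auto simp: Basis_vec_def)
  thus "(\<lambda>x. f x \<bullet> b) \<in> borel_measurable M" using assms by (simp add: inner_axis)
qed

lemma vec_nth_measurable [measurable]: "(\<lambda>x::real^'n. x $ i) \<in> borel_measurable borel"
  by (intro borel_measurable_continuous_onI continuous_intros)

text \<open>Complete the rows \<open>y\<^sub>i\<close>, \<open>i \<in> I\<close>, by orthonormal vectors to a square matrix \<open>S\<close> and substitute \<open>z = S x\<close>;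
  then \<open>\<bar>x\<bar>\<^sup>2 = z' (S S')\<^sup>-\<^sup>1 z\<close> and \<open>S S'\<close> is the Gram matrix extended by the identity.\<close>

lemma nn_integral_inner_products:
  fixes y :: "'n::finite \<Rightarrow> real^'n" and h :: "('n \<Rightarrow> real) \<Rightarrow> real \<Rightarrow> ennreal"
  assumes R: "block I (\<lambda>i j. y i \<bullet> y j) \<in> posdef_cone" and a: "a \<notin> I"
    and [measurable]: "(\<lambda>(b, \<rho>). h b \<rho>) \<in> borel_measurable ((\<Pi>\<^sub>M i\<in>I. lborel) \<Otimes>\<^sub>M lborel)"
  defines "D \<equiv> det (block I (\<lambda>i j. y i \<bullet> y j))"
  shows "(\<integral>\<^sup>+x. h (\<lambda>i\<in>I. y i \<bullet> x) (x \<bullet> x) \<partial>lborel) =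
    ennreal (1 / sqrt D) * (\<integral>\<^sup>+b. (\<integral>\<^sup>+\<rho>.
       radial_density (CARD('n) - card I) (det (block (insert a I) (border a (\<lambda>i j. y i \<bullet> y j) b \<rho>)) / D) * h b \<rho> \<partial>lborel)
     \<partial>(\<Pi>\<^sub>M i\<in>I. lborel))"
proof -
  interpret product_sigma_finite "\<lambda>_::'n. lborel :: real measure" by standard
  let ?R = "block I (\<lambda>i j. y i \<bullet> y j)"
  define q where "q = CARD('n) - card I"
  define Q where "Q b = restrict_vec I b \<bullet> (matrix_inv ?R *v restrict_vec I b)" for b
  have D: "D > 0" using posdef_det_pos[OF R] by (simp add: D_def)
  obtain z where z: "\<And>i. i \<in> I \<Longrightarrow> z i = y i" "\<And>i. i \<notin> I \<Longrightarrow> norm (z i) = 1"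
    "\<And>i j. i \<notin> I \<Longrightarrow> i \<noteq> j \<Longrightarrow> orthogonal (z i) (z j)"
    using orthonormal_completion[of I y] by blast
  define S where "S = (\<chi> i j. z i $ j)"
  have Sx: "(S *v x) $ i = z i \<bullet> x" for x i by (simp add: S_def matrix_vector_mult_def inner_vec_def)
  have SS: "S ** transpose S = ?R"
  proof -
    have "(S ** transpose S) $ i $ j = z i \<bullet> z j" for i j
      by (simp add: S_def matrix_matrix_mult_def transpose_def inner_vec_def)
    moreover have "z i \<bullet> z j = ?R $ i $ j" for i j
    proof (cases "i \<in> I \<and> j \<in> I")
      case True thus ?thesis using z(1) by (simp add: block_def)
    next
      case False
      show ?thesis
      proof (cases "i = j")
        case True thus ?thesis using False z(2)[of i] by (simp add: block_def norm_eq_1)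
      next
        case ij: False
        have "orthogonal (z i) (z j)" using False ij z(3)[of i j] z(3)[of j i] by (auto simp: orthogonal_commute)
        thus ?thesis using False ij by (auto simp: block_def orthogonal_def)
      qed
    qed
    ultimately show ?thesis by (simp add: vec_eq_iff)
  qed
  define F where "F x = h (\<lambda>i\<in>I. x $ i) (x \<bullet> (matrix_inv ?R *v x))" for x
  have [measurable]: "(*v) M \<in> borel_measurable borel" for M :: "real^'n^'n"
    by (rule borel_measurable_linear) simp
  have [measurable]: "(\<lambda>x::real^'n. \<lambda>i\<in>I. x $ i) \<in> measurable borel (\<Pi>\<^sub>M i\<in>I. lborel)"
    by (rule measurable_restrict) simp
  have [measurable]: "F \<in> borel_measurable borel"
    unfolding F_def[abs_def] by measurable
  \<comment> \<open>Cancelling the invertible \<open>S\<close> gives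
    \<open>transpose S ** matrix_inv ?R ** S = mat 1\<close>, so that |x|^2 becomes a quadratic form
    in z = S x.\<close>
  have "S ** (transpose S ** matrix_inv ?R ** S) = S"
    by (simp add: matrix_mul_assoc SS posdef_inverse(2)[OF R])
  moreover have "det S \<noteq> 0"
    using D SS by (metis D_def det_mul det_transpose less_irrefl mult_zero_left)
  hence "invertible S" by (simp add: invertible_det_nz)
  then obtain S' where "S' ** S = mat 1" by (auto simp: invertible_def)
  ultimately have "transpose S ** matrix_inv ?R ** S = mat 1"
    by (metis matrix_mul_assoc matrix_mul_lid)
  hence xx: "(S *v x) \<bullet> (matrix_inv ?R *v (S *v x)) = x \<bullet> x" for x
    by (metis inner_congruence matrix_vector_mul_lid)
  have FS: "F (S *v x) = h (\<lambda>i\<in>I. y i \<bullet> x) (x \<bullet> x)" for x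
    unfolding F_def xx Sx by (intro arg_cong2[of _ _ _ _ h] restrict_ext) (simp_all add: z(1))
  have "(\<integral>\<^sup>+x. F x \<partial>lborel) = ennreal (sqrt D) * (\<integral>\<^sup>+x. F (S *v x) \<partial>lborel)"
    using nn_integral_lborel_matrix[of S F] R by (simp add: SS D_def)
  hence "ennreal (1 / sqrt D) * (\<integral>\<^sup>+x. F x \<partial>lborel) = (ennreal (1 / sqrt D) * ennreal (sqrt D)) * (\<integral>\<^sup>+x. F (S *v x) \<partial>lborel)"
    by (simp add: mult.assoc)
  also have "ennreal (1 / sqrt D) * ennreal (sqrt D) = 1" using D by (simp add: ennreal_mult[symmetric])
  finally have 1: "(\<integral>\<^sup>+x. h (\<lambda>i\<in>I. y i \<bullet> x) (x \<bullet> x) \<partial>lborel) = ennreal (1 / sqrt D) * (\<integral>\<^sup>+x. F x \<partial>lborel)"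
    by (simp add: FS)
  have vm [measurable]: "(\<lambda>z. \<chi> i. z i :: real^'n) \<in> borel_measurable (\<Pi>\<^sub>M i\<in>UNIV. lborel)"
    by (rule vec_measurableI) simp
  have Fm: "(\<lambda>z. F (\<chi> i. z i)) \<in> borel_measurable (\<Pi>\<^sub>M i\<in>I \<union> - I. lborel)" by simp
  have "(\<integral>\<^sup>+x. F x \<partial>lborel) = (\<integral>\<^sup>+z. F (\<chi> i. z i) \<partial>(\<Pi>\<^sub>M i\<in>I \<union> - I. lborel))"
    by (simp add: nn_integral_lborel_vec_lambda)
  also have "\<dots> = (\<integral>\<^sup>+b. (\<integral>\<^sup>+d. F (\<chi> i. merge I (- I) (b, d) i) \<partial>(\<Pi>\<^sub>M i\<in>- I. lborel)) \<partial>(\<Pi>\<^sub>M i\<in>I. lborel))"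
    by (rule product_nn_integral_fold[OF _ _ _ Fm]) auto
  also have "\<dots> = (\<integral>\<^sup>+b. (\<integral>\<^sup>+d. h b (Q b + (\<Sum>i\<in>-I. (d i)\<^sup>2)) \<partial>(\<Pi>\<^sub>M i\<in>- I. lborel)) \<partial>(\<Pi>\<^sub>M i\<in>I. lborel))"
  proof (intro nn_integral_cong)
    fix b d assume b: "b \<in> space (\<Pi>\<^sub>M i\<in>I. lborel :: real measure)" and d: "d \<in> space (\<Pi>\<^sub>M i\<in>- I. lborel :: real measure)"
    have m: "(\<chi> i. merge I (- I) (b, d) i) = (\<chi> i. if i \<in> I then b i else d i)"
      by (simp add: merge_def vec_eq_iff)
    have r: "(\<lambda>i\<in>I. (\<chi> i. if i \<in> I then b i else d i) $ i) = b"
      using b by (auto simp: space_PiM PiE_def extensional_def fun_eq_iff)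
    show "F (\<chi> i. merge I (- I) (b, d) i) = h b (Q b + (\<Sum>i\<in>-I. (d i)\<^sup>2))"
      unfolding m F_def r inner_block_inv[OF R] Q_def ..
  qed
  also have "\<dots> = (\<integral>\<^sup>+b. (\<integral>\<^sup>+\<rho>. radial_density q (det (block (insert a I) (border a (\<lambda>i j. y i \<bullet> y j) b \<rho>)) / D) * h b \<rho> \<partial>lborel)
     \<partial>(\<Pi>\<^sub>M i\<in>I. lborel))"
  proof (intro nn_integral_cong)
    fix b assume [measurable]: "b \<in> space (\<Pi>\<^sub>M i\<in>I. lborel :: real measure)"
    have [measurable]: "h b \<in> borel_measurable borel" by measurable
    have cq: "card (- I) = q" by (simp add: q_def Compl_eq_Diff_UNIV card_Diff_subset)
    \<comment> \<open>The coordinates outside \<open>I\<close> enter only through their sum of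
      squares and are replaced by its radial law.\<close>
    have "(\<integral>\<^sup>+d. h b (Q b + (\<Sum>i\<in>-I. (d i)\<^sup>2)) \<partial>(\<Pi>\<^sub>M i\<in>- I. lborel)) = (\<integral>\<^sup>+s. radial_density q s * h b (Q b + s) \<partial>lborel)"
      unfolding cq[symmetric] by (rule nn_integral_sum_squares) (use a in auto)
    \<comment> \<open>With \<rho> = |x|^2 as variable, \<open>\<rho> - Q b\<close> is the Schur
      complement of the new diagonal entry, that is, the bordered determinant divided by
      \<open>D\<close>.\<close>
    also have "\<dots> = (\<integral>\<^sup>+\<rho>. radial_density q (\<rho> - Q b) * h b \<rho> \<partial>lborel)"
      using nn_integral_lborel_translate[of "\<lambda>s. radial_density q s * h b (Q b + s)" "- Q b"] by simp
    also have "\<dots> = (\<integral>\<^sup>+\<rho>. radial_density q (det (block (insert a I) (border a (\<lambda>i j. y i \<bullet> y j) b \<rho>)) / D) * h b \<rho> \<partial>lborel)"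
      using D by (simp add: det_border[OF R a] Q_def D_def)
    finally show "(\<integral>\<^sup>+d. h b (Q b + (\<Sum>i\<in>-I. (d i)\<^sup>2)) \<partial>(\<Pi>\<^sub>M i\<in>- I. lborel)) =
      (\<integral>\<^sup>+\<rho>. radial_density q (det (block (insert a I) (border a (\<lambda>i j. y i \<bullet> y j) b \<rho>)) / D) * h b \<rho> \<partial>lborel)" .
  qed
  finally show ?thesis
    unfolding 1 q_def[symmetric] by simp
qed

section \<open>Distribution of Gram matrices\<close>

lemma matrix_measurableI:
  assumes "\<And>i j. (\<lambda>x. f x $ i $ j) \<in> borel_measurable M"
  shows "(f :: 'a \<Rightarrow> real^'m^'n) \<in> borel_measurable M"
proof (rule borel_measurable_euclidean_space[THEN iffD2], safe)
  fix b :: "real^'m^'n" assume "b \<in> Basis"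
  then obtain i j where "b = axis i (axis j 1)" by (auto simp: Basis_matrix)
  thus "(\<lambda>x. f x \<bullet> b) \<in> borel_measurable M" using assms by (simp add: inner_matrix_axis)
qed

lemma matrix_nth_measurable [measurable]: "(\<lambda>x::real^'m^'n. x $ i $ j) \<in> borel_measurable borel"
  by (intro borel_measurable_continuous_onI continuous_intros)

lemma det_measurable [measurable]: "(det :: real^'n^'n \<Rightarrow> real) \<in> borel_measurable borel"
  unfolding det_def[abs_def] by measurable

text \<open>By coercivity, strict positivity of the form is the same as a lower bound 1/(k+1) on the
  unit sphere for some natural number k. The cone is thus a closed set intersected with a countable
  union of closed sets.\<close>

lemma posdef_cone_measurable [measurable]: "(posdef_cone :: (real^'n^'n) set) \<in> sets borel"
proof -
  let ?S = "{r :: real^'n^'n. transpose r = r}" and ?C = "\<lambda>k. \<Inter>x\<in>sphere 0 1. {r :: real^'n^'n. 1 / (real k + 1) \<le> x \<bullet> (r *v x)}"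
  have lin: "linear (\<lambda>r :: real^'n^'n. x \<bullet> (r *v x))" for x
    by (intro linearI) (simp_all add: matrix_vector_mult_add_rdistrib inner_add_right scaleR_matrix_vector_assoc[symmetric])
  have "posdef_cone = ?S \<inter> (\<Union>k. ?C k)"
  proof (intro set_eqI iffI)
    fix r :: "real^'n^'n" assume r: "r \<in> posdef_cone"
    obtain c where c: "c > 0" "\<And>x. c * (x \<bullet> x) \<le> x \<bullet> (r *v x)" using posdef_coercive[OF r] by blast
    obtain k where k: "1 / (real k + 1) < c"
      using c(1) by (metis nat_approx_posE of_nat_Suc add.commute)
    have "1 / (real k + 1) \<le> x \<bullet> (r *v x)" if "norm x = 1" for x
      using c(2)[of x] k that by (simp add: norm_eq_1)
    hence "r \<in> ?C k" by simp
    thus "r \<in> ?S \<inter> (\<Union>k. ?C k)" using posdef_cone_transpose[OF r] by blast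
  next
    fix r :: "real^'n^'n" assume r: "r \<in> ?S \<inter> (\<Union>k. ?C k)"
    then obtain k where "r \<in> ?C k" by blast
    hence k: "1 / (real k + 1) \<le> x \<bullet> (r *v x)" if "norm x = 1" for x using that by simp
    show "r \<in> posdef_cone"
    proof (rule posdef_coneI)
      fix x :: "real^'n" assume x: "x \<noteq> 0"
      have "0 < 1 / (real k + 1)" by simp
      also have "\<dots> \<le> (x /\<^sub>R norm x) \<bullet> (r *v (x /\<^sub>R norm x))" using x by (intro k) simp
      also have "\<dots> = (x \<bullet> (r *v x)) / (norm x * norm x)" by (simp add: matrix_vector_mult_scaleR field_simps)
      finally show "0 < x \<bullet> (r *v x)" using x by (simp add: zero_less_divide_iff)
    qed (use r in auto)
  qed
  moreover have "closed ?S"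
    unfolding transpose_def vec_eq_iff
    by (simp add: closed_Collect_all closed_Collect_eq continuous_intros)
  moreover have "closed (?C k)" for k
    by (intro closed_INT ballI closed_Collect_le continuous_intros linear_continuous_on)
       (use lin in \<open>auto simp: linear_conv_bounded_linear\<close>)
  ultimately show ?thesis
    by (metis (no_types, lifting) borel_closed sets.Int sets.countable_UN image_subsetI)
qed

definition upper :: "'m::linorder set \<Rightarrow> ('m \<times> 'm) set" where
  "upper A = {(i, j). i \<in> A \<and> j \<in> A \<and> i \<le> j}"

definition usym :: "('m::linorder \<times> 'm \<Rightarrow> real) \<Rightarrow> 'm \<Rightarrow> 'm \<Rightarrow> real" where
  "usym u i j = (if i \<le> j then u (i, j) else u (j, i))"

definition gram :: "'m::linorder set \<Rightarrow> ('m \<Rightarrow> 'a::real_inner) \<Rightarrow> 'm \<times> 'm \<Rightarrow> real" where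
  "gram A y = (\<lambda>(i, j)\<in>upper A. y i \<bullet> y j)"

text \<open>The symmetric matrix on the index set \<open>A\<close>, moved along
  \<open>\<iota>\<close> into the n x n matrices and padded by the identity, so that the results on
  bordered blocks apply at every stage \<open>A\<close> of the induction.\<close>

definition gram_matrix :: "('m::{finite,linorder} \<Rightarrow> 'n::finite) \<Rightarrow> 'm set \<Rightarrow> ('m \<times> 'm \<Rightarrow> real) \<Rightarrow> real^'n^'n" where
  "gram_matrix \<iota> A u = block (\<iota> ` A) (\<lambda>i j. usym u (inv \<iota> i) (inv \<iota> j))"

text \<open>The determinant factor of a Wishart density with n degrees of freedom: up to
  \<open>wishart_const\<close>, the density of the Gram matrix of \<open>card A\<close> vectors
  distributed by Lebesgue measure.\<close>

definition wishart_weight :: "('m::{finite,linorder} \<Rightarrow> 'n::finite) \<Rightarrow> 'm set \<Rightarrow> ('m \<times> 'm \<Rightarrow> real) \<Rightarrow> ennreal" where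
  "wishart_weight \<iota> A u = (if gram_matrix \<iota> A u \<in> posdef_cone
     then ennreal (det (gram_matrix \<iota> A u) powr ((real CARD('n) - real (card A) - 1) / 2)) else 0)"

lemma gram_measurable [measurable]:
  "gram A \<in> measurable (\<Pi>\<^sub>M i\<in>A. lborel :: 'a::euclidean_space measure) (\<Pi>\<^sub>M i\<in>upper A. lborel)"
  unfolding gram_def[abs_def]
proof (rule measurable_restrict)
  fix p assume "p \<in> upper A"
  then obtain i j where p: "p = (i, j)" "i \<in> A" "j \<in> A" by (auto simp: upper_def)
  have [measurable]: "(\<lambda>y. y k) \<in> borel_measurable (\<Pi>\<^sub>M i\<in>A. lborel :: 'a measure)" if "k \<in> A" for k
    using measurable_component_singleton[OF that, of "\<lambda>_. lborel :: 'a measure"] by simp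
  show "(\<lambda>y. case p of (i, j) \<Rightarrow> y i \<bullet> y j) \<in> measurable (\<Pi>\<^sub>M i\<in>A. lborel :: 'a measure) lborel"
    using p by simp
qed

lemma gram_matrix_measurable [measurable]:
  fixes \<iota> :: "'m::{finite,linorder} \<Rightarrow> 'n::finite"
  assumes \<iota>: "inj \<iota>"
  shows "gram_matrix \<iota> A \<in> borel_measurable (\<Pi>\<^sub>M i\<in>upper A. lborel)"
proof (rule matrix_measurableI)
  fix i j
  have [measurable]: "(\<lambda>u. u p) \<in> borel_measurable (\<Pi>\<^sub>M i\<in>upper A. lborel :: real measure)" if "p \<in> upper A" for p
    using measurable_component_singleton[OF that, of "\<lambda>_. lborel :: real measure"] by simp
  show "(\<lambda>u. gram_matrix \<iota> A u $ i $ j) \<in> borel_measurable (\<Pi>\<^sub>M i\<in>upper A. lborel)"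
  proof (cases "i \<in> \<iota> ` A \<and> j \<in> \<iota> ` A")
    case True
    then obtain k l where kl: "i = \<iota> k" "j = \<iota> l" "k \<in> A" "l \<in> A" by auto
    have "(k, l) \<in> upper A" if "k \<le> l" using that kl by (simp add: upper_def)
    moreover have "(l, k) \<in> upper A" if "\<not> k \<le> l" using that kl by (auto simp: upper_def)
    ultimately show ?thesis using \<iota> kl
      by (cases "k \<le> l") (auto simp: gram_matrix_def block_def usym_def)
  next
    case False
    hence "(\<lambda>u. gram_matrix \<iota> A u $ i $ j) = (\<lambda>_. if i = j then 1 else 0)"
      by (auto simp: gram_matrix_def block_def)
    thus ?thesis by simp
  qed
qed

lemma wishart_weight_measurable [measurable]:
  assumes "inj \<iota>"
  shows "wishart_weight \<iota> A \<in> borel_measurable (\<Pi>\<^sub>M i\<in>upper A. lborel)"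
proof -
  note [measurable] = gram_matrix_measurable[OF assms]
  show ?thesis unfolding wishart_weight_def[abs_def] by measurable
qed

text \<open>One radial constant per column: the k-th new column has n - k dimensions left over after
  its inner products with the earlier ones.\<close>

definition wishart_const :: "nat \<Rightarrow> nat \<Rightarrow> real" where
  "wishart_const n p = (\<Prod>k<p. sphere_const (n - k))"

text \<open>For \<open>a\<close> above all of \<open>A\<close>, the new entries fill the last column
  of the upper triangle: inner products \<open>b\<close>, indexed by rows along
  \<open>\<iota>\<close>, and the squared norm \<rho>. This order keeps the extension compatible
  with \<open>usym\<close>.\<close>

definition gram_extend :: "('m::linorder \<Rightarrow> 'n) \<Rightarrow> 'm \<Rightarrow> 'm set \<Rightarrow> ('m \<times> 'm \<Rightarrow> real) \<Rightarrow> ('n \<Rightarrow> real) \<Rightarrow> real \<Rightarrow> 'm \<times> 'm \<Rightarrow> real" where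
  "gram_extend \<iota> a A u b \<rho> =
    (\<lambda>(i, j)\<in>upper (insert a A). if j = a then (if i = a then \<rho> else b (\<iota> i)) else u (i, j))"

lemma gram_extend_measurable:
  fixes \<iota> :: "'m::{finite,linorder} \<Rightarrow> 'n::finite"
  assumes "\<And>x. x \<in> A \<Longrightarrow> x < a"
  shows "(\<lambda>(u, b, \<rho>). gram_extend \<iota> a A u b \<rho>) \<in>
    measurable ((\<Pi>\<^sub>M i\<in>upper A. lborel) \<Otimes>\<^sub>M (\<Pi>\<^sub>M i\<in>\<iota> ` A. lborel) \<Otimes>\<^sub>M lborel) (\<Pi>\<^sub>M i\<in>upper (insert a A). lborel)"
  unfolding gram_extend_def case_prod_beta
proof (rule measurable_restrict)
  fix p assume p: "p \<in> upper (insert a A)"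
  obtain i j where ij: "p = (i, j)" by fastforce
  consider "j = a" "i = a" | "j = a" "i \<in> A" "i \<noteq> a" | "j \<noteq> a" "(i, j) \<in> upper A"
    using p ij assms by (fastforce simp: upper_def)
  thus "(\<lambda>x. if snd p = a then if fst p = a then snd (snd x) else fst (snd x) (\<iota> (fst p)) else fst x (fst p, snd p))
     \<in> measurable ((\<Pi>\<^sub>M i\<in>upper A. lborel) \<Otimes>\<^sub>M (\<Pi>\<^sub>M i\<in>\<iota> ` A. lborel) \<Otimes>\<^sub>M lborel) lborel"
  proof cases
    case 2
    have "\<iota> i \<in> \<iota> ` A" using 2(2) by (rule imageI)
    note m = measurable_component_singleton[OF this, of "\<lambda>_. lborel :: real measure"]
    have "(\<lambda>x. fst (snd x) (\<iota> i)) \<in> measurable ((\<Pi>\<^sub>M i\<in>upper A. lborel :: real measure) \<Otimes>\<^sub>M (\<Pi>\<^sub>M i\<in>\<iota> ` A. lborel :: real measure) \<Otimes>\<^sub>M (lborel :: real measure)) lborel"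
      by (rule measurable_compose[OF measurable_compose[OF measurable_snd measurable_fst] m])
    thus ?thesis using 2 by (simp add: ij)
  next
    case 3
    have "(\<lambda>x. fst x (i, j)) \<in> measurable ((\<Pi>\<^sub>M i\<in>upper A. lborel :: real measure) \<Otimes>\<^sub>M (\<Pi>\<^sub>M i\<in>\<iota> ` A. lborel :: real measure) \<Otimes>\<^sub>M (lborel :: real measure)) lborel"
      by (rule measurable_compose[OF measurable_fst measurable_component_singleton[OF 3(2)]])
    thus ?thesis using 3 by (simp add: ij)
  qed (simp add: ij)
qed

lemma gram_matrix_extend:
  fixes \<iota> :: "'m::{finite,linorder} \<Rightarrow> 'n::finite"
  assumes \<iota>: "inj \<iota>" and a: "\<And>x. x \<in> A \<Longrightarrow> x < a"
  shows "gram_matrix \<iota> (insert a A) (gram_extend \<iota> a A u b \<rho>) =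
    block (insert (\<iota> a) (\<iota> ` A)) (border (\<iota> a) (\<lambda>i j. usym u (inv \<iota> i) (inv \<iota> j)) b \<rho>)"
proof -
  have aA: "a \<notin> A" using a by blast
  have "usym (gram_extend \<iota> a A u b \<rho>) k l = border (\<iota> a) (\<lambda>i j. usym u (inv \<iota> i) (inv \<iota> j)) b \<rho> (\<iota> k) (\<iota> l)"
    if "k \<in> insert a A" "l \<in> insert a A" for k l
    using that \<iota> a[of k] a[of l] aA
    by (auto simp: usym_def gram_extend_def border_def upper_def inj_eq not_le)
  thus ?thesis using \<iota> by (auto simp: gram_matrix_def block_def vec_eq_iff inj_eq)
qed

lemma gram_insert:
  fixes \<iota> :: "'m::{finite,linorder} \<Rightarrow> 'n::finite"
  assumes \<iota>: "inj \<iota>" and a: "\<And>x. x \<in> A \<Longrightarrow> x < a"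
  shows "gram (insert a A) (y(a := x)) =
    gram_extend \<iota> a A (gram A y) (\<lambda>i\<in>\<iota> ` A. y (inv \<iota> i) \<bullet> x) (x \<bullet> x)"
proof -
  have aA: "a \<notin> A" using a by blast
  have "\<not> a \<le> b" if "b \<in> A" for b using a[OF that] by simp
  thus ?thesis
    using \<iota> aA by (auto simp: gram_def gram_extend_def fun_eq_iff restrict_def upper_def)
qed

lemma gram_matrix_gram:
  fixes \<iota> :: "'m::{finite,linorder} \<Rightarrow> 'n::finite"
  assumes \<iota>: "inj \<iota>"
  shows "gram_matrix \<iota> A (gram A y) = block (\<iota> ` A) (\<lambda>i j. y (inv \<iota> i) \<bullet> y (inv \<iota> j))"
    and "k \<in> A \<Longrightarrow> l \<in> A \<Longrightarrow> usym (gram A y) k l = y k \<bullet> y l"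
proof -
  show *: "usym (gram A y) k l = y k \<bullet> y l" if "k \<in> A" "l \<in> A" for k l
    using that by (auto simp: usym_def gram_def upper_def inner_commute)
  show "gram_matrix \<iota> A (gram A y) = block (\<iota> ` A) (\<lambda>i j. y (inv \<iota> i) \<bullet> y (inv \<iota> j))"
    using \<iota> by (auto simp: gram_matrix_def block_def vec_eq_iff *)
qed

text \<open>Fubini for the new pairs of indices: those of the form (i, a) with i in \<open>A\<close>
  are renamed along \<open>\<iota>\<close> to match the border entries, and (a, a) carries
  \<rho>.\<close>

lemma nn_integral_upper_insert:
  fixes \<iota> :: "'m::{finite,linorder} \<Rightarrow> 'n::finite"
  assumes \<iota>: "inj \<iota>" and a: "\<And>x. x \<in> A \<Longrightarrow> x < a"
    and P [measurable]: "P \<in> borel_measurable (\<Pi>\<^sub>M i\<in>upper (insert a A). lborel :: real measure)"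
  shows "(\<integral>\<^sup>+u. P u \<partial>(\<Pi>\<^sub>M i\<in>upper (insert a A). lborel)) =
    (\<integral>\<^sup>+u. (\<integral>\<^sup>+b. (\<integral>\<^sup>+\<rho>. P (gram_extend \<iota> a A u b \<rho>) \<partial>lborel) \<partial>(\<Pi>\<^sub>M i\<in>\<iota> ` A. lborel)) \<partial>(\<Pi>\<^sub>M i\<in>upper A. lborel))"
proof -
  interpret product_sigma_finite "\<lambda>_::'m \<times> 'm. lborel :: real measure" by standard
  define B0 where "B0 = (\<lambda>i. (i, a)) ` A"
  define B where "B = insert (a, a) B0"
  have aA: "a \<notin> A" using a by blast
  have na: "\<not> a \<le> x" if "x \<in> A" for x using a[OF that] by simp
  have le: "x \<le> a" if "x \<in> A" for x using a[OF that] by simp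
  have un: "upper (insert a A) = upper A \<union> B"
    using na le by (auto simp: upper_def B_def B0_def)
  have disj: "upper A \<inter> B = {}" using aA by (auto simp: upper_def B_def B0_def)
  have aB0: "(a, a) \<notin> B0" using aA by (auto simp: B0_def)
  have g: "bij_betw (\<lambda>p. \<iota> (fst p)) B0 (\<iota> ` A)"
    unfolding bij_betw_def
  proof
    show "inj_on (\<lambda>p. \<iota> (fst p)) B0" using \<iota> by (auto intro!: inj_onI simp: B0_def dest: injD)
    show "(\<lambda>p. \<iota> (fst p)) ` B0 = \<iota> ` A" by (simp add: B0_def image_image)
  qed
  have P': "P \<in> borel_measurable (\<Pi>\<^sub>M i\<in>upper A \<union> B. lborel :: real measure)" using P by (simp add: un)
  have "(\<integral>\<^sup>+u. P u \<partial>(\<Pi>\<^sub>M i\<in>upper (insert a A). lborel))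
      = (\<integral>\<^sup>+u. (\<integral>\<^sup>+v. P (merge (upper A) B (u, v)) \<partial>(\<Pi>\<^sub>M i\<in>B. lborel)) \<partial>(\<Pi>\<^sub>M i\<in>upper A. lborel))"
    unfolding un by (rule product_nn_integral_fold[OF disj _ _ P']) auto
  also have "\<dots> = (\<integral>\<^sup>+u. (\<integral>\<^sup>+b. (\<integral>\<^sup>+\<rho>. P (gram_extend \<iota> a A u b \<rho>) \<partial>lborel) \<partial>(\<Pi>\<^sub>M i\<in>\<iota> ` A. lborel)) \<partial>(\<Pi>\<^sub>M i\<in>upper A. lborel))"
  proof (rule nn_integral_cong)
    fix u assume u [measurable]: "u \<in> space (\<Pi>\<^sub>M i\<in>upper A. lborel :: real measure)"
    let ?N = "\<lambda>v. P (merge (upper A) B (u, v))"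
    have "(\<lambda>v. (u, v)) \<in> measurable (\<Pi>\<^sub>M i\<in>B. lborel :: real measure) ((\<Pi>\<^sub>M i\<in>upper A. lborel) \<Otimes>\<^sub>M (\<Pi>\<^sub>M i\<in>B. lborel))"
      by measurable
    from measurable_compose[OF measurable_compose[OF this measurable_merge] P']
    have N [measurable]: "?N \<in> borel_measurable (\<Pi>\<^sub>M i\<in>B. lborel)" .
    define F where "F v = (\<integral>\<^sup>+\<rho>. ?N (v((a, a) := \<rho>)) \<partial>lborel)" for v
    have upd: "(\<lambda>(v, \<rho>). v((a, a) := \<rho>)) \<in> measurable ((\<Pi>\<^sub>M i\<in>B0. lborel :: real measure) \<Otimes>\<^sub>M lborel) (\<Pi>\<^sub>M i\<in>B. lborel)"
      using measurable_add_dim[of "(a, a)" B0 "\<lambda>_. lborel :: real measure"] by (simp add: B_def)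
    have "(\<lambda>(v, \<rho>). ?N (v((a, a) := \<rho>))) \<in> borel_measurable ((\<Pi>\<^sub>M i\<in>B0. lborel) \<Otimes>\<^sub>M lborel)"
      using measurable_compose[OF upd N] by (simp add: case_prod_beta)
    hence F: "F \<in> borel_measurable (\<Pi>\<^sub>M i\<in>B0. lborel)"
      unfolding F_def[abs_def] by (rule lborel.borel_measurable_nn_integral)
    have "(\<integral>\<^sup>+v. ?N v \<partial>(\<Pi>\<^sub>M i\<in>B. lborel)) = (\<integral>\<^sup>+v. F v \<partial>(\<Pi>\<^sub>M i\<in>B0. lborel))"
      unfolding B_def F_def by (rule product_nn_integral_insert) (use aB0 N in \<open>auto simp: B_def\<close>)
    also have "\<dots> = (\<integral>\<^sup>+b. F (\<lambda>p\<in>B0. b (\<iota> (fst p))) \<partial>(\<Pi>\<^sub>M i\<in>\<iota> ` A. lborel))"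
      by (rule nn_integral_PiM_reindex[OF sigma_finite_lborel g _ F]) simp
    also have "\<dots> = (\<integral>\<^sup>+b. (\<integral>\<^sup>+\<rho>. P (gram_extend \<iota> a A u b \<rho>) \<partial>lborel) \<partial>(\<Pi>\<^sub>M i\<in>\<iota> ` A. lborel))"
      unfolding F_def
    proof (intro nn_integral_cong arg_cong[of _ _ P] ext)
      fix b and \<rho> :: real and p :: "'m \<times> 'm"
      show "merge (upper A) B (u, (\<lambda>p\<in>B0. b (\<iota> (fst p)))((a, a) := \<rho>)) p = gram_extend \<iota> a A u b \<rho> p"
        unfolding gram_extend_def un
        using aA na by (cases p) (auto simp: merge_def B_def B0_def upper_def)
    qed
    finally show "(\<integral>\<^sup>+v. ?N v \<partial>(\<Pi>\<^sub>M i\<in>B. lborel)) =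
      (\<integral>\<^sup>+b. (\<integral>\<^sup>+\<rho>. P (gram_extend \<iota> a A u b \<rho>) \<partial>lborel) \<partial>(\<Pi>\<^sub>M i\<in>\<iota> ` A. lborel))" .
  qed
  finally show ?thesis .
qed

text \<open>The exponent bookkeeping. With q = n - card A and D s the extended determinant, (D
  s)^((q-2)/2) factors as D^((q-1)/2) (the old weight), D^(-1/2) (the linear substitution) and
  s^(q/2-1) (the radial density). Both sides vanish where the old or the extended matrix leaves the
  cone.\<close>

lemma wishart_weight_extend:
  fixes \<iota> :: "'m::{finite,linorder} \<Rightarrow> 'n::finite" and u :: "'m \<times> 'm \<Rightarrow> real"
  assumes \<iota>: "inj \<iota>" and a: "\<And>x. x \<in> A \<Longrightarrow> x < a" and less: "card A < CARD('n)"
  defines "D \<equiv> det (gram_matrix \<iota> A u)"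
  shows "ennreal (sphere_const (CARD('n) - card A)) * wishart_weight \<iota> (insert a A) (gram_extend \<iota> a A u b \<rho>) =
    wishart_weight \<iota> A u * (ennreal (1 / sqrt D) *
      radial_density (CARD('n) - card A) (det (gram_matrix \<iota> (insert a A) (gram_extend \<iota> a A u b \<rho>)) / D))"
proof -
  let ?c = "\<lambda>i j. usym u (inv \<iota> i) (inv \<iota> j)"
  have aA: "a \<notin> A" using a by blast
  have aI: "\<iota> a \<notin> \<iota> ` A" using aA \<iota> by (simp add: inj_image_mem_iff)
  have c: "card (insert a A) = card A + 1" using aA by simp
  define q where "q = CARD('n) - card A"
  have q: "q > 0" "real q = real CARD('n) - real (card A)" using less by (auto simp: q_def)
  have ext: "gram_matrix \<iota> (insert a A) (gram_extend \<iota> a A u b \<rho>) =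
    block (insert (\<iota> a) (\<iota> ` A)) (border (\<iota> a) ?c b \<rho>)"
    by (rule gram_matrix_extend[OF \<iota> a])
  show ?thesis
  proof (cases "gram_matrix \<iota> A u \<in> posdef_cone")
    case False
    have "gram_matrix \<iota> (insert a A) (gram_extend \<iota> a A u b \<rho>) \<notin> posdef_cone"
      using posdef_block_of_border[OF _ aI, of ?c b \<rho>] False unfolding ext gram_matrix_def[of \<iota> A] by blast
    thus ?thesis using False by (simp add: wishart_weight_def)
  next
    case True
    hence R: "block (\<iota> ` A) ?c \<in> posdef_cone" by (simp add: gram_matrix_def)
    define s where "s = \<rho> - restrict_vec (\<iota> ` A) b \<bullet> (matrix_inv (block (\<iota> ` A) ?c) *v restrict_vec (\<iota> ` A) b)"
    have D: "D > 0" using posdef_det_pos[OF True] by (simp add: D_def)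
    have det: "det (gram_matrix \<iota> (insert a A) (gram_extend \<iota> a A u b \<rho>)) = D * s"
      unfolding ext det_border[OF R aI] by (simp add: D_def s_def gram_matrix_def)
    have pd: "gram_matrix \<iota> (insert a A) (gram_extend \<iota> a A u b \<rho>) \<in> posdef_cone \<longleftrightarrow> s > 0"
      unfolding ext posdef_border[OF R aI] by (simp add: s_def)
    show ?thesis
    proof (cases "s > 0")
      case False
      thus ?thesis using pd det D by (simp add: wishart_weight_def radial_density_def q_def[symmetric])
    next
      case s: True
      let ?e = "(real q - 2) / 2"
      have "ennreal (sphere_const q) * wishart_weight \<iota> (insert a A) (gram_extend \<iota> a A u b \<rho>)
          = ennreal (sphere_const q * (D powr ?e * s powr ?e))"
        using s pd sphere_const_pos[OF q(1)] D
        by (simp add: wishart_weight_def det c q(2) ennreal_mult powr_mult diff_diff_eq add.commute[of 2])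
      also have "D powr ?e = D powr ((real q - 1) / 2) * (1 / sqrt D)"
        using D by (simp add: powr_half_sqrt[symmetric] powr_diff[symmetric] divide_powr_uminus diff_divide_distrib
            flip: powr_add)
      also have "s powr ?e = s powr (real q / 2 - 1)" by (simp add: diff_divide_distrib)
      also have "ennreal (sphere_const q * (D powr ((real q - 1) / 2) * (1 / sqrt D) * s powr (real q / 2 - 1)))
         = ennreal (D powr ((real q - 1) / 2)) * (ennreal (1 / sqrt D) * ennreal (sphere_const q * s powr (real q / 2 - 1)))"
        using D sphere_const_pos[OF q(1)] by (simp add: ennreal_mult[symmetric] mult_ac)
      also have "\<dots> = wishart_weight \<iota> A u * (ennreal (1 / sqrt D) * radial_density q (D * s / D))"
        using True D s by (simp add: wishart_weight_def radial_density_def D_def q(2))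
      finally show ?thesis by (simp add: det q_def)
    qed
  qed
qed

text \<open>Induction on the largest index: given the earlier columns, the new one influences the
  Gram matrix only through its inner products with them and its norm, whose joint law is
  known.\<close>

lemma nn_integral_gram:
  fixes \<iota> :: "'m::{finite,linorder} \<Rightarrow> 'n::finite" and A :: "'m set"
  assumes \<iota>: "inj \<iota>" and H: "H \<in> borel_measurable (\<Pi>\<^sub>M i\<in>upper A. lborel)"
  shows "(\<integral>\<^sup>+y. H (gram A y) \<partial>(\<Pi>\<^sub>M i\<in>A. lborel :: (real^'n) measure)) =
    ennreal (wishart_const CARD('n) (card A)) * (\<integral>\<^sup>+u. wishart_weight \<iota> A u * H u \<partial>(\<Pi>\<^sub>M i\<in>upper A. lborel))"
  using finite[of A] H
proof (induction A arbitrary: H rule: finite_linorder_max_induct)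
  case empty
  interpret E: product_sigma_finite "\<lambda>_::'m. lborel :: (real^'n) measure" by standard
  interpret E': product_sigma_finite "\<lambda>_::'m \<times> 'm. lborel :: real measure" by standard
  have "upper {} = ({} :: ('m \<times> 'm) set)" by (simp add: upper_def)
  moreover have "gram_matrix \<iota> {} u = mat 1" for u
    by (simp add: gram_matrix_def block_def mat_def)
  ultimately show ?case
    by (simp add: PiM_empty nn_integral_count_space_finite wishart_const_def wishart_weight_def
        mat_1_posdef gram_def restrict_def)
next
  case (insert a A)
  interpret E: product_sigma_finite "\<lambda>_::'m. lborel :: (real^'n) measure" by standard
  have a: "\<And>x. x \<in> A \<Longrightarrow> x < a" using insert.hyps by blast
  have aA: "a \<notin> A" using a by blast
  have aI: "\<iota> a \<notin> \<iota> ` A" using aA \<iota> by (simp add: inj_image_mem_iff)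
  have "card (insert a A) \<le> CARD('n)"
    using card_inj_on_le[OF inj_on_subset[OF \<iota>], of "insert a A" UNIV] by simp
  hence less: "card A < CARD('n)" using aA by simp
  let ?K = "ennreal (wishart_const CARD('n) (card A))" and ?q = "CARD('n) - card A"
  let ?D = "\<lambda>u. det (gram_matrix \<iota> A u)" and ?D' = "\<lambda>u b \<rho>. det (gram_matrix \<iota> (insert a A) (gram_extend \<iota> a A u b \<rho>))"
  note [measurable] = gram_matrix_measurable[OF \<iota>, of A] gram_matrix_measurable[OF \<iota>, of "insert a A"]
    wishart_weight_measurable[OF \<iota>, of A] wishart_weight_measurable[OF \<iota>, of "insert a A"] insert.prems
  note ext_m = gram_extend_measurable[of A a \<iota>, OF a]
  let ?M = "\<Pi>\<^sub>M i\<in>upper A. lborel :: real measure" and ?N = "\<Pi>\<^sub>M i\<in>\<iota> ` A. lborel :: real measure"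
  interpret N: sigma_finite_measure ?N
    by (rule product_sigma_finite.sigma_finite) (auto intro: product_sigma_finite.intro sigma_finite_lborel)
  \<comment> \<open>\<open>X\<close> is the integrand in the entries contributed by the new column;
    \<open>G u\<close> below is its integral conditional on the earlier Gram entries
    \<open>u\<close>.\<close>
  define X where "X u b \<rho> = radial_density ?q (?D' u b \<rho> / ?D u) * H (gram_extend \<iota> a A u b \<rho>)" for u b \<rho>
  define G where "G u = ennreal (1 / sqrt (?D u)) * (\<integral>\<^sup>+b. (\<integral>\<^sup>+\<rho>. X u b \<rho> \<partial>lborel) \<partial>?N)" for u
  have ext_m2: "(\<lambda>p. gram_extend \<iota> a A (f p) (g p) (h p)) \<in> measurable L (\<Pi>\<^sub>M i\<in>upper (insert a A). lborel)"
    if "f \<in> measurable L ?M" "g \<in> measurable L ?N" "h \<in> measurable L lborel"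
    for f g h and L :: "'z measure"
  proof -
    have "(\<lambda>p. (f p, g p, h p)) \<in> measurable L (?M \<Otimes>\<^sub>M ?N \<Otimes>\<^sub>M lborel)" using that by measurable
    from measurable_compose[OF this ext_m] show ?thesis by simp
  qed
  have X_m: "(\<lambda>p. X (f p) (g p) (h p)) \<in> borel_measurable L"
    if [measurable]: "f \<in> measurable L ?M" "g \<in> measurable L ?N" "h \<in> measurable L lborel"
    for f g h and L :: "'z measure"
  proof -
    note [measurable] = ext_m2[OF that]
    show ?thesis unfolding X_def by measurable
  qed
  have "(\<lambda>(p, \<rho>). X (fst p) (snd p) \<rho>) \<in> borel_measurable ((?M \<Otimes>\<^sub>M ?N) \<Otimes>\<^sub>M lborel)"
    unfolding case_prod_beta by (rule X_m) measurable
  hence "(\<lambda>(u, b). \<integral>\<^sup>+\<rho>. X u b \<rho> \<partial>lborel) \<in> borel_measurable (?M \<Otimes>\<^sub>M ?N)"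
    unfolding case_prod_beta by (rule lborel.borel_measurable_nn_integral[unfolded case_prod_beta])
  hence "(\<lambda>u. \<integral>\<^sup>+b. (\<integral>\<^sup>+\<rho>. X u b \<rho> \<partial>lborel) \<partial>?N) \<in> borel_measurable ?M"
    by (rule N.borel_measurable_nn_integral)
  hence G [measurable]: "G \<in> borel_measurable ?M" unfolding G_def[abs_def] by measurable
  define ind where "ind u = (indicator posdef_cone (gram_matrix \<iota> A u) :: ennreal)" for u
  have [measurable]: "ind \<in> borel_measurable ?M" unfolding ind_def[abs_def] by measurable
  \<comment> \<open>The induction hypothesis itself, applied to the indicator of the matrices
    outside the cone, shows that linearly dependent columns form a null set. The conditional law can
    then be used almost everywhere.\<close>
  have "(\<integral>\<^sup>+y. (1 - ind (gram A y)) \<partial>(\<Pi>\<^sub>M i\<in>A. lborel :: (real^'n) measure)) =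
      ?K * (\<integral>\<^sup>+u. wishart_weight \<iota> A u * (1 - ind u) \<partial>?M)"
    by (rule insert.IH) measurable
  also have "(\<integral>\<^sup>+u. wishart_weight \<iota> A u * (1 - ind u) \<partial>?M) = (\<integral>\<^sup>+u. 0 \<partial>?M)"
    by (intro nn_integral_cong) (auto simp: wishart_weight_def ind_def indicator_def)
  finally have "(\<integral>\<^sup>+y. (1 - ind (gram A y)) \<partial>(\<Pi>\<^sub>M i\<in>A. lborel :: (real^'n) measure)) = 0" by simp
  hence "AE y in \<Pi>\<^sub>M i\<in>A. lborel :: (real^'n) measure. 1 - ind (gram A y) = 0"
    by (subst (asm) nn_integral_0_iff_AE) auto
  hence AE: "AE y in \<Pi>\<^sub>M i\<in>A. lborel :: (real^'n) measure. gram_matrix \<iota> A (gram A y) \<in> posdef_cone"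
    by eventually_elim (rule ccontr, simp add: ind_def)
  have "(\<integral>\<^sup>+y. H (gram (insert a A) y) \<partial>(\<Pi>\<^sub>M i\<in>insert a A. lborel :: (real^'n) measure)) =
      (\<integral>\<^sup>+y. (\<integral>\<^sup>+x. H (gram (insert a A) (y(a := x))) \<partial>lborel) \<partial>(\<Pi>\<^sub>M i\<in>A. lborel :: (real^'n) measure))"
    by (rule E.product_nn_integral_insert) (use aA in auto)
  also have "\<dots> = (\<integral>\<^sup>+y. ind (gram A y) * G (gram A y) \<partial>(\<Pi>\<^sub>M i\<in>A. lborel :: (real^'n) measure))"
  proof (rule nn_integral_cong_AE, use AE in eventually_elim)
    fix y :: "'m \<Rightarrow> real^'n"
    assume pd: "gram_matrix \<iota> A (gram A y) \<in> posdef_cone"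
    let ?y = "\<lambda>i. y (inv \<iota> i)"
    have R: "block (\<iota> ` A) (\<lambda>i j. ?y i \<bullet> ?y j) \<in> posdef_cone"
      using pd by (simp add: gram_matrix_gram(1)[OF \<iota>])
    have bd: "block (insert (\<iota> a) (\<iota> ` A)) (border (\<iota> a) (\<lambda>i j. ?y i \<bullet> ?y j) b \<rho>)
       = gram_matrix \<iota> (insert a A) (gram_extend \<iota> a A (gram A y) b \<rho>)" for b \<rho>
    proof -
      have ext: "gram_matrix \<iota> (insert a A) (gram_extend \<iota> a A (gram A y) b \<rho>) =
        block (insert (\<iota> a) (\<iota> ` A)) (border (\<iota> a) (\<lambda>i j. usym (gram A y) (inv \<iota> i) (inv \<iota> j)) b \<rho>)"
        by (rule gram_matrix_extend[OF \<iota> a])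
      show ?thesis unfolding ext using \<iota> aA
        by (auto simp: block_def border_def vec_eq_iff gram_matrix_gram(2)[OF \<iota>] inj_eq)
    qed
    have hm: "(\<lambda>(b, \<rho>). H (gram_extend \<iota> a A (gram A y) b \<rho>)) \<in> borel_measurable (?N \<Otimes>\<^sub>M lborel)"
    proof -
      have "gram A y \<in> space ?M" by (auto simp: space_PiM gram_def)
      hence "(\<lambda>p. gram_extend \<iota> a A (gram A y) (fst p) (snd p)) \<in> measurable (?N \<Otimes>\<^sub>M lborel) (\<Pi>\<^sub>M i\<in>upper (insert a A). lborel)"
        by (intro ext_m2) measurable
      thus ?thesis unfolding case_prod_beta by measurable
    qed
    have "(\<integral>\<^sup>+x. H (gram (insert a A) (y(a := x))) \<partial>lborel)
       = (\<integral>\<^sup>+x. H (gram_extend \<iota> a A (gram A y) (\<lambda>i\<in>\<iota> ` A. ?y i \<bullet> x) (x \<bullet> x)) \<partial>lborel)"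
      by (simp add: gram_insert[OF \<iota> a])
    also have "\<dots> = G (gram A y)"
      unfolding nn_integral_inner_products[OF R aI hm] G_def X_def bd
      by (simp add: gram_matrix_gram(1)[OF \<iota>] card_image inj_on_subset[OF \<iota>])
    finally show "(\<integral>\<^sup>+x. H (gram (insert a A) (y(a := x))) \<partial>lborel) = ind (gram A y) * G (gram A y)"
      using pd by (simp add: ind_def)
  qed
  also have "\<dots> = ?K * (\<integral>\<^sup>+u. wishart_weight \<iota> A u * (ind u * G u) \<partial>?M)"
    by (rule insert.IH) measurable
  also have "(\<integral>\<^sup>+u. wishart_weight \<iota> A u * (ind u * G u) \<partial>?M) =
    (\<integral>\<^sup>+u. (\<integral>\<^sup>+b. (\<integral>\<^sup>+\<rho>. ennreal (sphere_const ?q) * (wishart_weight \<iota> (insert a A) (gram_extend \<iota> a A u b \<rho>) * H (gram_extend \<iota> a A u b \<rho>)) \<partial>lborel) \<partial>?N) \<partial>?M)"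
  proof (rule nn_integral_cong)
    fix u assume u [measurable]: "u \<in> space ?M"
    let ?c = "wishart_weight \<iota> A u * ennreal (1 / sqrt (?D u))"
    have Xu: "(\<lambda>(b, \<rho>). X u b \<rho>) \<in> borel_measurable (?N \<Otimes>\<^sub>M lborel)"
      unfolding case_prod_beta using u by (intro X_m) measurable
    have "wishart_weight \<iota> A u * (ind u * G u) = wishart_weight \<iota> A u * G u"
      by (auto simp: wishart_weight_def ind_def)
    also have "\<dots> = ?c * (\<integral>\<^sup>+b. (\<integral>\<^sup>+\<rho>. X u b \<rho> \<partial>lborel) \<partial>?N)"
      by (simp add: G_def mult.assoc)
    also have "\<dots> = (\<integral>\<^sup>+b. ?c * (\<integral>\<^sup>+\<rho>. X u b \<rho> \<partial>lborel) \<partial>?N)"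
      by (rule nn_integral_cmult[symmetric], rule lborel.borel_measurable_nn_integral[OF Xu])
    also have "\<dots> = (\<integral>\<^sup>+b. (\<integral>\<^sup>+\<rho>. ?c * X u b \<rho> \<partial>lborel) \<partial>?N)"
    proof (rule nn_integral_cong)
      fix b assume "b \<in> space ?N"
      from measurable_compose_Pair1[OF this Xu]
      show "?c * (\<integral>\<^sup>+\<rho>. X u b \<rho> \<partial>lborel) = (\<integral>\<^sup>+\<rho>. ?c * X u b \<rho> \<partial>lborel)"
        by (intro nn_integral_cmult[symmetric]) simp
    qed
    also have "\<dots> = (\<integral>\<^sup>+b. (\<integral>\<^sup>+\<rho>. ennreal (sphere_const ?q) * (wishart_weight \<iota> (insert a A) (gram_extend \<iota> a A u b \<rho>) * H (gram_extend \<iota> a A u b \<rho>)) \<partial>lborel) \<partial>?N)"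
      unfolding X_def by (simp only: mult.assoc[symmetric] wishart_weight_extend[OF \<iota> a less])
    finally show "wishart_weight \<iota> A u * (ind u * G u) = \<dots>" .
  qed
  also have "\<dots> = (\<integral>\<^sup>+u. ennreal (sphere_const ?q) * (wishart_weight \<iota> (insert a A) u * H u) \<partial>(\<Pi>\<^sub>M i\<in>upper (insert a A). lborel))"
    by (rule nn_integral_upper_insert[OF \<iota> a, symmetric]) measurable
  also have "\<dots> = ennreal (sphere_const ?q) * (\<integral>\<^sup>+u. wishart_weight \<iota> (insert a A) u * H u \<partial>(\<Pi>\<^sub>M i\<in>upper (insert a A). lborel))"
    by (rule nn_integral_cmult) measurable
  also have "?K * (ennreal (sphere_const ?q) * (\<integral>\<^sup>+u. wishart_weight \<iota> (insert a A) u * H u \<partial>(\<Pi>\<^sub>M i\<in>upper (insert a A). lborel)))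
    = ennreal (wishart_const CARD('n) (card (insert a A))) * (\<integral>\<^sup>+u. wishart_weight \<iota> (insert a A) u * H u \<partial>(\<Pi>\<^sub>M i\<in>upper (insert a A). lborel))"
  proof -
    have "wishart_const CARD('n) (card (insert a A)) = wishart_const CARD('n) (card A) * sphere_const ?q"
      using aA by (simp add: wishart_const_def)
    hence "ennreal (wishart_const CARD('n) (card (insert a A))) = ?K * ennreal (sphere_const ?q)"
      using sphere_const_pos[of ?q] less by (simp add: ennreal_mult'')
    thus ?thesis by (simp only: mult.assoc)
  qed
  finally show ?case .
qed

text \<open>In the Leibniz sum, a permutation that moves an index outside the range of
  \<open>\<iota>\<close> meets a zero of the identity padding; the others correspond to the
  permutations of \<open>'m\<close>, with the same sign. For definiteness, the quadratic form splits
  off the squares of the padded coordinates.\<close>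

lemma
  fixes \<iota> :: "'m::finite \<Rightarrow> 'n::finite" and M :: "real^'m^'m"
  assumes \<iota>: "inj \<iota>"
  defines "B \<equiv> block (range \<iota>) (\<lambda>i j. M $ inv \<iota> i $ inv \<iota> j)"
  shows det_block_embed: "det B = det M"
    and posdef_block_embed: "B \<in> posdef_cone \<longleftrightarrow> M \<in> posdef_cone"
proof -
  have B: "B $ \<iota> k $ \<iota> l = M $ k $ l" for k l using \<iota> by (simp add: B_def block_def)
  have Boff: "B $ i $ j = (if i = j then 1 else 0)" if "i \<notin> range \<iota> \<or> j \<notin> range \<iota>" for i j
    using that by (auto simp: B_def block_def)
  let ?f = "map_permutation UNIV \<iota>"
  let ?t = "\<lambda>p. of_int (sign p) * (\<Prod>i\<in>UNIV. B $ i $ p i)"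
  have "det B = (\<Sum>p | p permutes UNIV. ?t p)" by (simp add: det_def)
  also have "\<dots> = (\<Sum>p | p permutes range \<iota>. ?t p)"
  proof (rule sum.mono_neutral_right)
    show "finite {p. p permutes (UNIV::'n set)}" by (rule finite_permutations) simp
    show "{p. p permutes range \<iota>} \<subseteq> {p. p permutes UNIV}" by (auto intro: permutes_subset)
    show "\<forall>p\<in>{p. p permutes UNIV} - {p. p permutes range \<iota>}. ?t p = 0"
    proof
      fix p assume p: "p \<in> {p. p permutes UNIV} - {p. p permutes range \<iota>}"
      then obtain i where "i \<notin> range \<iota>" "p i \<noteq> i" by (auto simp: permutes_def)
      hence "B $ i $ p i = 0" by (simp add: Boff)
      hence "(\<Prod>i\<in>UNIV. B $ i $ p i) = 0" by (intro prod_zero) auto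
      thus "?t p = 0" by simp
    qed
  qed
  also have "\<dots> = (\<Sum>p | p permutes (UNIV::'m set). ?t (?f p))"
  proof (rule sum.reindex_bij_betw[symmetric])
    have "?f = (\<lambda>\<pi> x. if x \<in> range \<iota> then \<iota> (\<pi> (inv \<iota> x)) else x)"
      by (simp add: fun_eq_iff map_permutation_def restrict_id_def)
    thus "bij_betw ?f {p. p permutes UNIV} {p. p permutes range \<iota>}"
      using bij_betw_permutations[OF bij_betw_imageI[OF \<iota> refl]] by simp
  qed
  also have "\<dots> = det M"
    unfolding det_def
  proof (intro sum.cong refl)
    fix p assume "p \<in> {p. p permutes (UNIV::'m set)}"
    hence p: "p permutes UNIV" by simp
    have fp: "?f p permutes range \<iota>"
      by (rule map_permutation_permutes[OF bij_betw_imageI[OF \<iota> refl] p])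
    have "(\<Prod>i\<in>UNIV. B $ i $ ?f p i) = (\<Prod>i\<in>range \<iota>. B $ i $ ?f p i)"
    proof (rule prod.mono_neutral_right)
      show "\<forall>i\<in>UNIV - range \<iota>. B $ i $ ?f p i = 1"
        using permutes_not_in[OF fp] by (simp add: Boff)
    qed auto
    also have "\<dots> = (\<Prod>k\<in>UNIV. B $ \<iota> k $ ?f p (\<iota> k))" by (simp add: prod.reindex[OF \<iota>])
    also have "\<dots> = (\<Prod>k\<in>UNIV. M $ k $ p k)"
      using \<iota> by (simp add: map_permutation_apply B)
    finally show "?t (?f p) = of_int (sign p) * (\<Prod>k\<in>UNIV. M $ k $ p k)"
      using sign_map_permutation[OF \<iota> p] by simp
  qed
  finally show "det B = det M" .
  \<comment> \<open>\<open>E\<close> extends a vector by zeros along \<open>\<iota>\<close>, so that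
    the padded squares vanish on its image.\<close>
  define E :: "real^'m^'n" where "E = (\<chi> i k. if i = \<iota> k then 1 else 0)"
  have E: "(E *v x) $ \<iota> k = x $ k" for x k
    using \<iota> by (simp add: E_def matrix_vector_mult_def inj_eq if_distrib[of "\<lambda>x. x * _"] cong: if_cong)
  have Eoff: "(E *v x) $ i = 0" if "i \<notin> range \<iota>" for x i
    using that by (auto simp: E_def matrix_vector_mult_def intro!: sum.neutral)
  have sum_range: "(\<Sum>i\<in>UNIV. h i) = (\<Sum>k\<in>UNIV. h (\<iota> k)) + (\<Sum>i\<in>- range \<iota>. h i)" for h :: "'n \<Rightarrow> real"
    using sum.union_disjoint[of "range \<iota>" "- range \<iota>" h] by (simp add: sum.reindex[OF \<iota>])
  have Bv: "(B *v x) $ \<iota> k = (M *v (\<chi> l. x $ \<iota> l)) $ k" for x k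
    unfolding matrix_vector_mult_def vec_lambda_beta sum_range
    by (simp add: B) (intro sum.neutral, auto simp: Boff)
  have Bvoff: "(B *v x) $ i = x $ i" if "i \<notin> range \<iota>" for x i
    using that by (simp add: matrix_vector_mult_def Boff if_distrib[of "\<lambda>x. x * _"] cong: if_cong)
  have quad: "x \<bullet> (B *v x) = (\<chi> l. x $ \<iota> l) \<bullet> (M *v (\<chi> l. x $ \<iota> l)) + (\<Sum>i\<in>- range \<iota>. (x $ i)\<^sup>2)" for x
    unfolding inner_vec_def sum_range by (simp add: Bv Bvoff power2_eq_square)
  show "B \<in> posdef_cone \<longleftrightarrow> M \<in> posdef_cone"
  proof
    assume M: "M \<in> posdef_cone"
    show "B \<in> posdef_cone"
    proof (rule posdef_coneI)
      have "M $ k $ l = M $ l $ k" for k l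
        using posdef_cone_transpose[OF M] by (simp add: transpose_def vec_eq_iff)
      thus "transpose B = B" by (auto simp: transpose_def vec_eq_iff B_def block_def)
      fix x :: "real^'n" assume x: "x \<noteq> 0"
      show "0 < x \<bullet> (B *v x)"
      proof (cases "(\<chi> l. x $ \<iota> l) = 0")
        case False
        thus ?thesis unfolding quad using posdef_cone_inner_pos[OF M False]
          by (intro add_pos_nonneg sum_nonneg) auto
      next
        case True
        hence "x $ \<iota> l = 0" for l by (simp add: vec_eq_iff)
        moreover obtain i where "x $ i \<noteq> 0" using x by (auto simp: vec_eq_iff)
        ultimately have i: "i \<in> - range \<iota>" "x $ i \<noteq> 0" by auto
        have "0 < (\<Sum>i\<in>- range \<iota>. (x $ i)\<^sup>2)" using i by (intro sum_pos2[of _ i]) auto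
        thus ?thesis unfolding quad True by simp
      qed
    qed
  next
    assume BP: "B \<in> posdef_cone"
    show "M \<in> posdef_cone"
    proof (rule posdef_coneI)
      have "B $ \<iota> k $ \<iota> l = B $ \<iota> l $ \<iota> k" for k l
        using posdef_cone_transpose[OF BP] by (simp add: transpose_def vec_eq_iff)
      thus "transpose M = M" by (simp add: transpose_def vec_eq_iff B)
      fix x :: "real^'m" assume x: "x \<noteq> 0"
      have Ex: "(\<chi> l. (E *v x) $ \<iota> l) = x" by (simp add: E vec_eq_iff)
      have "E *v x \<noteq> 0"
      proof
        assume "E *v x = 0"
        with Ex x show False by (simp add: vec_eq_iff)
      qed
      from posdef_cone_inner_pos[OF BP this] show "0 < x \<bullet> (M *v x)"
        unfolding quad Ex by (simp add: Eoff)
    qed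
  qed
qed

text \<open>The columns, not the rows, are the independent vectors whose inner products make up
  \<open>transpose y ** y\<close>.\<close>

lemma lborel_columns:
  "(lborel :: (real^'m^'n) measure) = distr (\<Pi>\<^sub>M j\<in>UNIV. lborel) borel (\<lambda>y. \<chi> i j. y j $ i)"
proof (rule lborel_eqI)
  interpret product_sigma_finite "\<lambda>_::'m. lborel :: (real^'n) measure" by standard
  fix l u :: "real^'m^'n"
  assume "\<And>b. b \<in> Basis \<Longrightarrow> l \<bullet> b \<le> u \<bullet> b"
  hence le: "l $ i $ j \<le> u $ i $ j" for i j by (rule le_inner_Basis_matrix)
  have m: "(\<lambda>y. (\<chi> i j. y j $ i) :: real^'m^'n) \<in> borel_measurable (\<Pi>\<^sub>M j\<in>UNIV. lborel)"
    by (rule matrix_measurableI) simp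
  have "(\<lambda>y. \<chi> i j. y j $ i) -` box l u \<inter> space (\<Pi>\<^sub>M j\<in>UNIV. lborel) = Pi\<^sub>E UNIV (\<lambda>j. box (column j l) (column j u))"
    by (auto simp: space_PiM PiE_iff mem_box_matrix mem_box_cart column_def)
  hence "emeasure (distr (\<Pi>\<^sub>M j\<in>UNIV. lborel) borel (\<lambda>y. \<chi> i j. y j $ i)) (box l u)
      = (\<Prod>j\<in>UNIV. emeasure lborel (box (column j l) (column j u)))"
    by (simp add: emeasure_distr m emeasure_PiM)
  also have "\<dots> = (\<Prod>j\<in>UNIV. ennreal (\<Prod>i\<in>UNIV. u $ i $ j - l $ i $ j))"
    by (intro prod.cong refl, subst emeasure_box_vector) (auto simp: column_def le)
  also have "\<dots> = ennreal (\<Prod>j\<in>UNIV. \<Prod>i\<in>UNIV. u $ i $ j - l $ i $ j)"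
    by (intro prod_ennreal prod_nonneg) (simp add: le)
  also have "(\<Prod>j\<in>UNIV. \<Prod>i\<in>UNIV. u $ i $ j - l $ i $ j) = (\<Prod>b\<in>Basis. (u - l) \<bullet> b)"
    unfolding prod_Basis_matrix by (subst prod.swap) simp
  finally show "emeasure (distr (\<Pi>\<^sub>M j\<in>UNIV. lborel) borel (\<lambda>y. \<chi> i j. y j $ i)) (box l u) = (\<Prod>b\<in>Basis. (u - l) \<bullet> b)" .
qed simp

text \<open>The Gram law for the full index set, with the padding removed. The coordinates of
  \<open>sym_lborel\<close> are exactly the upper-triangular Gram entries, so no further constant
  arises.\<close>

lemma nn_integral_transpose_mult:
  fixes H :: "real^'m::{finite,linorder}^'m::_ \<Rightarrow> ennreal"
  assumes le: "CARD('m) \<le> CARD('n::finite)" and [measurable]: "H \<in> borel_measurable borel"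
  shows "(\<integral>\<^sup>+y. H (transpose y ** y) \<partial>(lborel :: (real^'m::_^'n) measure)) =
    ennreal (wishart_const CARD('n) CARD('m)) *
    (\<integral>\<^sup>+r. (if r \<in> posdef_cone then ennreal (det r powr ((real CARD('n) - real CARD('m) - 1) / 2)) else 0) * H r \<partial>sym_lborel)"
proof -
  obtain \<iota> :: "'m \<Rightarrow> 'n" where \<iota>: "inj \<iota>"
    using card_le_inj[of "UNIV::'m set" "UNIV::'n set"] le by auto
  define W where "W r = (if r \<in> posdef_cone then ennreal (det r powr ((real CARD('n) - real CARD('m) - 1) / 2)) else 0)" for r :: "real^'m::_^'m::_"
  define S where "S u = (\<chi> i j. if i \<le> j then u (i, j) else u (j, i))" for u :: "'m \<times> 'm \<Rightarrow> real"
  have U: "{(i, j). i \<le> j} = upper (UNIV :: 'm set)" by (simp add: upper_def)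
  have S_usym: "S u $ i $ j = usym u i j" for u i j by (simp add: S_def usym_def)
  have [measurable]: "S \<in> borel_measurable (\<Pi>\<^sub>M i\<in>upper UNIV. lborel)"
  proof (rule matrix_measurableI)
    fix i j :: 'm
    have "(if i \<le> j then (i, j) else (j, i)) \<in> upper UNIV" by (auto simp: upper_def)
    from measurable_component_singleton[OF this, of "\<lambda>_. lborel :: real measure"]
    show "(\<lambda>u. S u $ i $ j) \<in> borel_measurable (\<Pi>\<^sub>M i\<in>upper UNIV. lborel)" by (cases "i \<le> j") (auto simp: S_def)
  qed
  have [measurable]: "W \<in> borel_measurable borel" unfolding W_def[abs_def] by measurable
  have gm: "gram_matrix \<iota> UNIV u = block (range \<iota>) (\<lambda>i j. S u $ inv \<iota> i $ inv \<iota> j)" for u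
    by (simp add: gram_matrix_def S_usym)
  have weight: "wishart_weight \<iota> UNIV u = W (S u)" for u
    unfolding wishart_weight_def W_def gm det_block_embed[OF \<iota>] posdef_block_embed[OF \<iota>] ..
  have S_gram: "S (gram UNIV y) = transpose (\<chi> i j. y j $ i) ** (\<chi> i j. y j $ i)" for y :: "'m \<Rightarrow> real^'n"
    by (simp add: vec_eq_iff S_usym gram_matrix_gram(2)[OF \<iota>] matrix_matrix_mult_def transpose_def inner_vec_def)
  have m: "(\<lambda>y. (\<chi> i j. y j $ i) :: real^'m::_^'n) \<in> borel_measurable (\<Pi>\<^sub>M j\<in>UNIV. lborel)"
    by (rule matrix_measurableI) simp
  have [measurable]: "(\<lambda>y::real^'m::_^'n. transpose y ** y) \<in> borel_measurable borel"
    by (rule matrix_measurableI) (simp add: matrix_matrix_mult_def transpose_def)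
  have "(\<integral>\<^sup>+y. H (transpose y ** y) \<partial>(lborel :: (real^'m::_^'n) measure)) = (\<integral>\<^sup>+y. H (S (gram UNIV y)) \<partial>(\<Pi>\<^sub>M j\<in>(UNIV::'m set). lborel :: (real^'n) measure))"
    by (subst lborel_columns) (simp add: nn_integral_distr[OF m] S_gram)
  also have "\<dots> = ennreal (wishart_const CARD('n) CARD('m)) * (\<integral>\<^sup>+u. wishart_weight \<iota> UNIV u * H (S u) \<partial>(\<Pi>\<^sub>M i\<in>upper UNIV. lborel))"
    by (rule nn_integral_gram[OF \<iota>]) measurable
  also have "(\<integral>\<^sup>+u. wishart_weight \<iota> UNIV u * H (S u) \<partial>(\<Pi>\<^sub>M i\<in>upper UNIV. lborel)) = (\<integral>\<^sup>+r. W r * H r \<partial>sym_lborel)"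
    unfolding sym_lborel_def U weight S_def[symmetric] by (subst nn_integral_distr) auto
  finally show ?thesis by (simp add: W_def)
qed

section \<open>Invariant measure and polar coordinates\<close>

text \<open>\<sigma>_(n,m) is the product of the areas of the unit spheres in dimensions n, ...,
  n-m+1, while each \<open>sphere_const\<close> is half such an area. The induction checks that the
  powers of \<pi> add up to n m/2 - m (m-1)/4.\<close>

lemma wishart_const_eq:
  assumes "m \<le> n"
  shows "wishart_const n m = stiefel_mass n m / 2 ^ m"
  using assms
proof (induction m)
  case 0
  thus ?case by (simp add: wishart_const_def stiefel_mass_def multi_Gamma_def)
next
  case (Suc m)
  define P where "P = (\<Prod>j<m. Gamma (real n / 2 - real j / 2))"
  have mm: "real (m * (m - 1)) = real m * (real m - 1)" by (cases m) (auto simp: algebra_simps)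
  hence IH: "wishart_const n m = pi powr (real n * real m / 2) / (pi powr (real m * (real m - 1) / 4) * P)"
    using Suc unfolding stiefel_mass_def multi_Gamma_def P_def[symmetric] mm by simp
  have "sphere_const (n - m) = pi powr (real n / 2 - real m / 2) / Gamma (real n / 2 - real m / 2)"
    using Suc.prems by (simp add: sphere_const_def of_nat_diff diff_divide_distrib)
  hence "wishart_const n (Suc m) = pi powr (real n * real m / 2) * pi powr (real n / 2 - real m / 2) /
      (pi powr (real m * (real m - 1) / 4) * (P * Gamma (real n / 2 - real m / 2)))"
    using IH by (simp add: wishart_const_def)
  also have "\<dots> = pi powr (real n * real m / 2 + (real n / 2 - real m / 2) - real m * (real m - 1) / 4) / (P * Gamma (real n / 2 - real m / 2))"
    by (simp add: powr_add powr_diff)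
  also have "real n * real m / 2 + (real n / 2 - real m / 2) - real m * (real m - 1) / 4 =
      real n * real (Suc m) / 2 - real (Suc m) * real m / 4"
    by (simp add: field_simps)
  also have "pi powr (real n * real (Suc m) / 2 - real (Suc m) * real m / 4) / (P * Gamma (real n / 2 - real m / 2)) =
      stiefel_mass n (Suc m) / 2 ^ Suc m"
    by (simp add: stiefel_mass_def multi_Gamma_def P_def powr_diff del: mult_Suc mult_Suc_right of_nat_Suc)
  finally show ?case .
qed

lemma stiefel_mass_pos: "m \<le> n \<Longrightarrow> stiefel_mass n m > 0"
proof -
  assume m: "m \<le> n"
  have "wishart_const n m > 0" unfolding wishart_const_def
    using m by (intro prod_pos) (auto intro: sphere_const_pos)
  thus ?thesis using wishart_const_eq[OF m] by (simp add: zero_less_divide_iff)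
qed

lemma stiefel_closed: "closed (stiefel :: (real^'m^'n) set)"
proof -
  have "continuous_on UNIV (\<lambda>v::real^'m^'n. transpose v ** v)"
    by (simp add: continuous_on_componentwise[where 'b="real^'m^'m"] Basis_matrix inner_matrix_axis
        matrix_matrix_mult_def transpose_def) (intro allI continuous_intros)
  thus ?thesis unfolding stiefel_def by (intro closed_Collect_eq continuous_intros) auto
qed

lemma stiefel_measurable [measurable]: "stiefel \<in> sets borel"
  using stiefel_closed by (rule borel_closed)

lemma matrix_mult_measurable [measurable]:
  fixes f :: "'a \<Rightarrow> real^'p^'n" and g :: "'a \<Rightarrow> real^'m^'p"
  assumes [measurable]: "f \<in> borel_measurable M" "g \<in> borel_measurable M"
  shows "(\<lambda>x. f x ** g x) \<in> borel_measurable M"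
  by (rule matrix_measurableI) (simp add: matrix_matrix_mult_def)

lemma transpose_measurable [measurable]:
  fixes f :: "'a \<Rightarrow> real^'m^'n"
  assumes [measurable]: "f \<in> borel_measurable M"
  shows "(\<lambda>x. transpose (f x)) \<in> borel_measurable M"
  by (rule matrix_measurableI) (simp add: transpose_def)

section \<open>Measurable inverses, square roots and polar factors\<close>

lemma matrix_inv_cramer:
  fixes A :: "real^'n^'n"
  assumes "det A \<noteq> 0"
  shows "matrix_inv A $ k $ j = det (\<chi> i l. if l = k then axis j 1 $ i else A $ i $ l) / det A"
proof -
  have "A ** matrix_inv A = mat 1"
    using assms someI_ex[of "\<lambda>r'. A ** r' = mat 1 \<and> r' ** A = mat 1"]
    by (simp add: invertible_det_nz[symmetric] invertible_def matrix_inv_def)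
  hence "A *v (matrix_inv A *v axis j 1) = axis j 1" by (simp add: matrix_vector_mul_assoc)
  hence "matrix_inv A *v axis j 1 = (\<chi> k. det (\<chi> i l. if l = k then axis j 1 $ i else A $ i $ l) / det A)"
    using cramer[OF assms] by blast
  moreover have "matrix_inv A $ k $ j = (matrix_inv A *v axis j 1) $ k"
    by (simp add: matrix_vector_mult_basis column_def)
  ultimately show ?thesis by simp
qed

text \<open>By the Cramer rule the entries of the inverse are quotients of determinants; the
  fallback \<open>mat 1\<close> replaces the unspecified value at singular matrices.\<close>

lemma matrix_inv_measurable:
  "(\<lambda>A::real^'n^'n. if det A \<noteq> 0 then matrix_inv A else mat 1) \<in> borel_measurable borel"
proof (rule matrix_measurableI)
  fix k j :: 'n
  have [measurable]: "(\<lambda>A::real^'n^'n. (\<chi> i l. if l = k then axis j 1 $ i else A $ i $ l) :: real^'n^'n) \<in> borel_measurable borel"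
  proof (rule matrix_measurableI)
    fix i l
    show "(\<lambda>A::real^'n^'n. (\<chi> i l. if l = k then axis j 1 $ i else A $ i $ l) $ i $ l) \<in> borel_measurable borel"
      by (cases "l = k") auto
  qed
  have "(\<lambda>A::real^'n^'n. if det A \<noteq> 0 then det (\<chi> i l. if l = k then axis j 1 $ i else A $ i $ l) / det A else mat 1 $ k $ j) \<in> borel_measurable borel"
    by measurable
  moreover have "(if det A \<noteq> 0 then matrix_inv A else mat 1) $ k $ j =
      (if det A \<noteq> 0 then det (\<chi> i l. if l = k then axis j 1 $ i else A $ i $ l) / det A else mat 1 $ k $ j)" for A :: "real^'n^'n"
    by (simp add: matrix_inv_cramer)
  ultimately show "(\<lambda>A::real^'n^'n. (if det A \<noteq> 0 then matrix_inv A else mat 1) $ k $ j) \<in> borel_measurable borel"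
    by presburger
qed

text \<open>A total version of the root: the fallback \<open>mat 1\<close> keeps it Borel on the
  whole matrix space and always invertible, so that polar factors are defined for every
  matrix.\<close>

definition psqrt :: "real^'n^'n \<Rightarrow> real^'n^'n" where
  "psqrt r = (if r \<in> posdef_cone then posdef_sqrt r else mat 1)"

lemma psqrt_posdef: "psqrt r \<in> posdef_cone"
  by (simp add: psqrt_def posdef_sqrt_posdef mat_1_posdef)

lemma psqrt_measurable [measurable]: "psqrt \<in> borel_measurable borel"
  unfolding psqrt_def[abs_def]
  by (rule borel_measurable_continuous_on_if) (auto intro: continuous_on_posdef_sqrt)

definition polar_factor :: "real^'m^'n \<Rightarrow> real^'m^'n" where
  "polar_factor y = y ** matrix_inv (psqrt (transpose y ** y))"

lemma polar_factor_measurable [measurable]: "polar_factor \<in> borel_measurable borel"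
proof -
  have eq: "(\<lambda>r::real^'m^'m. matrix_inv (psqrt r)) = (\<lambda>r. if det (psqrt r) \<noteq> 0 then matrix_inv (psqrt r) else mat 1)"
  proof
    fix r :: "real^'m^'m"
    have "det (psqrt r) \<noteq> 0" using posdef_det_pos[OF psqrt_posdef[of r]] by simp
    thus "matrix_inv (psqrt r) = (if det (psqrt r) \<noteq> 0 then matrix_inv (psqrt r) else mat 1)" by simp
  qed
  have "(\<lambda>r::real^'m^'m. if det (psqrt r) \<noteq> 0 then matrix_inv (psqrt r) else mat 1) \<in> borel_measurable borel"
    by (rule measurable_compose[OF psqrt_measurable matrix_inv_measurable])
  hence [measurable]: "(\<lambda>r::real^'m^'m. matrix_inv (psqrt r)) \<in> borel_measurable borel"
    by (simp only: eq)
  show ?thesis unfolding polar_factor_def[abs_def] by measurable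
qed

lemma polar_factor_mult: "y = polar_factor y ** psqrt (transpose y ** y)"
  by (simp add: polar_factor_def matrix_mul_assoc[symmetric] posdef_inverse[OF psqrt_posdef])

lemma polar_factor_stiefel:
  assumes y: "transpose y ** y \<in> posdef_cone"
  shows "polar_factor y \<in> stiefel"
proof -
  let ?s = "psqrt (transpose y ** y)"
  have s: "?s ** ?s = transpose y ** y" using posdef_sqrt_square[OF y] y by (simp add: psqrt_def)
  have "transpose (polar_factor y) ** polar_factor y = matrix_inv ?s ** (transpose y ** y) ** matrix_inv ?s"
    by (simp add: polar_factor_def matrix_transpose_mul symmetric_matrix_inv[OF psqrt_posdef] matrix_mul_assoc)
  also have "\<dots> = matrix_inv ?s ** (?s ** ?s) ** matrix_inv ?s" by (simp only: s)
  also have "\<dots> = (matrix_inv ?s ** ?s) ** (?s ** matrix_inv ?s)" by (simp only: matrix_mul_assoc)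
  finally show ?thesis by (simp add: stiefel_def posdef_inverse[OF psqrt_posdef])
qed

lemma polar_factor_mult_left:
  assumes "orthogonal_matrix h" shows "polar_factor (h ** y) = h ** polar_factor y"
proof -
  have "transpose (h ** y) ** (h ** y) = transpose y ** (transpose h ** h) ** y"
    by (simp add: matrix_transpose_mul matrix_mul_assoc)
  also have "\<dots> = transpose y ** y" using assms by (simp add: orthogonal_matrix)
  finally show ?thesis by (simp add: polar_factor_def matrix_mul_assoc)
qed

lemma psqrt_conj:
  fixes h :: "real^'n^'n"
  assumes h: "orthogonal_matrix h" and r: "r \<in> posdef_cone"
  shows "psqrt (transpose h ** r ** h) = transpose h ** psqrt r ** h"
proof -
  have hh: "h ** transpose h = mat 1" using h by (simp add: orthogonal_matrix_def)
  have pd: "transpose h ** r ** h \<in> posdef_cone"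
    by (rule posdef_cone_congruence[OF r orthogonal_matrix_inj[OF h]])
  have "posdef_sqrt (transpose h ** r ** h) = transpose h ** posdef_sqrt r ** h"
  proof (rule posdef_sqrt_eqI)
    show "transpose h ** posdef_sqrt r ** h \<in> posdef_cone"
      by (rule posdef_cone_congruence[OF posdef_sqrt_posdef[OF r] orthogonal_matrix_inj[OF h]])
    have "transpose h ** posdef_sqrt r ** h ** (transpose h ** posdef_sqrt r ** h) =
      transpose h ** posdef_sqrt r ** (h ** transpose h) ** posdef_sqrt r ** h" by (simp only: matrix_mul_assoc)
    also have "\<dots> = transpose h ** (posdef_sqrt r ** posdef_sqrt r) ** h" by (simp add: hh matrix_mul_assoc)
    finally show "transpose h ** posdef_sqrt r ** h ** (transpose h ** posdef_sqrt r ** h) = transpose h ** r ** h"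
      by (simp add: posdef_sqrt_square[OF r])
  qed
  thus ?thesis using pd r by (simp add: psqrt_def)
qed

lemma matrix_inv_eqI: "A ** B = mat 1 \<Longrightarrow> matrix_inv A = B" for A B :: "real^'n^'n"
proof -
  assume AB: "A ** B = mat 1"
  hence BA: "B ** A = mat 1" by (simp add: matrix_left_right_inverse)
  have inv: "A ** matrix_inv A = mat 1 \<and> matrix_inv A ** A = mat 1"
    unfolding matrix_inv_def by (rule someI[of _ B]) (simp add: AB BA)
  have "matrix_inv A = (B ** A) ** matrix_inv A" by (simp add: BA)
  also have "\<dots> = B ** (A ** matrix_inv A)" by (simp only: matrix_mul_assoc)
  also have "\<dots> = B" using inv by simp
  finally show "matrix_inv A = B" .
qed

text \<open>Conjugation by \<open>h\<close> carries over to the unique square root and to its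
  inverse, after which \<open>h ** transpose h\<close> cancels. It is the source of right invariance
  of the averages over O(n).\<close>

lemma polar_factor_mult_right:
  fixes h :: "real^'m^'m"
  assumes h: "orthogonal_matrix h" and y: "transpose y ** y \<in> posdef_cone"
  shows "polar_factor (y ** h) = polar_factor y ** h"
proof -
  let ?s = "psqrt (transpose y ** y)"
  have hh: "h ** transpose h = mat 1" "transpose h ** h = mat 1" using h by (auto simp: orthogonal_matrix_def)
  have "transpose (y ** h) ** (y ** h) = transpose h ** (transpose y ** y) ** h"
    by (simp add: matrix_transpose_mul matrix_mul_assoc)
  hence s: "psqrt (transpose (y ** h) ** (y ** h)) = transpose h ** ?s ** h"
    by (simp add: psqrt_conj[OF h y])
  have "transpose h ** ?s ** h ** (transpose h ** matrix_inv ?s ** h) =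
    transpose h ** ?s ** (h ** transpose h) ** matrix_inv ?s ** h" by (simp only: matrix_mul_assoc)
  also have "\<dots> = transpose h ** (?s ** matrix_inv ?s) ** h" by (simp add: hh matrix_mul_assoc)
  also have "\<dots> = mat 1" by (simp add: posdef_inverse[OF psqrt_posdef] hh)
  finally have "matrix_inv (transpose h ** ?s ** h) = transpose h ** matrix_inv ?s ** h" by (rule matrix_inv_eqI)
  hence "polar_factor (y ** h) = y ** (h ** transpose h) ** matrix_inv ?s ** h"
    unfolding polar_factor_def s by (simp only: matrix_mul_assoc)
  thus ?thesis by (simp add: hh polar_factor_def)
qed

text \<open>The orthogonal polar factor of a square matrix. Under Lebesgue measure on a set
  invariant under O(n) from both sides, its law is again invariant from both sides and plays the
  part of Haar measure.\<close>

definition rand_orth :: "real^'n^'n \<Rightarrow> real^'n^'n" where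
  "rand_orth G = (if det G \<noteq> 0 then polar_factor G else mat 1)"

text \<open>Bounded, hence of finite volume, and open; the radius is chosen so that the identity
  lies inside, which makes the volume positive. Multiplication by orthogonal matrices on either side
  preserves it.\<close>

definition orth_domain :: "(real^'n^'n) set" where
  "orth_domain = {G. det G \<noteq> 0 \<and> norm G < norm (mat 1 :: real^'n^'n) + 1}"

lemma gram_posdef_square: "det G \<noteq> 0 \<Longrightarrow> transpose G ** G \<in> posdef_cone" for G :: "real^'n^'n"
  by (intro gram_posdef) (simp add: inj_matrix_vector_mult invertible_det_nz)

lemma orthogonal_rand_orth: "orthogonal_matrix (rand_orth G)"
  using polar_factor_stiefel[OF gram_posdef_square[of G]]
  by (auto simp: rand_orth_def stiefel_def orthogonal_matrix orthogonal_matrix_id)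

lemma rand_orth_measurable [measurable]: "rand_orth \<in> borel_measurable borel"
  unfolding rand_orth_def[abs_def] by measurable

lemma orth_domain_open: "open (orth_domain :: (real^'n^'n) set)"
proof -
  have "continuous_on UNIV (det :: real^'n^'n \<Rightarrow> real)"
    unfolding det_def[abs_def] by (intro continuous_intros)
  hence "open {G :: real^'n^'n. det G \<noteq> 0}" by (intro open_Collect_neq continuous_intros)
  moreover have "open {G :: real^'n^'n. norm G < norm (mat 1 :: real^'n^'n) + 1}" by (intro open_Collect_less continuous_intros)
  ultimately show ?thesis unfolding orth_domain_def by (simp add: open_Int Collect_conj_eq)
qed

lemma orth_domain_measurable [measurable]: "orth_domain \<in> sets borel"
  using orth_domain_open by (rule borel_open)

lemma orth_domain_emeasure:
  "emeasure lborel (orth_domain :: (real^'n^'n) set) \<noteq> 0" "emeasure lborel (orth_domain :: (real^'n^'n) set) \<noteq> \<infinity>"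
proof -
  have "mat 1 \<in> (orth_domain :: (real^'n^'n) set)" by (simp add: orth_domain_def)
  then obtain e where e: "e > 0" "ball (mat 1) e \<subseteq> (orth_domain :: (real^'n^'n) set)"
    using orth_domain_open open_contains_ball by blast
  have "emeasure lborel (ball (mat 1 :: real^'n^'n) e) \<le> emeasure lborel (orth_domain :: (real^'n^'n) set)"
    using e(2) by (intro emeasure_mono) auto
  thus "emeasure lborel (orth_domain :: (real^'n^'n) set) \<noteq> 0"
    using emeasure_lborel_ball_pos[OF e(1), of "mat 1 :: real^'n^'n"] by auto
  have "bounded (orth_domain :: (real^'n^'n) set)"
    unfolding orth_domain_def bounded_iff by (auto intro!: exI[of _ "norm (mat 1 :: real^'n^'n) + 1"])
  thus "emeasure lborel (orth_domain :: (real^'n^'n) set) \<noteq> \<infinity>"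
    using emeasure_bounded_finite by force
qed

text \<open>An average over O(n) without normalisation: the total mass is the volume of
  \<open>orth_domain\<close>, which is carried along and cancelled at the end.\<close>

definition orth_integral :: "(real^'n^'n \<Rightarrow> ennreal) \<Rightarrow> ennreal" where
  "orth_integral F = (\<integral>\<^sup>+G. indicator orth_domain G * F (rand_orth G) \<partial>lborel)"

text \<open>Left multiplication by \<open>h\<close> preserves Lebesgue measure and the domain, and
  it commutes with taking the polar factor.\<close>

lemma orth_integral_mult_left:
  assumes h: "orthogonal_matrix h" and [measurable]: "F \<in> borel_measurable borel"
  shows "orth_integral (\<lambda>g. F (h ** g)) = orth_integral F"
proof -
  have T: "orthogonal_transformation (\<lambda>x::real^'a^'a. h ** x)" by (rule orthogonal_transformation_matrix_left[OF h])
  have d: "det (h ** G) \<noteq> 0 \<longleftrightarrow> det G \<noteq> 0" for G using det_orthogonal_matrix[OF h] by (auto simp: det_mul)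
  have "indicator orth_domain G * F (h ** rand_orth G) = indicator orth_domain (h ** G) * F (rand_orth (h ** G))" for G
    using orthogonal_transformation_norm[OF T, of G] d[of G]
    by (auto simp: orth_domain_def rand_orth_def indicator_def polar_factor_mult_left[OF h])
  hence "orth_integral (\<lambda>g. F (h ** g)) = (\<integral>\<^sup>+G. indicator orth_domain (h ** G) * F (rand_orth (h ** G)) \<partial>lborel)"
    by (simp add: orth_integral_def)
  also have "\<dots> = orth_integral F"
    unfolding orth_integral_def by (rule nn_integral_lborel_orthogonal[OF T]) measurable
  finally show ?thesis .
qed

lemma orth_integral_mult_right:
  assumes h: "orthogonal_matrix h" and [measurable]: "F \<in> borel_measurable borel"
  shows "orth_integral (\<lambda>g. F (g ** h)) = orth_integral F"
proof -
  have T: "orthogonal_transformation (\<lambda>x::real^'a^'a. x ** h)" by (rule orthogonal_transformation_matrix_right[OF h])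
  have d: "det (G ** h) \<noteq> 0 \<longleftrightarrow> det G \<noteq> 0" for G using det_orthogonal_matrix[OF h] by (auto simp: det_mul)
  have "indicator orth_domain G * F (rand_orth G ** h) = indicator orth_domain (G ** h) * F (rand_orth (G ** h))" for G
    using orthogonal_transformation_norm[OF T, of G] d[of G]
    by (auto simp: orth_domain_def rand_orth_def indicator_def polar_factor_mult_right[OF h gram_posdef_square])
  hence "orth_integral (\<lambda>g. F (g ** h)) = (\<integral>\<^sup>+G. indicator orth_domain (G ** h) * F (rand_orth (G ** h)) \<partial>lborel)"
    by (simp add: orth_integral_def)
  also have "\<dots> = orth_integral F"
    unfolding orth_integral_def by (rule nn_integral_lborel_orthogonal[OF T]) measurable
  finally show ?thesis .
qed

lemma orth_integral_const: "orth_integral (\<lambda>_ :: real^'n^'n. c) = c * emeasure lborel (orth_domain :: (real^'n^'n) set)"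
  for c :: ennreal
  unfolding orth_integral_def by (subst nn_integral_multc) (auto simp: mult.commute)

section \<open>The invariant measure on frames\<close>

definition invariant_stiefel_measure :: "(real^'m^'n) measure \<Rightarrow> bool" where
  "invariant_stiefel_measure M \<longleftrightarrow> sets M = sets (restrict_space borel stiefel) \<and>
     (\<forall>g. orthogonal_matrix g \<longrightarrow> distr M M (\<lambda>v. g ** v) = M) \<and>
     emeasure M (space M) = ennreal (stiefel_mass CARD('n) CARD('m))"

lemma stiefel_transitive:
  fixes v w :: "real^'m^'n"
  assumes "CARD('m) < CARD('n)" "v \<in> stiefel" "w \<in> stiefel"
  obtains h where "orthogonal_matrix h" "v = h ** w"
  using stiefel_rotation_exists[OF assms(1,3,2)] by (metis rotation_matrix_def)

text \<open>Average \<open>F (g v)\<close> over \<open>g\<close> and \<open>v\<close>: the integral over \<open>v\<close> is independent of \<open>g\<close> by invariance,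
  that over \<open>g\<close> is independent of \<open>v\<close> by transitivity.\<close>

lemma nn_integral_invariant_stiefel:
  fixes M :: "(real^'m^'n) measure"
  assumes M: "invariant_stiefel_measure M" and less: "CARD('m) < CARD('n)"
    and w: "w \<in> stiefel" and F [measurable]: "F \<in> borel_measurable borel"
  shows "emeasure lborel (orth_domain :: (real^'n^'n) set) * (\<integral>\<^sup>+v. F v \<partial>M) =
    ennreal (stiefel_mass CARD('n) CARD('m)) * orth_integral (\<lambda>g. F (g ** w))"
proof -
  have sM [measurable_cong]: "sets M = sets (restrict_space borel stiefel)" using M by (simp add: invariant_stiefel_measure_def)
  have spM: "space M = stiefel" using sets_eq_imp_space_eq[OF sM] by (simp add: space_restrict_space)
  interpret finite_measure M
    by standard (use M in \<open>simp add: invariant_stiefel_measure_def\<close>)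
  interpret P: pair_sigma_finite "lborel :: (real^'n^'n) measure" M
    by (intro pair_sigma_finite.intro sigma_finite_lborel sigma_finite_measure)
  have idM [measurable]: "(\<lambda>v. v) \<in> measurable M borel"
    unfolding measurable_cong_sets[OF sM refl] by (rule measurable_restrict_space1) simp
  have FM [measurable]: "H \<in> borel_measurable M" if "H \<in> borel_measurable borel" for H :: "real^'m^'n \<Rightarrow> ennreal"
    using measurable_compose[OF idM that] .
  have inv: "(\<integral>\<^sup>+v. H (g ** v) \<partial>M) = (\<integral>\<^sup>+v. H v \<partial>M)"
    if g: "orthogonal_matrix g" and Hm [measurable]: "H \<in> borel_measurable borel" for g H
  proof -
    have "(\<lambda>v. g ** v) \<in> measurable M borel" by measurable
    hence gm: "(\<lambda>v. g ** v) \<in> measurable M M"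
      unfolding measurable_cong_sets[OF refl sM]
      by (intro measurable_restrict_space2) (auto simp: spM stiefel_mult_left[OF g])
    have "(\<integral>\<^sup>+v. H v \<partial>M) = (\<integral>\<^sup>+v. H v \<partial>distr M M (\<lambda>v. g ** v))"
      using M g by (simp add: invariant_stiefel_measure_def)
    also have "\<dots> = (\<integral>\<^sup>+v. H (g ** v) \<partial>M)"
      by (rule nn_integral_distr[OF gm]) (simp only: measurable_distr_eq1 FM[OF Hm])
    finally show ?thesis ..
  qed
  have "emeasure lborel (orth_domain :: (real^'n^'n) set) * (\<integral>\<^sup>+v. F v \<partial>M) = orth_integral (\<lambda>_ :: real^'n^'n. (\<integral>\<^sup>+v. F v \<partial>M))"
    by (simp add: orth_integral_const mult.commute)
  also have "\<dots> = orth_integral (\<lambda>g. (\<integral>\<^sup>+v. F (g ** v) \<partial>M))"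
    unfolding orth_integral_def by (simp add: inv[OF orthogonal_rand_orth])
  also have "\<dots> = (\<integral>\<^sup>+G. (\<integral>\<^sup>+v. indicator orth_domain G * F (rand_orth G ** v) \<partial>M) \<partial>lborel)"
    unfolding orth_integral_def by (simp add: nn_integral_cmult)
  also have "\<dots> = (\<integral>\<^sup>+v. (\<integral>\<^sup>+G. indicator orth_domain G * F (rand_orth G ** v) \<partial>lborel) \<partial>M)"
    by (rule P.Fubini'[symmetric]) measurable
  also have "\<dots> = (\<integral>\<^sup>+v. orth_integral (\<lambda>g. F (g ** w)) \<partial>M)"
  proof (rule nn_integral_cong)
    fix v assume "v \<in> space M"
    hence "v \<in> stiefel" by (simp add: spM)
    then obtain h where h: "orthogonal_matrix h" "v = h ** w" using stiefel_transitive[OF less _ w] by metis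
    have "(\<integral>\<^sup>+G. indicator orth_domain G * F (rand_orth G ** v) \<partial>lborel) = orth_integral (\<lambda>g. F (g ** h ** w))"
      by (simp add: orth_integral_def h(2) matrix_mul_assoc)
    also have "\<dots> = orth_integral (\<lambda>g. F (g ** w))"
      by (rule orth_integral_mult_right[OF h(1), where F = "\<lambda>g. F (g ** w)"]) measurable
    finally show "(\<integral>\<^sup>+G. indicator orth_domain G * F (rand_orth G ** v) \<partial>lborel) = orth_integral (\<lambda>g. F (g ** w))" .
  qed
  also have "\<dots> = ennreal (stiefel_mass CARD('n) CARD('m)) * orth_integral (\<lambda>g. F (g ** w))"
    using M by (simp add: invariant_stiefel_measure_def mult.commute)
  finally show ?thesis .
qed

text \<open>The image of the random orthogonal matrix under the orbit map of a coordinate frame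
  \<open>w\<close>, suitably scaled; invariance is the left invariance of
  \<open>orth_integral\<close>.\<close>

lemma invariant_stiefel_measure_exists:
  assumes less: "CARD('m) < CARD('n)"
  shows "\<exists>M :: (real^'m^'n) measure. invariant_stiefel_measure M"
proof -
  obtain \<iota> :: "'m \<Rightarrow> 'n" where \<iota>: "inj \<iota>"
    using card_le_inj[of "UNIV::'m set" "UNIV::'n set"] less by auto
  define w :: "real^'m^'n" where "w = (\<chi> i j. if i = \<iota> j then 1 else 0)"
  have "(transpose w ** w) $ i $ j = (mat 1 :: real^'m^'m) $ i $ j" for i j
    using \<iota> by (auto simp: w_def transpose_def matrix_matrix_mult_def mat_def inj_eq
        if_distrib[of "\<lambda>x. x * _"] cong: if_cong)
  hence w: "w \<in> stiefel" by (simp add: stiefel_def vec_eq_iff)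
  let ?S = "restrict_space borel stiefel :: (real^'m^'n) measure" and ?E = "orth_domain :: (real^'n^'n) set"
  define N where "N = density (lborel :: (real^'n^'n) measure) (indicator ?E)"
  \<comment> \<open>Replaces the mass inherited from \<open>orth_domain\<close> by the prescribed
    total mass.\<close>
  define c where "c = ennreal (stiefel_mass CARD('n) CARD('m)) / emeasure lborel ?E"
  have st: "rand_orth G ** w \<in> stiefel" for G by (rule stiefel_mult_left[OF orthogonal_rand_orth w])
  have fm: "(\<lambda>G. rand_orth G ** w) \<in> measurable N ?S"
    by (rule measurable_restrict_space2) (auto simp: st N_def)
  define M where "M = scale_measure c (distr N ?S (\<lambda>G. rand_orth G ** w))"
  have sM: "sets M = sets ?S" by (simp add: M_def)
  have em: "emeasure M A = c * orth_integral (\<lambda>g. indicator A (g ** w))" if A: "A \<in> sets ?S" for A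
  proof -
    have [measurable]: "A \<in> sets borel" using A by (auto simp: sets_restrict_space)
    have "emeasure (distr N ?S (\<lambda>G. rand_orth G ** w)) A = (\<integral>\<^sup>+G. indicator A (rand_orth G ** w) \<partial>N)"
      using A by (simp add: nn_integral_distr[OF fm] flip: nn_integral_indicator)
    also have "\<dots> = orth_integral (\<lambda>g. indicator A (g ** w))"
      unfolding N_def orth_integral_def by (rule nn_integral_density) measurable
    finally show ?thesis by (simp add: M_def)
  qed
  have "distr M M (\<lambda>v. g ** v) = M" if g: "orthogonal_matrix g" for g
  proof (rule measure_eqI)
    fix A assume "A \<in> sets (distr M M (\<lambda>v. g ** v))"
    hence A: "A \<in> sets ?S" by (simp add: sM)
    hence [measurable]: "A \<in> sets borel" by (auto simp: sets_restrict_space)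
    have "(\<lambda>v. g ** v) \<in> measurable ?S ?S"
      by (rule measurable_restrict_space2)
        (auto simp: space_restrict_space stiefel_mult_left[OF g] intro!: measurable_restrict_space1)
    hence gm: "(\<lambda>v. g ** v) \<in> measurable M M" by (simp add: measurable_cong_sets[OF sM sM])
    have spM: "space M = stiefel" using sets_eq_imp_space_eq[OF sM] by (simp add: space_restrict_space)
    have "(\<lambda>v. g ** v) -` A \<inter> space M \<in> sets ?S" using measurable_sets[OF gm] A sM by simp
    hence "emeasure (distr M M (\<lambda>v. g ** v)) A = c * orth_integral (\<lambda>h. indicator ((\<lambda>v. g ** v) -` A \<inter> space M) (h ** w))"
      using A sM by (simp add: emeasure_distr[OF gm] em)
    also have "orth_integral (\<lambda>h. indicator ((\<lambda>v. g ** v) -` A \<inter> space M) (h ** w)) = orth_integral (\<lambda>h. indicator A ((g ** h) ** w))"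
      unfolding orth_integral_def
      by (intro nn_integral_cong arg_cong2[of _ _ _ _ "(*)"] refl)
         (simp add: indicator_def spM st matrix_mul_assoc)
    also have "\<dots> = orth_integral (\<lambda>h. indicator A (h ** w))"
      by (rule orth_integral_mult_left[OF g, where F = "\<lambda>h. indicator A (h ** w)"]) measurable
    finally show "emeasure (distr M M (\<lambda>v. g ** v)) A = emeasure M A" using A by (simp add: em)
  qed simp
  moreover have "emeasure M (space M) = ennreal (stiefel_mass CARD('n) CARD('m))"
  proof -
    have spM: "space M = stiefel" using sets_eq_imp_space_eq[OF sM] by (simp add: space_restrict_space)
    have "emeasure M (space M) = c * orth_integral (\<lambda>g. indicator stiefel (g ** w))"
      unfolding spM by (rule em) (auto simp: sets_restrict_space)
    also have "orth_integral (\<lambda>g. indicator stiefel (g ** w)) = emeasure lborel ?E"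
      using orth_integral_const[where 'n='n, of 1] by (simp add: orth_integral_def st)
    also have "c * emeasure lborel ?E = ennreal (stiefel_mass CARD('n) CARD('m))"
      using orth_domain_emeasure[where 'n='n] by (simp add: c_def ennreal_divide_times ennreal_divide_self less_top zero_less_iff_neq_zero)
    finally show ?thesis .
  qed
  ultimately show ?thesis using sM unfolding invariant_stiefel_measure_def by blast
qed

text \<open>For any invariant measure of the prescribed mass, integrals are expressed through the
  same average over O(n) at one base frame \<open>w\<close>. Positive mass guarantees that such a
  frame exists.\<close>

lemma invariant_stiefel_measure_unique:
  fixes M M' :: "(real^'m^'n) measure"
  assumes M: "invariant_stiefel_measure M" and M': "invariant_stiefel_measure M'" and less: "CARD('m) < CARD('n)"
  shows "M = M'"
proof (rule measure_eqI)
  have sM: "sets M = sets (restrict_space borel stiefel)" "sets M' = sets (restrict_space borel stiefel)"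
    using M M' by (auto simp: invariant_stiefel_measure_def)
  thus "sets M = sets M'" by simp
  fix A assume A: "A \<in> sets M"
  hence [measurable]: "A \<in> sets borel" using sM by (auto simp: sets_restrict_space)
  have "stiefel_mass CARD('n) CARD('m) > 0" using less by (intro stiefel_mass_pos) simp
  hence "emeasure M (space M) \<noteq> 0" using M by (simp add: invariant_stiefel_measure_def)
  hence "space M \<noteq> {}" by auto
  then obtain w :: "real^'m^'n" where w: "w \<in> stiefel"
    using sets_eq_imp_space_eq[OF sM(1)] by (auto simp: space_restrict_space)
  have "emeasure lborel (orth_domain :: (real^'n^'n) set) * (\<integral>\<^sup>+v. indicator A v \<partial>M) =
      emeasure lborel (orth_domain :: (real^'n^'n) set) * (\<integral>\<^sup>+v. indicator A v \<partial>M')"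
    using nn_integral_invariant_stiefel[OF M less w, of "indicator A"]
      nn_integral_invariant_stiefel[OF M' less w, of "indicator A"] by simp
  hence "(\<integral>\<^sup>+v. indicator A v \<partial>M) = (\<integral>\<^sup>+v. indicator A v \<partial>M')"
    using orth_domain_emeasure[where 'n='n] by (simp only: ennreal_mult_cancel_left) simp
  thus "emeasure M A = emeasure M' A" using A sM by simp
qed

text \<open>Existence and uniqueness together unlock the definite description in
  \<open>stiefel_measure\<close>.\<close>

lemma invariant_stiefel_measure:
  assumes less: "CARD('m) < CARD('n)"
  shows "invariant_stiefel_measure (stiefel_measure :: (real^'m^'n) measure)"
proof -
  have "\<exists>!M :: (real^'m^'n) measure. invariant_stiefel_measure M"
    using invariant_stiefel_measure_exists[OF less] invariant_stiefel_measure_unique[OF _ _ less] by blast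
  from theI'[OF this] show ?thesis
    unfolding stiefel_measure_def invariant_stiefel_measure_def .
qed

text \<open>Reading off the upper triangle undoes the symmetrisation, so the measure is mapped onto
  the product of Lebesgue measures; sigma-finiteness pulls back. It is needed for Fubini on pairs
  (r, v).\<close>

lemma sym_lborel_sigma_finite: "sigma_finite_measure (sym_lborel :: (real^'m::{finite,linorder}^'m::_) measure)"
proof -
  let ?U = "{(i, j). i \<le> j} :: ('m \<times> 'm) set"
  interpret product_sigma_finite "\<lambda>_::'m \<times> 'm. lborel :: real measure" by standard
  let ?P = "\<Pi>\<^sub>M i\<in>?U. lborel :: real measure"
  let ?S = "\<lambda>u::'m \<times> 'm \<Rightarrow> real. (\<chi> i j. if i \<le> j then u (i, j) else u (j, i)) :: real^'m::_^'m::_"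
  let ?T = "\<lambda>r::real^'m::_^'m::_. \<lambda>p\<in>?U. r $ fst p $ snd p"
  have S: "?S \<in> borel_measurable ?P"
  proof (rule matrix_measurableI)
    fix i j :: 'm
    have "(if i \<le> j then (i, j) else (j, i)) \<in> ?U" by auto
    from measurable_component_singleton[OF this, of "\<lambda>_. lborel :: real measure"]
    show "(\<lambda>u. ?S u $ i $ j) \<in> borel_measurable ?P" by (cases "i \<le> j") auto
  qed
  have T: "?T \<in> measurable borel ?P" by (rule measurable_restrict) simp
  have "distr (sym_lborel :: (real^'m::_^'m::_) measure) ?P ?T = distr ?P ?P (?T \<circ> ?S)"
    unfolding sym_lborel_def using S T by (rule distr_distr[rotated])
  also have "\<dots> = distr ?P ?P (\<lambda>u. u)"
  proof (rule distr_cong)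
    fix u assume "u \<in> space ?P"
    thus "(?T \<circ> ?S) u = u" by (auto simp: space_PiM PiE_def extensional_def fun_eq_iff)
  qed simp_all
  finally have "distr (sym_lborel :: (real^'m::_^'m::_) measure) ?P ?T = ?P" by simp
  moreover have "sigma_finite_measure ?P" by (rule sigma_finite) simp
  ultimately show ?thesis
    using T by (intro sigma_finite_measure_distr[of _ ?P ?T]) (auto simp: sym_lborel_def)
qed

lemma space_stiefel_measure:
  assumes "CARD('m) < CARD('n)"
  shows "space (stiefel_measure :: (real^'m^'n) measure) = stiefel"
    and "sets (stiefel_measure :: (real^'m^'n) measure) = sets (restrict_space borel stiefel)"
    and "finite_measure (stiefel_measure :: (real^'m^'n) measure)"
proof -
  show s: "sets (stiefel_measure :: (real^'m^'n) measure) = sets (restrict_space borel stiefel)"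
    using invariant_stiefel_measure[OF assms] by (simp add: invariant_stiefel_measure_def)
  show "space (stiefel_measure :: (real^'m^'n) measure) = stiefel"
    using sets_eq_imp_space_eq[OF s] by (simp add: space_restrict_space)
  show "finite_measure (stiefel_measure :: (real^'m^'n) measure)"
    by standard (use invariant_stiefel_measure[OF assms] in \<open>simp add: invariant_stiefel_measure_def\<close>)
qed

lemma stiefel_measure_measurable:
  assumes "CARD('m) < CARD('n)"
  shows "(\<lambda>v. v) \<in> measurable (stiefel_measure :: (real^'m^'n) measure) borel"
  unfolding measurable_cong_sets[OF space_stiefel_measure(2)[OF assms] refl] by (rule measurable_restrict_space1) simp

text \<open>The Jacobian of polar coordinates with respect to \<open>sym_lborel\<close> and
  \<open>stiefel_measure\<close>, including the factor 2^(-m) and the restriction to the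
  cone.\<close>

definition polar_weight :: "nat \<Rightarrow> real^'m^'m \<Rightarrow> real" where
  "polar_weight n r = indicator posdef_cone r * (\<bar>det r\<bar> powr ((real n - real CARD('m) - 1) / 2) / 2 ^ CARD('m))"

lemma polar_weight_nonneg: "polar_weight n r \<ge> 0"
  by (simp add: polar_weight_def)

lemma polar_weight_measurable [measurable]: "polar_weight n \<in> borel_measurable borel"
  unfolding polar_weight_def[abs_def] by measurable

text \<open>Lebesgue measure is unchanged when \<open>y\<close> is replaced by g y, so
  \<open>F\<close> may be averaged over g. The average depends on \<open>y\<close> only through
  \<open>transpose y ** y\<close> and equals a multiple of the frame integral; the Gram law then
  finishes the computation.\<close>

lemma nn_integral_polar:
  fixes F :: "real^'m::{finite,linorder}^'n::finite \<Rightarrow> ennreal"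
  assumes less: "CARD('m) < CARD('n)" and F [measurable]: "F \<in> borel_measurable borel"
  shows "(\<integral>\<^sup>+y. F y \<partial>lborel) =
    (\<integral>\<^sup>+r. ennreal (polar_weight CARD('n) r) * (\<integral>\<^sup>+v. F (v ** psqrt r) \<partial>stiefel_measure) \<partial>sym_lborel)"
proof -
  let ?W = "\<lambda>r :: real^'m::_^'m::_. if r \<in> posdef_cone then ennreal (det r powr ((real CARD('n) - real CARD('m) - 1) / 2)) else 0"
  let ?\<nu> = "stiefel_measure :: (real^'m::_^'n) measure" and ?E = "orth_domain :: (real^'n^'n) set"
  let ?\<sigma> = "ennreal (stiefel_mass CARD('n) CARD('m))"
  note sp = space_stiefel_measure[OF less]
  interpret finite_measure ?\<nu> by (rule sp(3))
  have gm: "(\<lambda>y::real^'m::_^'n. transpose y ** y) \<in> borel_measurable borel"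
    by (intro matrix_mult_measurable transpose_measurable) auto
  note [measurable] = stiefel_measure_measurable[OF less]
  have le: "CARD('m) \<le> CARD('n)" using less by simp
  have \<sigma>: "stiefel_mass CARD('n) CARD('m) > 0" by (rule stiefel_mass_pos[OF le])
  define H where "H r = (\<integral>\<^sup>+v. F (v ** psqrt r) \<partial>?\<nu>)" for r
  have Hb [measurable]: "H \<in> borel_measurable borel" unfolding H_def[abs_def] by measurable
  have Hm: "(\<lambda>y::real^'m::_^'n. H (transpose y ** y)) \<in> borel_measurable lborel"
    using measurable_compose[OF gm Hb] by simp
  have sym [measurable_cong]: "sets (sym_lborel :: (real^'m::_^'m::_) measure) = sets borel" by (simp add: sym_lborel_def)
  \<comment> \<open>Since \<open>y = polar_factor y ** psqrt (transpose y ** y)\<close>, averaging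
    over g y means averaging over frames with the radial part held fixed.\<close>
  have key: "?\<sigma> * orth_integral (\<lambda>g. F (g ** y)) = emeasure lborel ?E * H (transpose y ** y)"
    if y: "transpose y ** y \<in> posdef_cone" for y :: "real^'m::_^'n"
  proof -
    have "emeasure lborel ?E * H (transpose y ** y) = ?\<sigma> * orth_integral (\<lambda>g. F ((g ** polar_factor y) ** psqrt (transpose y ** y)))"
      unfolding H_def
      by (rule nn_integral_invariant_stiefel[OF invariant_stiefel_measure[OF less] less polar_factor_stiefel[OF y]]) measurable
    thus ?thesis by (simp only: matrix_mul_assoc[symmetric] polar_factor_mult[symmetric])
  qed
  \<comment> \<open>Matrices of deficient rank are negligible, because the law of the Gram matrix
    puts no mass outside the cone.\<close>
  have AE: "AE y in (lborel :: (real^'m::_^'n) measure). transpose y ** y \<in> posdef_cone"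
  proof -
    have "(\<integral>\<^sup>+y. indicator (- posdef_cone) (transpose y ** y) \<partial>(lborel :: (real^'m::_^'n) measure)) = 0"
    proof (subst nn_integral_transpose_mult[OF le])
      have "(\<integral>\<^sup>+r. ?W r *
          indicator (- posdef_cone) r \<partial>(sym_lborel :: (real^'m::_^'m::_) measure)) = (\<integral>\<^sup>+r. 0 \<partial>(sym_lborel :: (real^'m::_^'m::_) measure))"
        by (intro nn_integral_cong) simp
      thus "ennreal (wishart_const CARD('n) CARD('m)) * (\<integral>\<^sup>+r. ?W r *
          indicator (- posdef_cone) r \<partial>(sym_lborel :: (real^'m::_^'m::_) measure)) = 0" by simp
    qed measurable
    hence "AE y in (lborel :: (real^'m::_^'n) measure). indicator (- posdef_cone) (transpose y ** y) = (0::ennreal)"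
      by (subst (asm) nn_integral_0_iff_AE) measurable
    thus ?thesis by eventually_elim (auto simp: indicator_def split: if_splits)
  qed
  have "emeasure lborel ?E * (\<integral>\<^sup>+y. F y \<partial>lborel) = (\<integral>\<^sup>+G. indicator ?E G * (\<integral>\<^sup>+y. F y \<partial>lborel) \<partial>lborel)"
    by (simp add: nn_integral_multc)
  also have "\<dots> = (\<integral>\<^sup>+G. indicator ?E G * (\<integral>\<^sup>+y. F (rand_orth G ** y) \<partial>lborel) \<partial>lborel)"
    by (simp add: nn_integral_lborel_orthogonal[OF orthogonal_transformation_matrix_left[OF orthogonal_rand_orth]])
  also have "\<dots> = (\<integral>\<^sup>+G. (\<integral>\<^sup>+y. indicator ?E G * F (rand_orth G ** y) \<partial>lborel) \<partial>lborel)"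
    by (simp add: nn_integral_cmult)
  also have "\<dots> = (\<integral>\<^sup>+y. orth_integral (\<lambda>g. F (g ** y)) \<partial>lborel)"
    unfolding orth_integral_def by (rule lborel_pair.Fubini'[symmetric]) measurable
  finally have "?\<sigma> * (emeasure lborel ?E * (\<integral>\<^sup>+y. F y \<partial>lborel)) = (\<integral>\<^sup>+y. ?\<sigma> * orth_integral (\<lambda>g. F (g ** y)) \<partial>lborel)"
    unfolding orth_integral_def by (subst nn_integral_cmult) simp_all
  also have "\<dots> = (\<integral>\<^sup>+y. emeasure lborel ?E * H (transpose y ** (y :: real^'m::_^'n)) \<partial>lborel)"
    by (rule nn_integral_cong_AE, use AE in eventually_elim) (rule key)
  also have "\<dots> = emeasure lborel ?E * (\<integral>\<^sup>+y. H (transpose y ** (y :: real^'m::_^'n)) \<partial>lborel)"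
    by (rule nn_integral_cmult[OF Hm])
  also have "(\<integral>\<^sup>+y. H (transpose y ** y) \<partial>(lborel :: (real^'m::_^'n) measure)) = ennreal (wishart_const CARD('n) CARD('m)) *
    (\<integral>\<^sup>+r. ?W r * H r \<partial>sym_lborel)"
    by (rule nn_integral_transpose_mult[OF le Hb])
  also have "\<dots> = ?\<sigma> * (\<integral>\<^sup>+r. ennreal (polar_weight CARD('n) r) * H r \<partial>sym_lborel)"
  proof -
    have w: "ennreal (wishart_const CARD('n) CARD('m)) * (?W r * H r) =
       ?\<sigma> * (ennreal (polar_weight CARD('n) r) * H r)" for r :: "real^'m::_^'m::_"
    proof (cases "r \<in> posdef_cone")
      case True
      have "ennreal (wishart_const CARD('n) CARD('m)) * ennreal (det r powr ((real CARD('n) - real CARD('m) - 1) / 2)) = ?\<sigma> * ennreal (polar_weight CARD('n) r)"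
        using \<sigma> True posdef_det_pos[OF True]
        by (simp add: ennreal_mult[symmetric] wishart_const_eq[OF le] polar_weight_def)
      thus ?thesis using True by (simp add: mult.assoc[symmetric])
    qed (simp add: polar_weight_def)
    have "ennreal (wishart_const CARD('n) CARD('m)) *
      (\<integral>\<^sup>+r. ?W r * H r \<partial>sym_lborel) =
      (\<integral>\<^sup>+r. ennreal (wishart_const CARD('n) CARD('m)) * (?W r * H r) \<partial>sym_lborel)"
      by (rule nn_integral_cmult[symmetric]) measurable
    also have "\<dots> = (\<integral>\<^sup>+r. ?\<sigma> * (ennreal (polar_weight CARD('n) r) * H r) \<partial>sym_lborel)" by (simp only: w)
    also have "\<dots> = ?\<sigma> * (\<integral>\<^sup>+r. ennreal (polar_weight CARD('n) r) * H r \<partial>sym_lborel)"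
      by (rule nn_integral_cmult) measurable
    finally show ?thesis .
  qed
  finally have eq: "?\<sigma> * (emeasure lborel ?E * (\<integral>\<^sup>+y. F y \<partial>lborel)) =
    emeasure lborel ?E * (?\<sigma> * (\<integral>\<^sup>+r. ennreal (polar_weight CARD('n) r) * H r \<partial>sym_lborel))" .
  \<comment> \<open>Both constants are positive and finite, so the missing normalisation of the
    averages cancels.\<close>
  have "?\<sigma> * emeasure lborel ?E * (\<integral>\<^sup>+y. F y \<partial>lborel) =
    ?\<sigma> * emeasure lborel ?E * (\<integral>\<^sup>+r. ennreal (polar_weight CARD('n) r) * H r \<partial>sym_lborel)"
    using eq by (simp only: mult.assoc mult.left_commute)
  moreover have "?\<sigma> * emeasure lborel ?E \<noteq> 0" "?\<sigma> * emeasure lborel ?E \<noteq> \<infinity>"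
    using orth_domain_emeasure[where 'n='n] \<sigma> by (auto simp: ennreal_mult_eq_top_iff)
  ultimately show ?thesis unfolding H_def by (simp add: ennreal_mult_cancel_left)
qed

text \<open>Applied to indicators, the nonnegative formula says that Lebesgue measure is an image of
  a weighted product measure. Integrability of \<Phi> transfers to that product, and Fubini for
  Bochner integrals yields the iterated integral.\<close>

lemma integral_polar:
  fixes \<Phi> :: "real^'m::{finite,linorder}^'n::finite \<Rightarrow> complex"
  assumes less: "CARD('m) < CARD('n)" and \<Phi>: "integrable lborel \<Phi>"
  shows "(\<integral>y. \<Phi> y \<partial>lborel) =
    (\<integral>r. polar_weight CARD('n) r *\<^sub>R (\<integral>v. \<Phi> (v ** psqrt r) \<partial>stiefel_measure) \<partial>sym_lborel)"
proof -
  let ?\<nu> = "stiefel_measure :: (real^'m::_^'n) measure" and ?P = "sym_lborel :: (real^'m::_^'m::_) measure"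
  note sp = space_stiefel_measure[OF less]
  interpret \<nu>: finite_measure ?\<nu> by (rule sp(3))
  interpret pair_sigma_finite ?P ?\<nu>
    by (intro pair_sigma_finite.intro sym_lborel_sigma_finite \<nu>.sigma_finite_measure)
  note [measurable] = stiefel_measure_measurable[OF less]
  have sym [measurable_cong]: "sets ?P = sets borel" by (simp add: sym_lborel_def)
  have [measurable]: "\<Phi> \<in> borel_measurable borel" using \<Phi> by auto
  define D where "D = density (?P \<Otimes>\<^sub>M ?\<nu>) (\<lambda>(r, v). ennreal (polar_weight CARD('n) r))"
  have T [measurable]: "(\<lambda>(r, v). v ** psqrt r) \<in> borel_measurable (?P \<Otimes>\<^sub>M ?\<nu>)" by measurable
  have eq: "(lborel :: (real^'m::_^'n) measure) = distr D borel (\<lambda>(r, v). v ** psqrt r)"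
  proof (rule measure_eqI)
    fix A assume "A \<in> sets (lborel :: (real^'m::_^'n) measure)"
    hence [measurable]: "A \<in> sets borel" by simp
    have "emeasure (distr D borel (\<lambda>(r, v). v ** psqrt r)) A = (\<integral>\<^sup>+p. indicator A (case p of (r, v) \<Rightarrow> v ** psqrt r) \<partial>D)"
      by (subst nn_integral_indicator[symmetric], simp, subst nn_integral_distr) (auto simp: D_def)
    also have "\<dots> = (\<integral>\<^sup>+p. (case p of (r, v) \<Rightarrow> ennreal (polar_weight CARD('n) r)) * indicator A (case p of (r, v) \<Rightarrow> v ** psqrt r) \<partial>(?P \<Otimes>\<^sub>M ?\<nu>))"
      unfolding D_def by (rule nn_integral_density) measurable
    also have "\<dots> = (\<integral>\<^sup>+r. (\<integral>\<^sup>+v. ennreal (polar_weight CARD('n) r) * indicator A (v ** psqrt r) \<partial>?\<nu>) \<partial>?P)"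
      by (subst \<nu>.nn_integral_fst[symmetric]) auto
    also have "\<dots> = (\<integral>\<^sup>+r. ennreal (polar_weight CARD('n) r) * (\<integral>\<^sup>+v. indicator A (v ** psqrt r) \<partial>?\<nu>) \<partial>?P)"
      by (intro nn_integral_cong nn_integral_cmult) measurable
    also have "\<dots> = (\<integral>\<^sup>+y. indicator A y \<partial>lborel)"
      by (rule nn_integral_polar[OF less, symmetric]) measurable
    finally show "emeasure lborel A = emeasure (distr D borel (\<lambda>(r, v). v ** psqrt r)) A" by simp
  qed simp
  have TD: "(\<lambda>(r, v). v ** psqrt r) \<in> borel_measurable D" unfolding D_def by simp
  have "integrable D (\<lambda>p. \<Phi> (case p of (r, v) \<Rightarrow> v ** psqrt r))"
    using \<Phi> unfolding eq by (subst (asm) integrable_distr_eq[OF TD]) auto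
  hence int: "integrable (?P \<Otimes>\<^sub>M ?\<nu>) (\<lambda>(r, v). polar_weight CARD('n) r *\<^sub>R \<Phi> (v ** psqrt r))"
    unfolding D_def case_prod_beta
    by (subst (asm) integrable_density) (auto simp: polar_weight_nonneg)
  have "(\<integral>y. \<Phi> y \<partial>lborel) = (\<integral>p. \<Phi> (case p of (r, v) \<Rightarrow> v ** psqrt r) \<partial>D)"
    by (subst eq, rule integral_distr[OF TD]) simp
  also have "\<dots> = (\<integral>(r, v). polar_weight CARD('n) r *\<^sub>R \<Phi> (v ** psqrt r) \<partial>(?P \<Otimes>\<^sub>M ?\<nu>))"
    unfolding D_def case_prod_beta
    by (subst integral_density) (auto simp: polar_weight_nonneg)
  also have "\<dots> = (\<integral>r. (\<integral>v. polar_weight CARD('n) r *\<^sub>R \<Phi> (v ** psqrt r) \<partial>?\<nu>) \<partial>?P)"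
    by (rule integral_fst[OF int, symmetric])
  finally show ?thesis by simp
qed

section \<open>Inversion of the Radon transform\<close>

lemma bij_betw_card_greater: "bij_betw (\<lambda>a::'a::{finite,linorder}. card {b. a < b}) UNIV {..<CARD('a)}"
proof -
  have less: "card {c. b < c} < card {c. a < c}" if "a < b" for a b :: 'a
    using that by (intro psubset_card_mono) auto
  have inj: "inj (\<lambda>a::'a. card {b. a < b})"
    by (rule injI) (metis less less_irrefl neqE)
  moreover have "range (\<lambda>a::'a. card {b. a < b}) = {..<CARD('a)}"
  proof (rule card_subset_eq)
    show "range (\<lambda>a::'a. card {b. a < b}) \<subseteq> {..<CARD('a)}"
      by (auto intro!: psubset_card_mono)
    show "card (range (\<lambda>a::'a. card {b. a < b})) = card {..<CARD('a)}"
      using inj by (simp add: card_image)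
  qed simp
  ultimately show ?thesis by (simp add: bij_betw_def)
qed

text \<open>Counted from the end, the upper rows have positions at least \<open>CARD('l)\<close>,
  beyond every column position when m \<le> n - k; the identity block therefore lies in the lower
  part.\<close>

lemma v0_eq_vstack:
  assumes "CARD('m) \<le> CARD('l)"
  shows "(v0 :: real^'m::{finite,linorder}^('k::{finite,linorder} + 'l::{finite,linorder})) =
    vstack 0 (\<chi> b j. if card {b'. b < b'} = card {j'. j < j'} then 1 else 0)"
proof -
  have "card {j'. j < j'} < CARD('m)" for j :: 'm by (rule psubset_card_mono) auto
  hence "card {j'. j < j'} < CARD('l) + c" for j :: 'm and c using assms by (meson less_le_trans trans_less_add1)
  hence "card {a'. a < a'} + CARD('l) \<noteq> card {j'. j < j'}" for a :: 'k and j :: 'm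
    by (metis add.commute less_irrefl)
  thus ?thesis
    by (auto simp: v0_def vstack_def vec_eq_iff row_from_end_def col_from_end_def split: sum.split)
qed

lemma transpose_xi0_mult: "transpose xi0 ** vstack \<omega> t = t"
proof -
  have "(transpose xi0 ** vstack \<omega> t) $ i $ j = t $ i $ j" for i j
    unfolding matrix_matrix_mult_def UNIV_Plus_UNIV[symmetric]
    by (subst vec_lambda_beta, subst vec_lambda_beta, subst sum.Plus)
       (auto simp: xi0_def transpose_def mat_def if_distrib[of "\<lambda>x. x * _"] cong: if_cong)
  thus ?thesis by (simp add: vec_eq_iff)
qed

text \<open>Reading off the lower block and stacking it under zeros again loses nothing, as
  \<open>v0\<close> vanishes above that block. The upper blocks on the two sides may have different
  sizes.\<close>

lemma xi0_transpose_v0: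
  assumes "CARD('m) \<le> CARD('l)"
  shows "xi0 ** (transpose xi0 ** (v0 :: real^'m::{finite,linorder}^('q::{finite,linorder} + 'l::{finite,linorder}))) =
    (v0 :: real^'m::_^('k::{finite,linorder} + 'l::_))"
  unfolding v0_eq_vstack[OF assms] transpose_xi0_mult xi0_mult ..

lemma v0_stiefel:
  assumes le: "CARD('m) \<le> CARD('l)"
  shows "(v0 :: real^'m::{finite,linorder}^('k::{finite,linorder} + 'l::{finite,linorder})) \<in> stiefel"
proof -
  let ?r = "\<lambda>b::'l. card {b'. b < b'}" and ?c = "\<lambda>j::'m. card {j'. j < j'}"
  let ?v = "v0 :: real^'m::_^('k::_ + 'l::_)"
  have r: "inj ?r" "range ?r = {..<CARD('l)}" using bij_betw_card_greater[where 'a='l] by (auto simp: bij_betw_def)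
  have c: "inj ?c" "range ?c = {..<CARD('m)}" using bij_betw_card_greater[where 'a='m] by (auto simp: bij_betw_def)
  have "(transpose ?v ** ?v) $ i $ j = (mat 1 :: real^'m::_^'m::_) $ i $ j" for i j
  proof -
    have "?c i \<in> range ?r" using c(2) r(2) le by (metis lessThan_iff less_le_trans rangeI)
    then obtain b where b: "?c i = ?r b" by (rule rangeE)
    have rb: "?r b' = ?c i \<longleftrightarrow> b' = b" for b' unfolding b by (rule inj_eq[OF r(1)])
    have cij: "?c i = ?c j \<longleftrightarrow> i = j" by (rule inj_eq[OF c(1)])
    have "(transpose ?v ** ?v) $ i $ j = (\<Sum>b'\<in>UNIV. (if ?r b' = ?c i then 1 else 0) * (if ?r b' = ?c j then 1 else 0))"
      unfolding v0_eq_vstack[OF le] matrix_matrix_mult_def UNIV_Plus_UNIV[symmetric]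
      by (subst vec_lambda_beta, subst vec_lambda_beta, subst sum.Plus) (auto simp: transpose_def)
    also have "\<dots> = (\<Sum>b'\<in>UNIV. if b' = b then (if ?r b' = ?c j then 1 else 0) else 0)"
      by (intro sum.cong refl) (simp add: rb)
    also have "\<dots> = (if i = j then 1 else 0)" using b[symmetric] cij by simp
    finally show ?thesis by (simp add: mat_def)
  qed
  thus ?thesis by (simp add: stiefel_def vec_eq_iff)
qed

text \<open>The matrix \<open>\<xi>\<^sub>0' v\<^sub>0\<close> does not depend on the number of leading zero rows, whence the separate
  type variable \<open>'q\<close>.\<close>

lemma radon_inversion:
  fixes f :: "real^'m::{finite,linorder}^('k::{finite,linorder} + 'l::{finite,linorder}) \<Rightarrow> complex"
    and g :: "real^'m::_^('k::_ + 'l::_) \<Rightarrow> real^('k::_ + 'l::_)^('k::_ + 'l::_)"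
  assumes le: "CARD('m) \<le> CARD('l)" and f: "f \<in> schwartz"
    and g: "\<And>v. v \<in> stiefel \<Longrightarrow> rotation_matrix (g v) \<and> g v ** v0 = v"
  shows "f x = of_real (2 powi (- int CARD('m)) / (2 * pi) ^ (CARD('k + 'l) * CARD('m))) *
    (LINT r:posdef_cone|sym_lborel.
       of_real (\<bar>det r\<bar> powr ((real CARD('k + 'l) - real CARD('m) - 1) / 2)) *
       (LINT v|stiefel_measure.
          exp (- \<i> * of_real (trace (transpose x ** v ** posdef_sqrt r))) *
          fourier (\<lambda>t. radon f (g v ** xi0, t)) (transpose (xi0 :: real^'l::_^('q::{finite,linorder} + 'l::_)) ** v0 ** posdef_sqrt r)))"
proof -
  let ?\<xi>0 = "xi0 :: real^'l::_^('q + 'l::_)"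
  let ?n = "CARD('k + 'l)" and ?m = "CARD('m)"
  \<comment> \<open>The block of k rows is nonempty, so m \<le> n - k gives the strict inequality
    under which the invariant measure and polar coordinates are available.\<close>
  have less: "?m < ?n" using le zero_less_card_finite[where 'a='k] by (simp del: zero_less_card_finite)
  define \<Phi> where "\<Phi> y = cis (- (x \<bullet> y)) * fourier_transform f y" for y
  have \<Phi>: "integrable lborel \<Phi>"
    using integrable_cis_mult[OF schwartz_fourier_transform_integrable[OF f], of "- x"] by (simp add: \<Phi>_def[abs_def])
  let ?inner = "\<lambda>r. LINT v|stiefel_measure.
          exp (- \<i> * of_real (trace (transpose x ** v ** posdef_sqrt r))) *
          fourier (\<lambda>t. radon f (g v ** xi0, t)) (transpose ?\<xi>0 ** v0 ** posdef_sqrt r)"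
  have inner: "?inner r = (LINT v|stiefel_measure. \<Phi> (v ** psqrt r))" if r: "r \<in> posdef_cone" for r :: "real^'m::_^'m::_"
  proof (rule Bochner_Integration.integral_cong[OF refl])
    fix v :: "real^'m::_^('k + 'l)" assume "v \<in> space stiefel_measure"
    hence v: "v \<in> stiefel" by (simp add: space_stiefel_measure(1)[OF less])
    let ?s = "posdef_sqrt r"
    have "fourier (\<lambda>t. radon f (g v ** xi0, t)) (transpose ?\<xi>0 ** v0 ** ?s) = fourier f ((g v ** xi0) ** (transpose ?\<xi>0 ** v0 ** ?s))"
      using g[OF v] by (intro fourier_radon schwartz_integrable f) auto
    \<comment> \<open>The slice is evaluated exactly at the polar point: the projection onto the
      lower block fixes \<open>v0\<close>, and \<open>g v\<close> carries \<open>v0\<close> to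
      \<open>v\<close>.\<close>
    also have "(g v ** xi0) ** (transpose ?\<xi>0 ** v0 ** ?s) = (g v ** (xi0 ** (transpose ?\<xi>0 ** v0))) ** ?s"
      by (simp only: matrix_mul_assoc)
    also have "\<dots> = v ** ?s" using g[OF v] by (simp add: xi0_transpose_v0[OF le])
    finally have "fourier (\<lambda>t. radon f (g v ** xi0, t)) (transpose ?\<xi>0 ** v0 ** ?s) = fourier_transform f (v ** ?s)"
      by (simp add: fourier_eq_fourier_transform)
    moreover have "trace (transpose x ** v ** ?s) = x \<bullet> (v ** ?s)"
      by (simp add: matrix_mul_assoc[symmetric] trace_transpose_mult_eq_inner)
    ultimately show "exp (- \<i> * of_real (trace (transpose x ** v ** ?s))) *
          fourier (\<lambda>t. radon f (g v ** xi0, t)) (transpose ?\<xi>0 ** v0 ** ?s) = \<Phi> (v ** psqrt r)"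
      using r by (simp add: \<Phi>_def cis_conv_exp psqrt_def)
  qed
  have "(2 * pi) ^ (?n * ?m) * f x = (\<integral>y. \<Phi> y \<partial>lborel)"
    using schwartz_fourier_inversion[OF f, of x] by (simp add: \<Phi>_def)
  also have "\<dots> = (\<integral>r. polar_weight ?n r *\<^sub>R (LINT v|stiefel_measure. \<Phi> (v ** psqrt r)) \<partial>sym_lborel)"
    by (rule integral_polar[OF less \<Phi>])
  also have "\<dots> = (\<integral>r. (1 / 2 ^ ?m) *\<^sub>R (indicator posdef_cone r *\<^sub>R (of_real (\<bar>det r\<bar> powr ((real ?n - real ?m - 1) / 2)) * ?inner r)) \<partial>sym_lborel)"
  proof (rule Bochner_Integration.integral_cong[OF refl])
    fix r :: "real^'m::_^'m::_"
    show "polar_weight ?n r *\<^sub>R (LINT v|stiefel_measure. \<Phi> (v ** psqrt r)) =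
      (1 / 2 ^ ?m) *\<^sub>R (indicator posdef_cone r *\<^sub>R (of_real (\<bar>det r\<bar> powr ((real ?n - real ?m - 1) / 2)) * ?inner r))"
    proof (cases "r \<in> posdef_cone")
      case True
      show ?thesis unfolding inner[OF True] using True by (simp add: polar_weight_def scaleR_conv_of_real)
    qed (simp add: polar_weight_def)
  qed
  also have "\<dots> = (1 / 2 ^ ?m) *\<^sub>R (LINT r:posdef_cone|sym_lborel. of_real (\<bar>det r\<bar> powr ((real ?n - real ?m - 1) / 2)) * ?inner r)"
    unfolding set_lebesgue_integral_def by (rule integral_scaleR_right)
  finally have "complex_of_real ((2 * pi) ^ (?n * ?m)) * f x = of_real (1 / 2 ^ ?m) *
    (LINT r:posdef_cone|sym_lborel. of_real (\<bar>det r\<bar> powr ((real ?n - real ?m - 1) / 2)) * ?inner r)"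
    by (simp only: scaleR_conv_of_real of_real_power)
  moreover have "z = a / c * I" if "c * z = a * I" "c \<noteq> 0" for a c z I :: complex
    using that by (simp add: field_simps)
  moreover have "complex_of_real ((2 * pi) ^ (?n * ?m)) \<noteq> 0" by simp
  ultimately have "f x = of_real (1 / 2 ^ ?m) / complex_of_real ((2 * pi) ^ (?n * ?m)) *
    (LINT r:posdef_cone|sym_lborel. of_real (\<bar>det r\<bar> powr ((real ?n - real ?m - 1) / 2)) * ?inner r)"
    by blast
  moreover have "complex_of_real (1 / 2 ^ ?m) / of_real ((2 * pi) ^ (?n * ?m)) = of_real (2 powi (- int ?m) / (2 * pi) ^ (?n * ?m))"
    by (simp add: power_int_minus divide_simps)
  ultimately show ?thesis by (simp only:)
qed

text \<open>Once rotations \<open>g v\<close> are chosen, the right-hand side of the inversion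
  formula depends on the function only through its Radon transform.\<close>

lemma radon_inj:
  assumes le: "CARD('m::{finite,linorder}) \<le> CARD('l::{finite,linorder})"
  shows "inj_on (radon :: (real^'m::_^('k::{finite,linorder} + 'l::_) \<Rightarrow> complex) \<Rightarrow> _) schwartz"
proof (rule inj_onI, rule ext)
  fix f h :: "real^'m::_^('k + 'l) \<Rightarrow> complex" and x
  assume f: "f \<in> schwartz" and h: "h \<in> schwartz" and eq: "radon f = radon h"
  define g where "g v = (SOME g. rotation_matrix g \<and> g ** v0 = v)" for v :: "real^'m::_^('k + 'l)"
  have g: "rotation_matrix (g v) \<and> g v ** v0 = v" if "v \<in> stiefel" for v
  proof -
    have "CARD('m) < CARD('k + 'l)"
      using le zero_less_card_finite[where 'a='k] by (simp del: zero_less_card_finite)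
    from stiefel_rotation_exists[OF this v0_stiefel[OF le] that]
    have "\<exists>g. rotation_matrix g \<and> g ** v0 = v" by blast
    thus ?thesis unfolding g_def by (rule someI_ex)
  qed
  show "f x = h x"
    \<comment> \<open>The type \<open>'q\<close> behind the evaluation point is fixed to the same
      type in both instances, so that the two right-hand sides coincide.\<close>
    using radon_inversion[where 'q = 'k, OF le f g, of x] radon_inversion[where 'q = 'k, OF le h g, of x]
    by (simp only: eq)
qed

theorem theorem4p9:
  fixes n m k :: nat
  assumes "n = CARD('k::{finite,linorder} + 'l::{finite,linorder})"
    and "m = CARD('m::{finite,linorder})"
    and "k = CARD('k)"
    and "1 \<le> m" "m \<le> n" "1 \<le> k" "k \<le> n - 1"
  shows
    "(k \<le> n - m \<longrightarrow>
       inj_on (radon :: (real^'m::_^('k::_ + 'l::_) \<Rightarrow> complex) \<Rightarrow> _) schwartz \<and>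
       (\<forall>f \<in> schwartz. \<forall>g :: real^'m::_^('k::_ + 'l::_) \<Rightarrow> real^('k::_ + 'l::_)^('k::_ + 'l::_).
          (\<forall>v \<in> stiefel. rotation_matrix (g v) \<and> g v ** v0 = v) \<longrightarrow>
          (\<forall>x :: real^'m::_^('k::_ + 'l::_).
             f x = of_real (2 powi (- int m) / (2 * pi) ^ (n * m)) *
               (LINT r:posdef_cone|sym_lborel.
                  of_real (\<bar>det r\<bar> powr ((real n - real m - 1) / 2)) *
                  (LINT v|stiefel_measure.
                     exp (- \<i> * of_real (trace (transpose x ** v ** posdef_sqrt r))) *
                     fourier (\<lambda>t. radon f (g v ** xi0, t))
                       (transpose xi0 ** v0 ** posdef_sqrt r)))))) \<and>
     (k > n - m \<longrightarrow>
       \<not> inj_on (radon :: (real^'m::_^('k::_ + 'l::_) \<Rightarrow> complex) \<Rightarrow> _) schwartz)"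
proof (intro conjI impI ballI allI, goal_cases)
  case 1
  \<comment> \<open>As n - k is \<open>CARD('l)\<close>, the condition on k compares m with the
    number of rows of the offset \<open>t\<close>.\<close>
  hence "CARD('m) \<le> CARD('l)" using assms by simp
  thus ?case by (rule radon_inj)
next
  case (2 f g x)
  hence "CARD('m) \<le> CARD('l)" using assms by simp
  thus ?case unfolding assms(1,2) using 2 by (intro radon_inversion) blast+
next
  case 3
  hence "CARD('l) < CARD('m)" "CARD('m) \<le> CARD('k + 'l)" using assms by simp_all
  thus ?case by (intro radon_not_inj)
qed

end
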